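(* If $f\in W^{1,p}(\mathbb{R}^n)$, $1\leq p\leq \infty$, then $$Sf(x)\leq \sqrt{\frac{n}{n+2}}\; Tf(x)\quad\text{for almost every } x\in\mathbb{R}^n .$$
   Context: Here $n\ge1$. $W^{1,p}(\mathbb{R}^n)$ is the space of functions in $L^p(\mathbb{R}^n)$ with first order weak derivatives in $L^p(\mathbb{R}^n)$. $f_{S(x,t)}$ is the average of (the trace of) $f$ over the sphere $S(x,t)$ of center $x$ and radius $t$ with respect to surface measure (for $n=1$, $f_{S(x,t)}=\frac{f(x+t)+f(x-t)}{2}$), and $f_{B(x,t)}$ is the average of $f$ over the ball $B(x,t)$. The square functions, with values in $[0,\infty]$, are $$Tf(x)=\Big(\int_0^\infty \big|f(x)-f_{S(x,t)}\big|^2\,\frac{dt}{t^3}\Big)^{1/2},\qquad Sf(x)=\Big(\int_0^\infty \big|f(x)-f_{B(x,t)}\big|^2\,\frac{dt}{t^3}\Big)^{1/2}.$$ *)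

theory Defs
  imports "HOL-Analysis.Analysis"
begin

section \<open>Differentiable functions and weak derivatives\<close>

definition partial :: "'n \<Rightarrow> (real^'n \<Rightarrow> real) \<Rightarrow> real^'n \<Rightarrow> real" where
  "partial i f x = frechet_derivative f (at x) (axis i 1)"

fun C_k :: "nat \<Rightarrow> (real^'n \<Rightarrow> real) \<Rightarrow> bool" where
  "C_k 0 f \<longleftrightarrow> continuous_on UNIV f"
| "C_k (Suc k) f \<longleftrightarrow> (\<forall>x. f differentiable (at x)) \<and> (\<forall>i. C_k k (partial i f))"

definition test_function :: "(real^'n \<Rightarrow> real) \<Rightarrow> bool" where
  "test_function \<phi> \<longleftrightarrow> (\<forall>k. C_k k \<phi>) \<and> compact (closure {x. \<phi> x \<noteq> 0})"

definition locally_integrable :: "(real^'n \<Rightarrow> real) \<Rightarrow> bool" where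
  "locally_integrable f \<longleftrightarrow> (\<forall>K. compact K \<longrightarrow> set_integrable lebesgue K f)"

definition has_weak_partial :: "(real^'n \<Rightarrow> real) \<Rightarrow> 'n \<Rightarrow> (real^'n \<Rightarrow> real) \<Rightarrow> bool" where
  "has_weak_partial f i g \<longleftrightarrow>
     locally_integrable f \<and> locally_integrable g \<and>
     (\<forall>\<phi>. test_function \<phi> \<longrightarrow>
        (LINT x|lebesgue. f x * partial i \<phi> x) = - (LINT x|lebesgue. g x * \<phi> x))"

section \<open>The Sobolev space\<close>

definition Lp :: "ennreal \<Rightarrow> (real^'n \<Rightarrow> real) set" where
  "Lp p = {f. f \<in> borel_measurable lebesgue \<and>
     (if p = \<infinity> then \<exists>C. AE x in lebesgue. \<bar>f x\<bar> \<le> C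
      else integrable lebesgue (\<lambda>x. \<bar>f x\<bar> powr enn2real p))}"

definition W1p :: "ennreal \<Rightarrow> (real^'n \<Rightarrow> real) set" where
  "W1p p = {f \<in> Lp p. \<forall>i. \<exists>g \<in> Lp p. has_weak_partial f i g}"

section \<open>Spherical averages of traces\<close>

text \<open>
  The surface measure on the sphere with center \<open>x\<close> and radius \<open>t\<close>, as a Borel measure on the whole
  space. On the unit sphere it is the usual cone construction: the measure of \<open>A\<close> is \<open>n\<close> times the
  volume of \<open>{r \<omega> | 0 < r < 1, \<omega> \<in> A}\<close>; that set consists of the \<open>z \<noteq> 0\<close> in the unit ball with
  \<open>sgn z = z / |z| \<in> A\<close>. It is then transported by \<open>\<omega> \<mapsto> x + t \<omega>\<close> and scaled by \<open>t ^ (n - 1)\<close>. For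
  \<open>n = 1\<close> this gives mass 1 to each of the points \<open>x + t\<close> and \<open>x - t\<close>.
\<close>

definition sphere_measure :: "real^'n \<Rightarrow> real \<Rightarrow> (real^'n) measure" where
  "sphere_measure x t =
     scale_measure (ennreal (real CARD('n) * t ^ (CARD('n) - 1)))
       (distr (restrict_space lborel (ball 0 1 - {0})) borel (\<lambda>z. x + t *\<^sub>R sgn z))"

text \<open>
  The trace on the sphere is the value of the trace operator from \<open>W\<^sup>1\<^sup>,\<^sup>1\<close> of the ball to \<open>L\<^sup>1\<close> of the
  sphere, the continuous extension of the restriction of \<open>C\<^sup>1\<close> functions. The exponent 1 covers
  all \<open>W\<^sup>1\<^sup>,\<^sup>p\<close>, since balls have finite measure; \<open>C\<^sup>1\<close> functions are not dense for \<open>p = \<infinity>\<close>.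
  The trace is determined up to null sets for the surface measure.
\<close>

definition is_sphere_trace ::
    "(real^'n \<Rightarrow> real) \<Rightarrow> real^'n \<Rightarrow> real \<Rightarrow> (real^'n \<Rightarrow> real) \<Rightarrow> bool" where
  "is_sphere_trace f x t g \<longleftrightarrow>
     integrable (sphere_measure x t) g \<and>
     (\<exists>G \<phi>. (\<forall>i. has_weak_partial f i (G i)) \<and>
        (\<forall>k. C_k 1 (\<phi> k)) \<and>
        (\<lambda>k. \<integral>\<^sup>+y\<in>ball x t. ennreal \<bar>\<phi> k y - f y\<bar> \<partial>lebesgue) \<longlonglongrightarrow> 0 \<and>
        (\<forall>i. (\<lambda>k. \<integral>\<^sup>+y\<in>ball x t. ennreal \<bar>partial i (\<phi> k) y - G i y\<bar> \<partial>lebesgue) \<longlonglongrightarrow> 0) \<and>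
        (\<lambda>k. \<integral>\<^sup>+y. ennreal \<bar>\<phi> (k::nat) y - g y\<bar> \<partial>sphere_measure x t) \<longlonglongrightarrow> 0)"

definition sphere_trace :: "(real^'n \<Rightarrow> real) \<Rightarrow> real^'n \<Rightarrow> real \<Rightarrow> real^'n \<Rightarrow> real" where
  "sphere_trace f x t = (SOME g. is_sphere_trace f x t g)"

definition sphere_avg :: "(real^'n \<Rightarrow> real) \<Rightarrow> real^'n \<Rightarrow> real \<Rightarrow> real" where
  "sphere_avg f x t =
     (LINT y|sphere_measure x t. sphere_trace f x t y) / measure (sphere_measure x t) (sphere x t)"

definition ball_avg :: "(real^'n \<Rightarrow> real) \<Rightarrow> real^'n \<Rightarrow> real \<Rightarrow> real" where
  "ball_avg f x t = (LINT y:ball x t|lebesgue. f y) / measure lebesgue (ball x t)"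

section \<open>The square functions\<close>

definition ennreal_sqrt :: "ennreal \<Rightarrow> ennreal" where
  "ennreal_sqrt a = (if a = \<infinity> then \<infinity> else ennreal (sqrt (enn2real a)))"

definition T_fun :: "(real^'n \<Rightarrow> real) \<Rightarrow> real^'n \<Rightarrow> ennreal" where
  "T_fun f x = ennreal_sqrt
     (\<integral>\<^sup>+t\<in>{0<..}. ennreal (\<bar>f x - sphere_avg f x t\<bar>\<^sup>2 / t ^ 3) \<partial>lebesgue)"

definition S_fun :: "(real^'n \<Rightarrow> real) \<Rightarrow> real^'n \<Rightarrow> ennreal" where
  "S_fun f x = ennreal_sqrt
     (\<integral>\<^sup>+t\<in>{0<..}. ennreal (\<bar>f x - ball_avg f x t\<bar>\<^sup>2 / t ^ 3) \<partial>lebesgue)"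

end

theory Submission
  imports Defs
begin

text \<open>
  The average of \<open>f\<close> over \<open>B(x,t)\<close> is the average of its spherical averages over \<open>S(x,r)\<close>, \<open>0 < r < t\<close>,
  with respect to \<open>n r ^ (n - 1) / t ^ n dr\<close>. Jensen's inequality bounds \<open>\<bar>f(x) - f_B(x,t)\<bar>\<^sup>2\<close> by the
  corresponding average of \<open>\<bar>f(x) - f_S(x,r)\<bar>\<^sup>2\<close>, and Tonelli's theorem together with
  \<open>\<integral> n r ^ (n - 1) / t ^ (n + 3) dt = n / (n + 2) / r ^ 3\<close> over \<open>t > r\<close> gives the constant.

  For Sobolev functions the first statement is obtained from the identity
  \<open>t \<integral>\<^sub>S \<phi> = \<integral>\<^sub>B (n \<phi> + (y - x) \<bullet> \<nabla>\<phi>)\<close> for \<open>C\<^sup>1\<close> functions. Its analogue for \<open>\<bar>\<phi>\<bar>\<close> is a trace inequality,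
  so mollification produces a trace on every sphere, and the identity determines the integral of the
  trace from \<open>f\<close> and its weak gradient. The inequality therefore holds at every point \<open>x\<close>.
\<close>

section \<open>Polar coordinates\<close>

text \<open>The obstacle is \<open>sphere_avg\<close>: its trace is picked by \<open>SOME\<close>,
  separately for every radius, so neither measurability in the radius nor any relation between
  neighbouring spheres comes with the definition. Both are recovered from
  \<open>surface_integral\<close>, a solid integral that does not mention traces and varies
  continuously with the radius. The identity behind it is the divergence theorem for the field
  \<phi>(y) (y - x): on the sphere of radius t the vector y - x has normal component t, so the flux
  is t times the surface integral. Along each ray this is only the fundamental theorem of calculus.
  Rays are natural here because \<open>sphere_measure\<close> is a cone measure: directions are
  \<open>sgn z\<close> with z in the unit ball, and polar coordinates become a statement on products
  of Lebesgue measures. A trace may be witnessed by a weak gradient other than the fixed one, whence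
  the uniqueness of weak derivatives.\<close>

lemma borel_measurable_sgn_vector [measurable]: "(sgn :: 'a::euclidean_space \<Rightarrow> 'a) \<in> borel_measurable borel"
  unfolding sgn_div_norm by measurable

lemma ball_in_borel [measurable]: "ball x r \<in> sets borel"
  by simp

lemma nn_integral_lborel_affine:
  fixes F :: "'a::euclidean_space \<Rightarrow> ennreal"
  assumes [measurable]: "F \<in> borel_measurable borel" and "c \<noteq> 0"
  shows "(\<integral>\<^sup>+y. F y \<partial>lborel) = ennreal (\<bar>c\<bar> ^ DIM('a)) * (\<integral>\<^sup>+y. F (t + c *\<^sub>R y) \<partial>lborel)"
  by (subst lborel_affine[OF assms(2), of t])
    (simp add: nn_integral_density nn_integral_distr nn_integral_cmult)

text \<open>The antiderivative is \<open>- (1 / s ^ N)\<close>, which vanishes at infinity. It is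
  applied twice: with N = n it cancels the Jacobian in polar coordinates, with N = n + 2 it produces
  the constant of the theorem.\<close>

lemma nn_integral_inverse_power_tail:
  fixes a :: real
  assumes "a > 0" "N > 0"
  shows "(\<integral>\<^sup>+s. indicator {a<..} s * ennreal (real N / s ^ Suc N) \<partial>lborel) = ennreal (1 / a ^ N)"
proof -
  have ae: "AE s in lborel. s \<noteq> a" by (rule AE_lborel_singleton)
  have "(\<integral>\<^sup>+s. indicator {a<..} s * ennreal (real N / s ^ Suc N) \<partial>lborel)
      = (\<integral>\<^sup>+s. ennreal (real N / s ^ Suc N) * indicator {a..} s \<partial>lborel)"
    by (rule nn_integral_cong_AE, use ae in eventually_elim) (auto split: split_indicator)
  also have "\<dots> = ennreal (0 - (- (1 / a ^ N)))"
  proof (rule nn_integral_FTC_atLeast)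
    show "((\<lambda>s. - (1 / s ^ N)) has_real_derivative real N / s ^ Suc N) (at s)" if "a \<le> s" for s
    proof -
      have "s \<noteq> 0" using that assms by auto
      moreover obtain m where "N = Suc m" using \<open>N > 0\<close> by (cases N) auto
      ultimately show ?thesis
        by (auto intro!: derivative_eq_intros simp del: of_nat_Suc)
          (cases m; simp add: field_simps)
    qed
    have "filterlim (\<lambda>s::real. s ^ N) at_top at_top"
      by (rule filterlim_pow_at_top[OF \<open>N > 0\<close> filterlim_ident])
    from tendsto_minus[OF tendsto_divide_0[OF tendsto_const filterlim_at_top_imp_at_infinity[OF this], of 1]]
    show "((\<lambda>s::real. - (1 / s ^ N)) \<longlongrightarrow> 0) at_top"
      by simp
  qed (use assms in auto)
  finally show ?thesis by simp
qed

theorem nn_integral_polar: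
  fixes F :: "'a::euclidean_space \<Rightarrow> ennreal"
  assumes [measurable]: "F \<in> borel_measurable borel"
  shows "(\<integral>\<^sup>+y. F y \<partial>lborel) = (\<integral>\<^sup>+z. \<integral>\<^sup>+r. indicator (ball 0 1) z * indicator {0<..} r *
           ennreal (DIM('a) * r ^ (DIM('a) - 1)) * F (r *\<^sub>R sgn z) \<partial>lborel \<partial>lborel)"
proof -
  \<comment> \<open>Substituting \<open>r = s * norm z\<close> and then \<open>w = s *\<^sub>R z\<close> makes the angular variable disappear.\<close>
  define N where "N = DIM('a)"
  have N: "N > 0" by (simp add: N_def)
  have ae: "AE z in lborel. z \<noteq> (0::'a)" by (rule AE_lborel_singleton)
  have pow: "a * a ^ (N - 1) = a ^ N" for a :: real
    using N by (cases N) auto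
  have "(\<integral>\<^sup>+z. \<integral>\<^sup>+r. indicator (ball 0 1) (z::'a) * indicator {0<..} r *
           ennreal (N * r ^ (N - 1)) * F (r *\<^sub>R sgn z) \<partial>lborel \<partial>lborel)
      = (\<integral>\<^sup>+z. \<integral>\<^sup>+s. indicator (ball 0 1) z * indicator {0<..} s *
           ennreal (N * s ^ (N - 1) * norm z ^ N) * F (s *\<^sub>R z) \<partial>lborel \<partial>lborel)"
  proof (rule nn_integral_cong_AE, use ae in eventually_elim)
    fix z :: 'a assume z: "z \<noteq> 0"
    have "(\<integral>\<^sup>+r. indicator (ball 0 1) z * indicator {0<..} r *
           ennreal (N * r ^ (N - 1)) * F (r *\<^sub>R sgn z) \<partial>lborel)
        = ennreal \<bar>norm z\<bar> * (\<integral>\<^sup>+s. indicator (ball 0 1) z * indicator {0<..} (0 + norm z * s) *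
           ennreal (N * (0 + norm z * s) ^ (N - 1)) * F ((0 + norm z * s) *\<^sub>R sgn z) \<partial>lborel)"
      by (rule nn_integral_real_affine) (measurable, use z in simp)
    also have "\<dots> = (\<integral>\<^sup>+s. indicator (ball 0 1) z * indicator {0<..} s *
           ennreal (N * s ^ (N - 1) * norm z ^ N) * F (s *\<^sub>R z) \<partial>lborel)"
    proof (subst nn_integral_cmult[symmetric], (measurable)[1], rule nn_integral_cong)
      fix s :: real
      show "ennreal \<bar>norm z\<bar> * (indicator (ball 0 1) z * indicator {0<..} (0 + norm z * s) *
           ennreal (N * (0 + norm z * s) ^ (N - 1)) * F ((0 + norm z * s) *\<^sub>R sgn z))
          = indicator (ball 0 1) z * indicator {0<..} s *
           ennreal (N * s ^ (N - 1) * norm z ^ N) * F (s *\<^sub>R z)"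
      proof (cases "s > 0")
        case True
        have 1: "(norm z * s) *\<^sub>R sgn z = s *\<^sub>R z" using z by (simp add: sgn_div_norm)
        have 2: "ennreal (norm z) * ennreal (N * (norm z * s) ^ (N - 1))
            = ennreal (N * s ^ (N - 1) * norm z ^ N)"
          using True by (simp add: ennreal_mult[symmetric] pow[symmetric] power_mult_distrib mult_ac)
        show ?thesis unfolding 2[symmetric] using True z 1
          by (auto split: split_indicator simp: mult_ac)
      qed (use z in \<open>auto split: split_indicator simp: zero_less_mult_iff\<close>)
    qed
    finally show "(\<integral>\<^sup>+r. indicator (ball 0 1) z * indicator {0<..} r *
           ennreal (N * r ^ (N - 1)) * F (r *\<^sub>R sgn z) \<partial>lborel)
        = (\<integral>\<^sup>+s. indicator (ball 0 1) z * indicator {0<..} s *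
           ennreal (N * s ^ (N - 1) * norm z ^ N) * F (s *\<^sub>R z) \<partial>lborel)" .
  qed
  also have "\<dots> = (\<integral>\<^sup>+s. \<integral>\<^sup>+z. indicator (ball 0 1) z * indicator {0<..} s *
           ennreal (N * s ^ (N - 1) * norm z ^ N) * F (s *\<^sub>R z) \<partial>lborel \<partial>lborel)"
    by (rule lborel_pair.Fubini') measurable
  \<comment> \<open>With w = s z the Jacobian is \<open>s ^ N\<close>, so
    \<open>s ^ (N - 1) * norm z ^ N\<close> turns into \<open>norm w ^ N / s ^ Suc N\<close>, and
    the constraint norm z < 1 becomes norm w < s.\<close>
  also have "\<dots> = (\<integral>\<^sup>+s. \<integral>\<^sup>+w. indicator {norm w<..} s * ennreal (N / s ^ Suc N) *
            (ennreal (norm w ^ N) * F w) \<partial>lborel \<partial>lborel)"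
  proof (rule nn_integral_cong)
    fix s :: real
    show "(\<integral>\<^sup>+z. indicator (ball 0 1) z * indicator {0<..} s *
           ennreal (N * s ^ (N - 1) * norm z ^ N) * F (s *\<^sub>R z) \<partial>lborel)
        = (\<integral>\<^sup>+w. indicator {norm w<..} s * ennreal (N / s ^ Suc N) *
            (ennreal (norm w ^ N) * F w) \<partial>lborel)" (is "?L = ?R")
    proof (cases "s > 0")
      case True
      have [measurable]: "(\<lambda>w::'a. indicator {norm w<..} s :: ennreal) \<in> borel_measurable borel"
        by (subst indicator_def) simp
      have "?R = ennreal (\<bar>s\<bar> ^ DIM('a)) * (\<integral>\<^sup>+z. indicator {norm (0 + s *\<^sub>R z)<..} s * ennreal (N / s ^ Suc N) *
            (ennreal (norm (0 + s *\<^sub>R z) ^ N) * F (0 + s *\<^sub>R z)) \<partial>lborel)"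
        by (rule nn_integral_lborel_affine) (measurable, use True in simp)
      also have "\<dots> = ?L"
      proof (subst nn_integral_cmult[symmetric], (measurable)[1], rule nn_integral_cong)
        fix z :: 'a
        have 1: "indicator {norm (0 + s *\<^sub>R z)<..} s = (indicator (ball 0 1) z :: ennreal)"
          using True by (auto split: split_indicator)
        have "s ^ N * (N / s ^ Suc N * (s * norm z) ^ N) = N * s ^ (N - 1) * norm z ^ N"
          using True pow[of s] by (simp add: power_mult_distrib field_simps)
        then have 2: "ennreal (\<bar>s\<bar> ^ DIM('a)) * (ennreal (N / s ^ Suc N) * ennreal (norm (0 + s *\<^sub>R z) ^ N))
            = ennreal (N * s ^ (N - 1) * norm z ^ N)"
          using True by (simp add: ennreal_mult[symmetric] N_def[symmetric] del: power_Suc)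
        show "ennreal (\<bar>s\<bar> ^ DIM('a)) * (indicator {norm (0 + s *\<^sub>R z)<..} s * ennreal (N / s ^ Suc N) *
            (ennreal (norm (0 + s *\<^sub>R z) ^ N) * F (0 + s *\<^sub>R z)))
          = indicator (ball 0 1) z * indicator {0<..} s *
           ennreal (N * s ^ (N - 1) * norm z ^ N) * F (s *\<^sub>R z)"
          unfolding 1 2[symmetric] using True by (simp add: mult_ac)
      qed
      finally show ?thesis by simp
    next
      case False
      have "indicator {norm w<..} s = (0::ennreal)" for w :: 'a
        using False norm_ge_zero[of w] by (auto split: split_indicator simp del: norm_ge_zero)
      then show ?thesis using False by simp
    qed
  qed
  also have "\<dots> = (\<integral>\<^sup>+w. \<integral>\<^sup>+s. indicator {norm w<..} s * ennreal (N / s ^ Suc N) *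
            (ennreal (norm w ^ N) * F w) \<partial>lborel \<partial>lborel)"
  proof (rule lborel_pair.Fubini')
    have [measurable]: "(\<lambda>p::'a \<times> real. indicator {norm (fst p)<..} (snd p) :: ennreal) \<in> borel_measurable (borel \<Otimes>\<^sub>M borel)"
      unfolding indicator_def of_bool_def greaterThan_iff by measurable
    show "(\<lambda>(w::'a, s). indicator {norm w<..} s * ennreal (N / s ^ Suc N) * (ennreal (norm w ^ N) * F w))
      \<in> borel_measurable (lborel \<Otimes>\<^sub>M lborel)"
      by (simp add: case_prod_unfold del: power_Suc)
  qed
  \<comment> \<open>The integral over s > norm w is \<open>1 / norm w ^ N\<close> and cancels the
    factor \<open>norm w ^ N\<close>.\<close>
  also have "\<dots> = (\<integral>\<^sup>+w. F w \<partial>lborel)"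
  proof (rule nn_integral_cong_AE, use ae in eventually_elim)
    fix w :: 'a assume w: "w \<noteq> 0"
    have "(\<integral>\<^sup>+s. indicator {norm w<..} s * ennreal (N / s ^ Suc N) * (ennreal (norm w ^ N) * F w) \<partial>lborel)
        = ennreal (1 / norm w ^ N) * (ennreal (norm w ^ N) * F w)"
      using w N by (subst nn_integral_multc) (simp_all add: nn_integral_inverse_power_tail del: power_Suc)
    also have "\<dots> = F w"
      using w by (simp add: mult.assoc[symmetric] ennreal_mult[symmetric])
    finally show "(\<integral>\<^sup>+s. indicator {norm w<..} s * ennreal (N / s ^ Suc N) * (ennreal (norm w ^ N) * F w) \<partial>lborel) = F w" .
  qed
  finally show ?thesis unfolding N_def by simp
qed

text \<open>The density that makes the image of (z, r) under \<open>r *\<^sub>R sgn z\<close>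
  Lebesgue measure. Directions are not points of a sphere but points z of the unit ball, of which
  only \<open>sgn z\<close> is used.\<close>

definition polar_weight :: "'a::euclidean_space \<times> real \<Rightarrow> real" where
  "polar_weight p = indicator (ball 0 1) (fst p) * indicator {0<..} (snd p) * (real DIM('a) * snd p ^ (DIM('a) - 1))"

lemma polar_weight_measurable [measurable]:
  "polar_weight \<in> borel_measurable (borel \<Otimes>\<^sub>M borel)"
  unfolding polar_weight_def by measurable

lemma polar_weight_nonneg: "0 \<le> polar_weight p"
  by (auto simp: polar_weight_def split: split_indicator)

text \<open>\<open>nn_integral_polar\<close> for indicators, turned into an equality of measures:
  the transfer rules for \<open>distr\<close> and \<open>density\<close> then give integrability and
  the value of Bochner integrals together.\<close>

lemma lborel_eq_polar:
  "(lborel :: 'a::euclidean_space measure) =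
     distr (density (lborel \<Otimes>\<^sub>M lborel) (\<lambda>p. ennreal (polar_weight p))) borel (\<lambda>p. snd p *\<^sub>R sgn (fst p))"
    (is "_ = ?M")
proof (rule measure_eqI)
  fix A :: "'a set" assume "A \<in> sets lborel"
  then have A[measurable]: "A \<in> sets borel" by simp
  have [measurable]: "(\<lambda>p::'a \<times> real. snd p *\<^sub>R sgn (fst p)) \<in> borel_measurable borel"
    by (simp add: case_prod_unfold borel_prod[symmetric])
  have "emeasure ?M A = (\<integral>\<^sup>+y. indicator A y \<partial>?M)"
    using A by (subst nn_integral_indicator) auto
  also have "\<dots> = (\<integral>\<^sup>+p. ennreal (polar_weight p) * indicator A (snd p *\<^sub>R sgn (fst p)) \<partial>(lborel \<Otimes>\<^sub>M lborel))"
    unfolding lborel_prod by (subst nn_integral_distr, measurable, subst nn_integral_density)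
       (auto simp: borel_prod[symmetric])
  also have "\<dots> = (\<integral>\<^sup>+z. \<integral>\<^sup>+r. ennreal (polar_weight (z, r)) * indicator A (r *\<^sub>R sgn z) \<partial>lborel \<partial>lborel)"
    by (subst lborel.nn_integral_fst[symmetric]) (simp_all add: lborel_prod borel_prod[symmetric])
  also have "\<dots> = (\<integral>\<^sup>+z. \<integral>\<^sup>+r. indicator (ball 0 1) z * indicator {0<..} r *
           ennreal (DIM('a) * r ^ (DIM('a) - 1)) * indicator A (r *\<^sub>R sgn z) \<partial>lborel \<partial>lborel)"
    by (intro nn_integral_cong) (auto simp: polar_weight_def split: split_indicator)
  also have "\<dots> = emeasure lborel A"
    by (subst nn_integral_polar[symmetric]) auto
  finally show "emeasure lborel A = emeasure ?M A" by simp
qed simp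

section \<open>Bochner integrals in polar coordinates\<close>

theorem
  fixes F :: "'a::euclidean_space \<Rightarrow> real"
  assumes F: "integrable lborel F"
  shows integrable_polar:
      "integrable (lborel \<Otimes>\<^sub>M lborel) (\<lambda>p. polar_weight p * F (snd p *\<^sub>R sgn (fst p)))"
    and integral_polar: "(LINT y|lborel. F y) =
      (LINT p|(lborel \<Otimes>\<^sub>M lborel). polar_weight p * F (snd p *\<^sub>R sgn (fst p)))"
proof -
  let ?D = "density (lborel \<Otimes>\<^sub>M lborel) (\<lambda>p::'a \<times> real. ennreal (polar_weight p))"
  have m1 [measurable]: "(\<lambda>p::'a \<times> real. snd p *\<^sub>R sgn (fst p)) \<in> measurable ?D borel"
    by (simp add: case_prod_unfold lborel_prod borel_prod[symmetric])
  have m2 [measurable]: "F \<in> borel_measurable borel" using F by simp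
  \<comment> \<open>\<open>lborel\<close> occurs on both sides of \<open>lborel_eq_polar\<close>, so
    the rewriting is done once, in an explicit context.\<close>
  have "integrable (distr ?D borel (\<lambda>p. snd p *\<^sub>R sgn (fst p))) F"
    by (rule subst[OF lborel_eq_polar, of "\<lambda>M. integrable M F"]) (rule F)
  then have "integrable ?D (\<lambda>p. F (snd p *\<^sub>R sgn (fst p)))"
    by (simp add: integrable_distr_eq[OF m1 m2] case_prod_unfold)
  then show "integrable (lborel \<Otimes>\<^sub>M lborel) (\<lambda>p. polar_weight p * F (snd p *\<^sub>R sgn (fst p)))"
    by (subst (asm) integrable_density) (auto simp: polar_weight_nonneg lborel_prod borel_prod[symmetric])
  have "(LINT y|lborel. F y) = (LINT y|distr ?D borel (\<lambda>p. snd p *\<^sub>R sgn (fst p)). F y)"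
    by (rule subst[OF lborel_eq_polar, of "\<lambda>M. integral\<^sup>L lborel F = integral\<^sup>L M F"]) (rule refl)
  also have "\<dots> = (LINT p|?D. F (snd p *\<^sub>R sgn (fst p)))"
    by (simp add: integral_distr[OF m1 m2] case_prod_unfold)
  also have "\<dots> = (LINT p|(lborel \<Otimes>\<^sub>M lborel). polar_weight p * F (snd p *\<^sub>R sgn (fst p)))"
    by (subst integral_density) (auto simp: polar_weight_nonneg lborel_prod borel_prod[symmetric])
  finally show "(LINT y|lborel. F y) =
      (LINT p|(lborel \<Otimes>\<^sub>M lborel). polar_weight p * F (snd p *\<^sub>R sgn (fst p)))" .
qed

text \<open>Both orders of integration are needed: the radius outermost compares spheres with balls,
  the direction outermost allows the fundamental theorem of calculus on each ray.\<close>

lemma integral_polar_snd: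
  fixes F :: "'a::euclidean_space \<Rightarrow> real"
  assumes "integrable lborel F"
  shows "(LINT y|lborel. F y) = (LINT r|lborel. LINT z|lborel. polar_weight (z, r) * F (r *\<^sub>R sgn z))"
  using lborel_pair.integral_snd[of "\<lambda>z r. polar_weight (z, r) * F (r *\<^sub>R sgn z)"]
    integrable_polar[OF assms] integral_polar[OF assms]
  by (simp add: case_prod_unfold)

lemma
  fixes F :: "'a::euclidean_space \<Rightarrow> real"
  assumes "integrable lborel F"
  shows integral_polar_fst: "(LINT y|lborel. F y) = (LINT z|lborel. LINT r|lborel. polar_weight (z, r) * F (r *\<^sub>R sgn z))"
    and integrable_polar_fst: "integrable lborel (\<lambda>z. LINT r|lborel. polar_weight (z, r) * F (r *\<^sub>R sgn z))"
  using lborel_pair.integral_fst[of "\<lambda>z r. polar_weight (z, r) * F (r *\<^sub>R sgn z)"]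
    lborel_pair.integrable_fst[of "\<lambda>z r. polar_weight (z, r) * F (r *\<^sub>R sgn z)"]
    integrable_polar[OF assms] integral_polar[OF assms]
  by (simp_all add: case_prod_unfold)

lemma
  fixes F :: "'a::euclidean_space \<Rightarrow> real"
  assumes F: "F \<in> borel_measurable borel"
  shows integral_lborel_translation: "(LINT y|lborel. F (x + y)) = (LINT y|lborel. F y)"
    and integrable_lborel_translation: "integrable lborel (\<lambda>y. F (x + y)) \<longleftrightarrow> integrable lborel F"
proof -
  have "(LINT y|lborel. F y) = (LINT y|distr lborel borel ((+) x). F y)"
    by (simp add: lborel_distr_plus)
  then show "(LINT y|lborel. F (x + y)) = (LINT y|lborel. F y)"
    using F by (simp add: integral_distr)
  have "integrable lborel F \<longleftrightarrow> integrable (distr lborel borel ((+) x)) F"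
    by (simp add: lborel_distr_plus)
  then show "integrable lborel (\<lambda>y. F (x + y)) \<longleftrightarrow> integrable lborel F"
    using F by (simp add: integrable_distr_eq)
qed

section \<open>Surface integrals\<close>

text \<open>Density of the surface measure in the cone variable: z stands for the point
  \<open>x + t *\<^sub>R sgn z\<close>. The origin stays in the ball, being a null set.\<close>

definition sphere_density :: "real \<Rightarrow> real^'n \<Rightarrow> real" where
  "sphere_density t z = indicator (ball 0 1) z * (real CARD('n) * t ^ (CARD('n) - 1))"

lemma sphere_density_measurable [measurable]: "sphere_density t \<in> borel_measurable borel"
  unfolding sphere_density_def by measurable

lemma sphere_density_nonneg: "0 \<le> t \<Longrightarrow> 0 \<le> sphere_density t z"
  by (auto simp: sphere_density_def)

lemma sets_sphere_measure [simp, measurable_cong]: "sets (sphere_measure x t) = sets borel"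
  by (simp add: sphere_measure_def)

lemma space_sphere_measure [simp]: "space (sphere_measure x t) = UNIV"
  using sets_eq_imp_space_eq[OF sets_sphere_measure] by simp

text \<open>Brings the definition by \<open>scale_measure\<close> and \<open>restrict_space\<close>
  to an image of a density, the shape for which integrals are readily transferred.\<close>

lemma sphere_measure_eq_distr_density:
  fixes x :: "real^'n"
  assumes "0 \<le> t"
  shows "sphere_measure x t =
    distr (density lborel (\<lambda>z. ennreal (sphere_density t z))) borel (\<lambda>z. x + t *\<^sub>R sgn z)"
    (is "_ = ?M")
proof (rule measure_eqI)
  fix A assume "A \<in> sets (sphere_measure x t)"
  then have [measurable]: "A \<in> sets borel" by simp
  let ?c = "real CARD('n) * t ^ (CARD('n) - 1)"
  have ae: "AE z in lborel. z \<noteq> (0::real^'n)" by (rule AE_lborel_singleton)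
  have R: "ball 0 1 - {0::real^'n} \<in> sets lborel" by simp
  have m: "(\<lambda>z. x + t *\<^sub>R sgn z) \<in> measurable (restrict_space lborel (ball 0 1 - {0})) borel"
    by (rule measurable_restrict_space1) simp
  have "emeasure (sphere_measure x t) A = ennreal ?c *
      (\<integral>\<^sup>+z. indicator A z \<partial>distr (restrict_space lborel (ball 0 1 - {0})) borel (\<lambda>z. x + t *\<^sub>R sgn z))"
    unfolding sphere_measure_def by (subst nn_integral_indicator) simp_all
  also have "\<dots> = ennreal ?c * (\<integral>\<^sup>+z. indicator A (x + t *\<^sub>R sgn z) * indicator (ball 0 1 - {0}) z \<partial>lborel)"
    by (subst nn_integral_distr[OF m], simp, subst nn_integral_restrict_space) simp_all
  also have "\<dots> = ennreal ?c * (\<integral>\<^sup>+z. indicator A (x + t *\<^sub>R sgn z) * indicator (ball 0 1) z \<partial>lborel)"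
    by (intro arg_cong2[where f="(*)"] refl nn_integral_cong_AE, use ae in eventually_elim)
      (auto split: split_indicator)
  also have "\<dots> = (\<integral>\<^sup>+z. ennreal ?c * (indicator A (x + t *\<^sub>R sgn z) * indicator (ball 0 1) z) \<partial>lborel)"
    by (rule nn_integral_cmult[symmetric]) measurable
  also have "\<dots> = (\<integral>\<^sup>+z. ennreal (sphere_density t z) * indicator A (x + t *\<^sub>R sgn z) \<partial>lborel)"
    by (intro nn_integral_cong) (auto simp: sphere_density_def split: split_indicator)
  also have "\<dots> = (\<integral>\<^sup>+z. indicator A z \<partial>?M)"
    by (subst nn_integral_distr, measurable, subst nn_integral_density) auto
  also have "\<dots> = emeasure ?M A"
    by (subst nn_integral_indicator) simp_all
  finally show "emeasure (sphere_measure x t) A = emeasure ?M A" .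
qed simp

lemma
  fixes g :: "real^'n \<Rightarrow> real"
  assumes g[measurable]: "g \<in> borel_measurable borel" and t: "0 \<le> t"
  shows integral_sphere_measure: "(LINT y|sphere_measure x t. g y) =
      (LINT z|lborel. sphere_density t z * g (x + t *\<^sub>R sgn z))"
    and integrable_sphere_measure: "integrable (sphere_measure x t) g \<longleftrightarrow>
      integrable lborel (\<lambda>z. sphere_density t z * g (x + t *\<^sub>R sgn z))"
proof -
  show "(LINT y|sphere_measure x t. g y) = (LINT z|lborel. sphere_density t z * g (x + t *\<^sub>R sgn z))"
    unfolding sphere_measure_eq_distr_density[OF t] using sphere_density_nonneg[OF t]
    by (subst integral_distr, simp, simp, subst integral_density) auto
  show "integrable (sphere_measure x t) g \<longleftrightarrow>
      integrable lborel (\<lambda>z. sphere_density t z * g (x + t *\<^sub>R sgn z))"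
    unfolding sphere_measure_eq_distr_density[OF t] using sphere_density_nonneg[OF t]
    by (subst integrable_distr_eq, simp, simp, subst integrable_density) auto
qed

lemma integrable_sphere_density: "integrable lborel (sphere_density t :: real^'n \<Rightarrow> real)"
  unfolding sphere_density_def
  by (intro integrable_mult_left integrable_real_indicator) (auto simp: emeasure_lborel_ball_finite[unfolded infinity_ennreal_def])

lemma finite_measure_sphere_measure:
  assumes t: "0 \<le> t" shows "finite_measure (sphere_measure x t)"
proof -
  have "integrable (sphere_measure x t) (indicator UNIV :: _ \<Rightarrow> real)"
    using integrable_sphere_density[of t] by (simp add: integrable_sphere_measure[OF _ t])
  then show ?thesis
    by (intro finite_measureI) (simp only: integrable_indicator_iff, simp)
qed

text \<open>All points \<open>x + t *\<^sub>R sgn z\<close> with z \<noteq> 0 lie on the sphere, so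
  this is the total mass.\<close>

lemma measure_sphere_measure:
  fixes x :: "real^'n" and t :: real
  assumes t: "0 \<le> t"
  shows "measure (sphere_measure x t) (sphere x t) =
    CARD('n) * t ^ (CARD('n) - 1) * measure lborel (ball 0 1 :: (real^'n) set)"
proof -
  interpret finite_measure "sphere_measure x t" by (rule finite_measure_sphere_measure[OF t])
  have ae: "AE z in lborel. z \<noteq> (0::real^'n)" by (rule AE_lborel_singleton)
  have [measurable]: "sphere x t \<in> sets borel" by simp
  have "measure (sphere_measure x t) (sphere x t) = (LINT y|sphere_measure x t. indicator (sphere x t) y)"
    by simp
  also have "\<dots> = (LINT z|lborel. sphere_density t z * indicator (sphere x t) (x + t *\<^sub>R sgn z))"
    by (rule integral_sphere_measure[OF _ t]) simp
  also have "\<dots> = (LINT z|lborel. sphere_density t (z::real^'n))"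
    by (rule integral_cong_AE, simp, simp, use ae in eventually_elim)
      (use t in \<open>simp add: norm_sgn indicator_def dist_norm\<close>)
  also have "\<dots> = CARD('n) * t ^ (CARD('n) - 1) * measure lborel (ball 0 1 :: (real^'n) set)"
    unfolding sphere_density_def by simp
  finally show ?thesis .
qed

section \<open>Continuously differentiable functions\<close>

lemma C1_partial_continuous: "C_k 1 \<phi> \<Longrightarrow> continuous_on UNIV (partial i \<phi>)"
  by simp

text \<open>Expansion of h in the standard basis. Derivatives are kept in this coordinate form
  throughout, so that \<open>partial_eqI\<close> can read off the partial derivatives.\<close>

lemma has_derivative_partial:
  fixes \<phi> :: "real^'n \<Rightarrow> real"
  assumes "\<phi> differentiable (at y)"
  shows "(\<phi> has_derivative (\<lambda>h. \<Sum>i\<in>UNIV. h $ i * partial i \<phi> y)) (at y)"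
proof -
  let ?D = "frechet_derivative \<phi> (at y)"
  have D: "(\<phi> has_derivative ?D) (at y)"
    using assms by (simp add: frechet_derivative_works)
  then have "linear ?D" by (rule has_derivative_linear)
  have "?D h = (\<Sum>i\<in>UNIV. h $ i * partial i \<phi> y)" for h
  proof -
    have "?D h = ?D (\<Sum>i\<in>UNIV. (h $ i) *\<^sub>R axis i 1)"
      using basis_expansion[of h] by (simp add: scalar_mult_eq_scaleR)
    also have "\<dots> = (\<Sum>i\<in>UNIV. h $ i * partial i \<phi> y)"
      using \<open>linear ?D\<close> by (simp add: linear_sum linear_cmul partial_def)
    finally show ?thesis .
  qed
  with D show ?thesis by (metis (no_types, lifting) ext)
qed

lemma partial_eqI:
  fixes \<phi> :: "real^'n \<Rightarrow> real"
  assumes "(\<phi> has_derivative (\<lambda>h. \<Sum>i\<in>UNIV. h $ i * d i)) (at y)"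
  shows "partial i \<phi> y = d i"
proof -
  have "frechet_derivative \<phi> (at y) = (\<lambda>h. \<Sum>i\<in>UNIV. h $ i * d i)"
    using assms frechet_derivative_at by metis
  then show ?thesis
    by (simp add: partial_def axis_def if_distrib[of "\<lambda>t. t * _"] cong: if_cong)
qed

lemma C1_continuous: "C_k 1 \<phi> \<Longrightarrow> continuous_on UNIV \<phi>"
  by (auto intro!: continuous_at_imp_continuous_on differentiable_imp_continuous_within)

text \<open>If G is the gradient of f, this is the divergence of the vector field f(y) (y - x). The
  gradient is a separate argument so that weak gradients can be inserted.\<close>

definition radial_div :: "real^'n \<Rightarrow> (real^'n \<Rightarrow> real) \<Rightarrow> ('n \<Rightarrow> real^'n \<Rightarrow> real) \<Rightarrow> real^'n \<Rightarrow> real" where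
  "radial_div x f G y = real CARD('n) * f y + (\<Sum>i\<in>UNIV. (y - x) $ i * G i y)"

lemma continuous_radial_div:
  "C_k 1 \<phi> \<Longrightarrow> continuous_on UNIV (radial_div x \<phi> (\<lambda>i. partial i \<phi>))"
  unfolding radial_div_def
  by (intro continuous_intros C1_continuous C1_partial_continuous) simp_all

lemma integrable_continuous_ball:
  fixes h :: "'a::euclidean_space \<Rightarrow> real"
  assumes "continuous_on UNIV h"
  shows "integrable lborel (\<lambda>y. indicator (ball x t) y * h y)"
proof -
  have [measurable]: "h \<in> borel_measurable borel"
    using assms by (rule borel_measurable_continuous_onI)
  have "integrable lborel (\<lambda>y. indicator (cball x t) y *\<^sub>R h y)"
    by (rule borel_integrable_compact) (use assms continuous_on_subset in auto)
  then show ?thesis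
    by (rule Bochner_Integration.integrable_bound) (auto split: split_indicator)
qed

text \<open>The integrand is the derivative of \<open>r ^ n * \<phi> (x + r *\<^sub>R w)\<close>:
  one factor r of \<open>r ^ n\<close> turns the directional derivative along w into the one along y
  - x.\<close>

lemma radial_FTC:
  fixes \<phi> :: "real^'n \<Rightarrow> real" and x :: "real^'n"
  assumes \<phi>: "C_k 1 \<phi>" and t: "0 \<le> t"
  defines "D \<equiv> radial_div x \<phi> (\<lambda>i. partial i \<phi>)"
  shows "has_bochner_integral lborel (\<lambda>r. indicator {0..t} r *\<^sub>R (r ^ (CARD('n) - 1) * D (x + r *\<^sub>R w)))
    (t ^ CARD('n) * \<phi> (x + t *\<^sub>R w))"
proof -
  let ?N = "CARD('n)"
  have D: "continuous_on UNIV D" unfolding D_def by (rule continuous_radial_div[OF \<phi>])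
  have "has_bochner_integral lborel (\<lambda>r. indicator {0..t} r *\<^sub>R (r ^ (?N - 1) * D (x + r *\<^sub>R w)))
    (t ^ ?N * \<phi> (x + t *\<^sub>R w) - 0 ^ ?N * \<phi> (x + 0 *\<^sub>R w))"
  proof (rule has_bochner_integral_FTC_Icc[OF t])
    fix r :: real
    have "(\<phi> has_derivative (\<lambda>h. \<Sum>i\<in>UNIV. h $ i * partial i \<phi> (x + r *\<^sub>R w))) (at (x + r *\<^sub>R w))"
      by (rule has_derivative_partial) (use \<phi> in simp)
    moreover have "((\<lambda>r. x + r *\<^sub>R w) has_derivative (\<lambda>s. s *\<^sub>R w)) (at r within {0..t})"
      by (auto intro!: derivative_eq_intros)
    ultimately have "((\<lambda>r. \<phi> (x + r *\<^sub>R w)) has_derivative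
        (\<lambda>s. \<Sum>i\<in>UNIV. (s *\<^sub>R w) $ i * partial i \<phi> (x + r *\<^sub>R w))) (at r within {0..t})"
      by (rule has_derivative_compose[rotated])
    moreover have "(\<lambda>s. \<Sum>i\<in>UNIV. (s *\<^sub>R w) $ i * partial i \<phi> (x + r *\<^sub>R w))
        = (*) (\<Sum>i\<in>UNIV. w $ i * partial i \<phi> (x + r *\<^sub>R w))"
      by (auto simp: sum_distrib_left sum_distrib_right mult_ac)
    ultimately have 1: "((\<lambda>r. \<phi> (x + r *\<^sub>R w)) has_real_derivative
        (\<Sum>i\<in>UNIV. w $ i * partial i \<phi> (x + r *\<^sub>R w))) (at r within {0..t})"
      by (simp add: has_field_derivative_def)
    have "((\<lambda>r. r ^ ?N * \<phi> (x + r *\<^sub>R w)) has_real_derivative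
        r ^ ?N * (\<Sum>i\<in>UNIV. w $ i * partial i \<phi> (x + r *\<^sub>R w)) +
        (?N * r ^ (?N - 1)) * \<phi> (x + r *\<^sub>R w)) (at r within {0..t})"
      by (rule DERIV_mult[OF _ 1, THEN DERIV_cong]) (auto intro!: derivative_eq_intros)
    moreover have "r ^ ?N = r ^ (?N - 1) * r"
      by (metis One_nat_def power_minus_mult zero_less_card_finite)
    ultimately have "((\<lambda>r. r ^ ?N * \<phi> (x + r *\<^sub>R w)) has_real_derivative
        (r ^ (?N - 1) * D (x + r *\<^sub>R w))) (at r within {0..t})"
      by (elim DERIV_cong) (simp add: D_def radial_div_def algebra_simps sum_distrib_left)
    then show "((\<lambda>r. r ^ ?N * \<phi> (x + r *\<^sub>R w)) has_vector_derivative
        (r ^ (?N - 1) * D (x + r *\<^sub>R w))) (at r within {0..t})"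
      by (simp add: has_real_derivative_iff_has_vector_derivative)
  next
    show "continuous_on {0..t} (\<lambda>r. r ^ (?N - 1) * D (x + r *\<^sub>R w))"
      by (intro continuous_intros continuous_on_compose2[OF D]) auto
  qed
  \<comment> \<open>The boundary term at r = 0 vanishes because the dimension is positive.\<close>
  then show ?thesis by (simp add: zero_power[OF zero_less_card_finite])
qed

text \<open>\<open>radial_FTC\<close> integrated over all directions. The second claim takes
  absolute values on each ray before integrating; it bounds the function on the sphere by function
  and gradient in the ball, and so makes the restrictions of approximating functions converge on the
  sphere.\<close>

lemma
  fixes \<phi> :: "real^'n \<Rightarrow> real" and x :: "real^'n"
  assumes \<phi>: "C_k 1 \<phi>" and t: "0 < t"
  defines "D \<equiv> radial_div x \<phi> (\<lambda>i. partial i \<phi>)"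
  shows sphere_integral_divergence:
      "t * (LINT y|sphere_measure x t. \<phi> y) = (LINT y|lborel. indicator (ball x t) y * D y)"
    and sphere_trace_inequality:
      "t * (LINT y|sphere_measure x t. \<bar>\<phi> y\<bar>) \<le> (LINT y|lborel. indicator (ball x t) y * \<bar>D y\<bar>)"
proof -
  let ?N = "CARD('n)"
  have D: "continuous_on UNIV D" unfolding D_def by (rule continuous_radial_div[OF \<phi>])
  have [measurable]: "\<phi> \<in> borel_measurable borel" "D \<in> borel_measurable borel"
    using D C1_continuous[OF \<phi>] by (auto intro: borel_measurable_continuous_onI)
  have N: "t ^ ?N = t ^ (?N - 1) * t"
    by (metis One_nat_def power_minus_mult zero_less_card_finite)
  have ae: "AE z in lborel. z \<noteq> (0::real^'n)" by (rule AE_lborel_singleton)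
  have aer: "AE r in lborel. r \<noteq> (0::real)" "AE r in lborel. r \<noteq> t" by (rule AE_lborel_singleton)+
  \<comment> \<open>Polar coordinates about x, with the radial integral over the closed interval
    \<open>{0..t}\<close> of \<open>radial_FTC\<close>; the endpoints and the origin are null
    sets.\<close>
  have polar: "(LINT y|lborel. indicator (ball x t) y * H y) = (LINT z|lborel. indicator (ball 0 1) z *
      (?N * (LINT r|lborel. indicator {0..t} r *\<^sub>R (r ^ (?N - 1) * H (x + r *\<^sub>R sgn z)))))" (is "_ = integral\<^sup>L lborel ?K")
    "integrable lborel (\<lambda>z. indicator (ball 0 1) z *
      (?N * (LINT r|lborel. indicator {0..t} r *\<^sub>R (r ^ (?N - 1) * H (x + r *\<^sub>R sgn z)))))"
    if H: "continuous_on UNIV H" for H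
  proof -
    have [measurable]: "H \<in> borel_measurable borel"
      using H by (auto intro: borel_measurable_continuous_onI)
    let ?F = "\<lambda>y. indicator (ball x t) (x + y) * H (x + y)"
    have F: "integrable lborel ?F"
      using integrable_continuous_ball[OF H] by (subst integrable_lborel_translation) auto
    have *: "AE z in lborel. (LINT r|lborel. polar_weight (z, r) * ?F (r *\<^sub>R sgn z)) = ?K z"
    proof (use ae in eventually_elim)
      fix z :: "real^'n" assume "z \<noteq> 0"
      then have nr: "norm (sgn z) = 1" by (simp add: norm_sgn)
      have "AE r in lborel. polar_weight (z, r) * ?F (r *\<^sub>R sgn z) =
          indicator (ball 0 1) z * (?N * (indicator {0..t} r *\<^sub>R (r ^ (?N - 1) * H (x + r *\<^sub>R sgn z))))"
        using aer by (eventually_elim)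
          (use nr in \<open>auto simp: polar_weight_def dist_norm split: split_indicator\<close>)
      then have "(LINT r|lborel. polar_weight (z, r) * ?F (r *\<^sub>R sgn z)) = (LINT r|lborel.
          indicator (ball 0 1) z * (?N * (indicator {0..t} r *\<^sub>R (r ^ (?N - 1) * H (x + r *\<^sub>R sgn z)))))"
        by (intro integral_cong_AE) (auto simp: polar_weight_def)
      then show "(LINT r|lborel. polar_weight (z, r) * ?F (r *\<^sub>R sgn z)) = ?K z"
        by simp
    qed
    have [measurable]: "?K \<in> borel_measurable borel"
      by measurable
    have meas: "(\<lambda>z. LINT r|lborel. polar_weight (z, r) * ?F (r *\<^sub>R sgn z)) \<in> borel_measurable lborel"
      using integrable_polar_fst[OF F] by simp
    show "integrable lborel ?K"
      using integrable_polar_fst[OF F] by (rule integrable_cong_AE_imp) (use * in auto)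
    have "(LINT y|lborel. indicator (ball x t) y * H y) = (LINT y|lborel. ?F y)"
      by (rule integral_lborel_translation[symmetric]) simp
    also have "\<dots> = integral\<^sup>L lborel ?K"
      unfolding integral_polar_fst[OF F] by (rule integral_cong_AE) (use * meas in auto)
    finally show "(LINT y|lborel. indicator (ball x t) y * H y) = integral\<^sup>L lborel ?K" .
  qed
  have sph: "t * (LINT y|sphere_measure x t. h y) =
      (LINT z|lborel. indicator (ball 0 1) z * (?N * (t ^ ?N * h (x + t *\<^sub>R sgn z))))"
    if [measurable]: "h \<in> borel_measurable borel" for h
    using t by (subst integral_sphere_measure)
      (auto simp: sphere_density_def N mult_ac simp flip: integral_mult_right_zero)
  note ftc = radial_FTC[OF \<phi> less_imp_le[OF t], of x, folded D_def]
  show "t * (LINT y|sphere_measure x t. \<phi> y) = (LINT y|lborel. indicator (ball x t) y * D y)"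
    unfolding polar(1)[OF D] has_bochner_integral_integral_eq[OF ftc] by (rule sph) simp
  have "\<bar>t ^ ?N * \<phi> (x + t *\<^sub>R w)\<bar> \<le> (LINT r|lborel. indicator {0..t} r *\<^sub>R (r ^ (?N - 1) * \<bar>D (x + r *\<^sub>R w)\<bar>))" for w
  proof -
    have "\<bar>t ^ ?N * \<phi> (x + t *\<^sub>R w)\<bar> \<le> (LINT r|lborel. norm (indicator {0..t} r *\<^sub>R (r ^ (?N - 1) * D (x + r *\<^sub>R w))))"
      unfolding has_bochner_integral_integral_eq[OF ftc, symmetric] real_norm_def[symmetric]
      by (rule integral_norm_bound)
    also have "\<dots> = (LINT r|lborel. indicator {0..t} r *\<^sub>R (r ^ (?N - 1) * \<bar>D (x + r *\<^sub>R w)\<bar>))"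
      by (intro Bochner_Integration.integral_cong) (auto simp: abs_mult split: split_indicator)
    finally show ?thesis .
  qed
  then have le: "t ^ ?N * \<bar>\<phi> (x + t *\<^sub>R w)\<bar> \<le> (LINT r|lborel. indicator {0..t} r *\<^sub>R (r ^ (?N - 1) * \<bar>D (x + r *\<^sub>R w)\<bar>))" for w
    using t by (simp add: abs_mult)
  have D': "continuous_on UNIV (\<lambda>y. \<bar>D y\<bar>)" using D by (intro continuous_intros)
  have "t * (LINT y|sphere_measure x t. \<bar>\<phi> y\<bar>) =
      (LINT z|lborel. indicator (ball 0 1) z * (?N * (t ^ ?N * \<bar>\<phi> (x + t *\<^sub>R sgn z)\<bar>)))"
    by (rule sph) simp
  also have "\<dots> \<le> (LINT y|lborel. indicator (ball x t) y * \<bar>D y\<bar>)"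
    unfolding polar(1)[OF D']
  proof (rule integral_mono')
    show "indicator (ball 0 1) z * (?N * (t ^ ?N * \<bar>\<phi> (x + t *\<^sub>R sgn z)\<bar>)) \<le> indicator (ball 0 1) z *
      (?N * (LINT r|lborel. indicator {0..t} r *\<^sub>R (r ^ (?N - 1) * \<bar>D (x + r *\<^sub>R sgn z)\<bar>)))" for z
      by (intro mult_left_mono le) auto
    then show "0 \<le> indicator (ball 0 1) z *
      (?N * (LINT r|lborel. indicator {0..t} r *\<^sub>R (r ^ (?N - 1) * \<bar>D (x + r *\<^sub>R sgn z)\<bar>)))" for z
      by (rule order_trans[rotated]) (use t in auto)
  qed (use polar(2)[OF D'] in simp)
  finally show "t * (LINT y|sphere_measure x t. \<bar>\<phi> y\<bar>) \<le> (LINT y|lborel. indicator (ball x t) y * \<bar>D y\<bar>)" .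
qed

text \<open>Polar coordinates with the radius outermost. The difference of the indicators of the two
  open balls selects e \<le> r < t, whence the half-open interval; what remains inside is the
  integral over directions, that is, over the sphere.\<close>

lemma sphere_integral_annulus:
  fixes \<phi> :: "real^'n \<Rightarrow> real"
  assumes \<phi>: "continuous_on UNIV \<phi>" and e: "0 < e" "e \<le> t"
  shows "(LINT r|lborel. indicator {e..<t} r * (LINT y|sphere_measure x r. \<phi> y)) =
    (LINT y|lborel. indicator (ball x t) y * \<phi> y) - (LINT y|lborel. indicator (ball x e) y * \<phi> y)"
proof -
  have [measurable]: "\<phi> \<in> borel_measurable borel"
    using \<phi> by (auto intro: borel_measurable_continuous_onI)
  let ?F = "\<lambda>y. (indicator (ball x t) (x + y) - indicator (ball x e) (x + y)) * \<phi> (x + y)"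
  note int = integrable_continuous_ball[OF \<phi>]
  have F0: "integrable lborel (\<lambda>y. (indicator (ball x t) y - indicator (ball x e) y) * \<phi> y)"
    using Bochner_Integration.integrable_diff[OF int int, of x t x e] by (simp add: algebra_simps)
  then have F: "integrable lborel ?F"
    by (subst integrable_lborel_translation) auto
  have ae: "AE z in lborel. z \<noteq> (0::real^'n)" by (rule AE_lborel_singleton)
  have "(LINT y|lborel. indicator (ball x t) y * \<phi> y) - (LINT y|lborel. indicator (ball x e) y * \<phi> y)
      = (LINT y|lborel. (indicator (ball x t) y - indicator (ball x e) y) * \<phi> y)"
    by (subst Bochner_Integration.integral_diff[OF int int, symmetric]) (simp add: algebra_simps)
  also have "\<dots> = (LINT y|lborel. ?F y)"
    by (rule integral_lborel_translation[symmetric]) simp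
  also have "\<dots> = (LINT r|lborel. LINT z|lborel. polar_weight (z, r) * ?F (r *\<^sub>R sgn z))"
    by (rule integral_polar_snd[OF F])
  also have "\<dots> = (LINT r|lborel. indicator {e..<t} r * (LINT y|sphere_measure x r. \<phi> y))"
  proof (rule Bochner_Integration.integral_cong[OF refl])
    fix r :: real
    have "(LINT z|lborel. polar_weight (z, r) * ?F (r *\<^sub>R sgn z)) =
        (LINT z|lborel. indicator {e..<t} r * (sphere_density r z * \<phi> (x + r *\<^sub>R sgn z)))"
    proof (rule integral_cong_AE)
      show "AE z in lborel. polar_weight (z, r) * ?F (r *\<^sub>R sgn z) =
          indicator {e..<t} r * (sphere_density r z * \<phi> (x + r *\<^sub>R sgn z))"
      proof (use ae in eventually_elim)
        fix z :: "real^'n" assume "z \<noteq> 0"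
        then have "norm (sgn z) = 1" by (simp add: norm_sgn)
        then show "polar_weight (z, r) * ?F (r *\<^sub>R sgn z) =
            indicator {e..<t} r * (sphere_density r z * \<phi> (x + r *\<^sub>R sgn z))"
          using e by (cases "r > 0")
            (auto simp: sphere_density_def polar_weight_def dist_norm split: split_indicator)
      qed
    qed (simp_all add: polar_weight_def)
    also have "\<dots> = indicator {e..<t} r * (LINT y|sphere_measure x r. \<phi> y)"
      using e by (auto simp: integral_sphere_measure split: split_indicator)
    finally show "(LINT z|lborel. polar_weight (z, r) * ?F (r *\<^sub>R sgn z)) =
        indicator {e..<t} r * (LINT y|sphere_measure x r. \<phi> y)" .
  qed
  finally show ?thesis by simp
qed

section \<open>Mollification in the mean\<close>

lemma
  fixes F :: "'a::euclidean_space \<Rightarrow> real"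
  assumes "integrable lborel F"
  shows integral_translation: "(LINT y|lborel. F (x + y)) = (LINT y|lborel. F y)"
    and integrable_translation: "integrable lborel (\<lambda>y. F (x + y))"
  using integral_lborel_translation[of F x] integrable_lborel_translation[of F x] assms by auto

text \<open>Translation continuity survives limits in the mean: F - G costs e/4 twice, once
  translated, and the translation of G less than e/2. One null sequence Z is fixed so that each case
  of an induction on F can use it.\<close>

lemma L1_translation_approx:
  fixes F :: "'a::euclidean_space \<Rightarrow> real"
  assumes F: "integrable lborel F" and Z: "Z \<longlonglongrightarrow> 0"
    and G: "\<And>e. e > 0 \<Longrightarrow> \<exists>G. integrable lborel G \<and> (LINT y|lborel. \<bar>F y - G y\<bar>) \<le> e \<and>
      (\<lambda>k. LINT y|lborel. \<bar>G (Z k + y) - G y\<bar>) \<longlonglongrightarrow> 0"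
  shows "(\<lambda>k::nat. LINT y|lborel. \<bar>F (Z k + y) - F y\<bar>) \<longlonglongrightarrow> 0"
proof (rule tendstoI)
  fix e :: real assume "e > 0"
  then obtain G where G: "integrable lborel G" "(LINT y|lborel. \<bar>F y - G y\<bar>) \<le> e / 4"
      "(\<lambda>k. LINT y|lborel. \<bar>G (Z k + y) - G y\<bar>) \<longlonglongrightarrow> 0"
    using G[of "e/4"] by auto
  have "\<forall>\<^sub>F k in sequentially. dist (LINT y|lborel. \<bar>G (Z k + y) - G y\<bar>) 0 < e / 2"
    by (rule tendstoD[OF G(3)]) (use \<open>e > 0\<close> in simp)
  then show "\<forall>\<^sub>F k in sequentially. dist (LINT y|lborel. \<bar>F (Z k + y) - F y\<bar>) 0 < e"
  proof eventually_elim
    case (elim k)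
    note [simp] = F G(1) integrable_translation[OF F] integrable_translation[OF G(1)]
    have FG: "integrable lborel (\<lambda>y. \<bar>F y - G y\<bar>)" by simp
    have "(LINT y|lborel. \<bar>F (Z k + y) - F y\<bar>)
        \<le> (LINT y|lborel. \<bar>F (Z k + y) - G (Z k + y)\<bar> + (\<bar>G (Z k + y) - G y\<bar> + \<bar>F y - G y\<bar>))"
      by (rule integral_mono) auto
    also have "\<dots> = (LINT y|lborel. \<bar>F (Z k + y) - G (Z k + y)\<bar>) +
        ((LINT y|lborel. \<bar>G (Z k + y) - G y\<bar>) + (LINT y|lborel. \<bar>F y - G y\<bar>))"
      by simp
    also have "(LINT y|lborel. \<bar>F (Z k + y) - G (Z k + y)\<bar>) = (LINT y|lborel. \<bar>F y - G y\<bar>)"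
      by (rule integral_translation[OF FG])
    finally have "(LINT y|lborel. \<bar>F (Z k + y) - F y\<bar>) < e"
      using G(2) elim by (simp add: dist_real_def)
    then show ?case by (simp add: dist_real_def)
  qed
qed

lemma L1_translation_open:
  fixes U :: "'a::euclidean_space set"
  assumes U: "open U" "emeasure lborel U < \<infinity>" and Z: "Z \<longlonglongrightarrow> 0"
  shows "(\<lambda>k::nat. LINT y|lborel. \<bar>indicat_real U (Z k + y) - indicator U y\<bar>) \<longlonglongrightarrow> 0"
proof -
  have [measurable]: "U \<in> sets borel" using U by simp
  have I: "integrable lborel (indicat_real U)"
    using U by (intro integrable_real_indicator) auto
  note [simp] = I integrable_translation[OF I]
  let ?P = "\<lambda>k y. max 0 (indicat_real U y - indicator U (Z k + y))"
  \<comment> \<open>The indicator of an open set is lower semicontinuous, so only its decrease needs dominated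
    convergence; increase and decrease have the same integral.\<close>
  have "(LINT y|lborel. \<bar>indicat_real U (Z k + y) - indicator U y\<bar>) = 2 * (LINT y|lborel. ?P k y)" for k
  proof -
    have "(LINT y|lborel. \<bar>indicat_real U (Z k + y) - indicator U y\<bar>) =
        (LINT y|lborel. 2 * ?P k y - (indicat_real U y - indicator U (Z k + y)))"
      by (intro Bochner_Integration.integral_cong) (auto simp: max_def split: split_indicator)
    also have "\<dots> = 2 * (LINT y|lborel. ?P k y) - ((LINT y|lborel. indicat_real U y) - (LINT y|lborel. indicator U (Z k + y)))"
      by simp
    finally show ?thesis using integral_translation[OF I] by simp
  qed
  moreover have "(\<lambda>k. LINT y|lborel. ?P k y) \<longlonglongrightarrow> (LINT y|(lborel::'a measure). (0::real))"
  proof (rule integral_dominated_convergence[where w="indicat_real U"])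
    show "AE y in lborel. (\<lambda>k. ?P k y) \<longlonglongrightarrow> 0"
    proof (rule AE_I2)
      fix y
      show "(\<lambda>k. ?P k y) \<longlonglongrightarrow> 0"
      proof (cases "y \<in> U")
        case True
        have "(\<lambda>k. Z k + y) \<longlonglongrightarrow> 0 + y" using Z by (intro tendsto_intros)
        then have "\<forall>\<^sub>F k in sequentially. Z k + y \<in> U"
          using True U(1) by (simp add: topological_tendstoD)
        then have "\<forall>\<^sub>F k in sequentially. ?P k y = 0"
          by eventually_elim (simp add: True)
        then show ?thesis by (rule tendsto_eventually)
      qed (auto split: split_indicator)
    qed
  qed (auto split: split_indicator)
  ultimately show ?thesis by (simp add: tendsto_mult_right_zero)
qed

text \<open>Induction over integrable functions. The indicator of a Borel set of finite measure is
  approximated by that of an open superset, by outer regularity; sums use the triangle inequality,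
  limits use \<open>L1_translation_approx\<close>.\<close>

lemma L1_translation_continuous:
  fixes F :: "'a::euclidean_space \<Rightarrow> real"
  assumes F: "integrable lborel F" and Z: "Z \<longlonglongrightarrow> 0"
  shows "(\<lambda>k::nat. LINT y|lborel. \<bar>F (Z k + y) - F y\<bar>) \<longlonglongrightarrow> 0"
  using F
proof (induction rule: integrable_induct)
  case (base A c)
  then have A[measurable]: "A \<in> sets borel" by simp
  have IA: "integrable lborel (\<lambda>y. indicator A y *\<^sub>R c)"
    using base by (intro integrable_scaleR_left integrable_real_indicator) auto
  show ?case
  proof (rule L1_translation_approx[OF IA Z])
    fix e :: real assume e: "e > 0"
    \<comment> \<open>The denominator |c| + 1 also covers c = 0.\<close>
    obtain U where U: "open U" "A \<subseteq> U" "emeasure lborel (U - A) < ennreal (e / (\<bar>c\<bar> + 1))"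
      using outer_regular_lborel[OF A, of "e / (\<bar>c\<bar> + 1)"] e by auto
    have [measurable]: "U \<in> sets borel" using U by simp
    have "emeasure lborel U = emeasure lborel A + emeasure lborel (U - A)"
      using U(2) by (subst plus_emeasure) (auto simp: Un_absorb1)
    also have "\<dots> < \<infinity>"
      using base order.strict_trans[OF U(3) ennreal_less_top] by simp
    finally have finU: "emeasure lborel U < \<infinity>" .
    have IU: "integrable lborel (\<lambda>y. indicator U y * c)"
      using finU by (intro integrable_mult_left integrable_real_indicator) auto
    have "(LINT y|lborel. \<bar>indicator A y *\<^sub>R c - indicator U y * c\<bar>) = (LINT y|lborel. indicator (U - A) y * \<bar>c\<bar>)"
      using U(2) by (intro Bochner_Integration.integral_cong) (auto split: split_indicator)
    also have "\<dots> = measure lborel (U - A) * \<bar>c\<bar>" by simp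
    also have "\<dots> \<le> (e / (\<bar>c\<bar> + 1)) * \<bar>c\<bar>"
      using U(3) e by (intro mult_right_mono) (auto simp: measure_def enn2real_leI)
    also have "\<dots> \<le> e" using e by (auto simp: field_simps)
    finally have 1: "(LINT y|lborel. \<bar>indicator A y *\<^sub>R c - indicator U y * c\<bar>) \<le> e" .
    have "(\<lambda>k. (LINT y|lborel. \<bar>indicat_real U (Z k + y) - indicator U y\<bar>) * \<bar>c\<bar>) \<longlonglongrightarrow> 0"
      by (intro tendsto_mult_left_zero L1_translation_open U Z finU)
    then have 2: "(\<lambda>k. LINT y|lborel. \<bar>indicat_real U (Z k + y) * c - indicator U y * c\<bar>) \<longlonglongrightarrow> 0"
      by (simp add: left_diff_distrib[symmetric] abs_mult)
    show "\<exists>G. integrable lborel G \<and> (LINT y|lborel. \<bar>indicator A y *\<^sub>R c - G y\<bar>) \<le> e \<and>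
      (\<lambda>k. LINT y|lborel. \<bar>G (Z k + y) - G y\<bar>) \<longlonglongrightarrow> 0"
      using 1 2 IU by (intro exI[of _ "\<lambda>y. indicator U y * c"]) auto
  qed
next
  case (add f g)
  note [simp] = add.hyps integrable_translation[OF add.hyps(1)] integrable_translation[OF add.hyps(2)]
  show ?case
  proof (rule tendsto_sandwich[OF _ _ tendsto_const])
    show "\<forall>\<^sub>F k in sequentially. (LINT y|lborel. \<bar>f (Z k + y) + g (Z k + y) - (f y + g y)\<bar>) \<le>
      (LINT y|lborel. \<bar>f (Z k + y) - f y\<bar>) + (LINT y|lborel. \<bar>g (Z k + y) - g y\<bar>)"
    proof (intro always_eventually allI)
      fix k
      have "(LINT y|lborel. \<bar>f (Z k + y) + g (Z k + y) - (f y + g y)\<bar>) \<le>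
          (LINT y|lborel. \<bar>f (Z k + y) - f y\<bar> + \<bar>g (Z k + y) - g y\<bar>)"
        by (rule integral_mono) auto
      then show "(LINT y|lborel. \<bar>f (Z k + y) + g (Z k + y) - (f y + g y)\<bar>) \<le>
          (LINT y|lborel. \<bar>f (Z k + y) - f y\<bar>) + (LINT y|lborel. \<bar>g (Z k + y) - g y\<bar>)"
        by simp
    qed
    show "(\<lambda>k. (LINT y|lborel. \<bar>f (Z k + y) - f y\<bar>) + (LINT y|lborel. \<bar>g (Z k + y) - g y\<bar>)) \<longlonglongrightarrow> 0"
      using tendsto_add[OF add.IH] by simp
  qed simp
next
  case (lim f s)
  have [measurable]: "f \<in> borel_measurable borel" "s i \<in> borel_measurable borel" for i
    using lim.hyps(1,4) by auto
  \<comment> \<open>The approximants of \<open>integrable_induct\<close> satisfy |s i y| \<le> 2 |f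
    y|, whence the majorant 3 |f y|.\<close>
  have L: "(\<lambda>i. LINT y|lborel. \<bar>f y - s i y\<bar>) \<longlonglongrightarrow> (LINT y|(lborel::'a measure). (0::real))"
  proof (rule integral_dominated_convergence[where w="\<lambda>y. 3 * \<bar>f y\<bar>"])
    show "AE y in lborel. (\<lambda>i. \<bar>f y - s i y\<bar>) \<longlonglongrightarrow> 0"
    proof (rule AE_I2)
      fix y
      have "(\<lambda>i. \<bar>f y - s i y\<bar>) \<longlonglongrightarrow> \<bar>f y - f y\<bar>"
        by (intro tendsto_intros lim.hyps) simp
      then show "(\<lambda>i. \<bar>f y - s i y\<bar>) \<longlonglongrightarrow> 0" by simp
    qed
    show "AE y in lborel. norm \<bar>f y - s i y\<bar> \<le> 3 * \<bar>f y\<bar>" for i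
    proof (rule AE_I2)
      fix y
      have "\<bar>s i y\<bar> \<le> 2 * \<bar>f y\<bar>" using lim.hyps(3)[of y i] by simp
      then show "norm \<bar>f y - s i y\<bar> \<le> 3 * \<bar>f y\<bar>" by simp
    qed
  qed (use lim.hyps in auto)
  show ?case
  proof (rule L1_translation_approx[OF lim.hyps(4) Z])
    fix e :: real assume "e > 0"
    then have "\<forall>\<^sub>F i in sequentially. dist (LINT y|lborel. \<bar>f y - s i y\<bar>) 0 < e"
      using tendstoD[OF L] by simp
    then obtain i where "(LINT y|lborel. \<bar>f y - s i y\<bar>) < e"
      by (auto simp: eventually_sequentially dist_real_def)
    then show "\<exists>G. integrable lborel G \<and> (LINT y|lborel. \<bar>f y - G y\<bar>) \<le> e \<and>
      (\<lambda>k. LINT y|lborel. \<bar>G (Z k + y) - G y\<bar>) \<longlonglongrightarrow> 0"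
      using lim.hyps(1) lim.IH by (intro exI[of _ "s i"]) auto
  qed
qed

text \<open>A counterexample below each 1/(k+1) would form a null sequence contradicting sequential
  continuity. The uniform version is needed because a mollifier averages over all small translations
  at once.\<close>

lemma L1_translation_small:
  fixes F :: "'a::euclidean_space \<Rightarrow> real"
  assumes F: "integrable lborel F" and e: "e > 0"
  obtains d where "d > 0" "\<And>h. norm h < d \<Longrightarrow> (LINT y|lborel. \<bar>F (h + y) - F y\<bar>) < e"
proof -
  have "\<exists>d>0. \<forall>h. norm h < d \<longrightarrow> (LINT y|lborel. \<bar>F (h + y) - F y\<bar>) < e"
  proof (rule ccontr)
    assume *: "\<not> ?thesis"
    have "\<exists>h. norm h < 1 / Suc k \<and> (LINT y|lborel. \<bar>F (h + y) - F y\<bar>) \<ge> e" for k :: nat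
    proof -
      have "1 / real (Suc k) > 0" by simp
      with * show ?thesis by (meson not_le)
    qed
    then obtain Z where Z: "\<And>k. norm (Z k) < 1 / Suc k" "\<And>k. (LINT y|lborel. \<bar>F (Z k + y) - F y\<bar>) \<ge> e"
      by metis
    have "Z \<longlonglongrightarrow> 0"
      by (rule Lim_null_comparison[OF _ LIMSEQ_inverse_real_of_nat])
        (use Z(1)[THEN less_imp_le] in \<open>simp add: inverse_eq_divide\<close>)
    from L1_translation_continuous[OF F this]
    have "e \<le> 0" by (rule LIMSEQ_le_const) (use Z(2) in auto)
    with e show False by simp
  qed
  then show ?thesis using that by blast
qed

text \<open>The mollified function minus F is the \<rho>-average of the differences F(x + z) - F(x),
  so Tonelli bounds its norm by the norms of small translations. The radius d depends on F and e
  only, which later lets one \<rho> serve several functions. The bound B makes the product of F and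
  \<rho> integrable.\<close>

lemma mollification_L1:
  fixes F :: "'a::euclidean_space \<Rightarrow> real"
  assumes F: "integrable lborel F" and e: "e > 0"
  obtains d where "d > 0"
    "\<And>\<rho> B. integrable lborel \<rho> \<Longrightarrow> (\<And>z. 0 \<le> \<rho> z) \<Longrightarrow> (\<And>z. \<rho> z \<le> B) \<Longrightarrow> (LINT z|lborel. \<rho> z) = 1 \<Longrightarrow>
      (\<And>z. \<rho> z \<noteq> 0 \<Longrightarrow> norm z < d) \<Longrightarrow>
      (\<integral>\<^sup>+x. ennreal \<bar>(LINT y|lborel. F y * \<rho> (y - x)) - F x\<bar> \<partial>lborel) \<le> ennreal e"
proof -
  obtain d where d: "d > 0" "\<And>h. norm h < d \<Longrightarrow> (LINT y|lborel. \<bar>F (h + y) - F y\<bar>) < e"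
    using L1_translation_small[OF F e] by blast
  have [measurable]: "F \<in> borel_measurable borel" using F by simp
  show ?thesis
  proof (rule that[OF d(1)])
    fix \<rho> :: "'a \<Rightarrow> real" and B
    assume \<rho>: "integrable lborel \<rho>" "\<And>z. 0 \<le> \<rho> z" "\<And>z. \<rho> z \<le> B" "(LINT z|lborel. \<rho> z) = 1"
      "\<And>z. \<rho> z \<noteq> 0 \<Longrightarrow> norm z < d"
    then have [measurable]: "\<rho> \<in> borel_measurable borel" by simp
    have pt: "ennreal \<bar>(LINT y|lborel. F y * \<rho> (y - x)) - F x\<bar> \<le> (\<integral>\<^sup>+z. ennreal (\<bar>F (z + x) - F x\<bar> * \<rho> z) \<partial>lborel)" for x
    proof -
      have "integrable lborel (\<lambda>y. F y * \<rho> (y - x))"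
      proof (rule Bochner_Integration.integrable_bound)
        show "integrable lborel (\<lambda>y. B * F y)" using F by simp
        show "AE y in lborel. norm (F y * \<rho> (y - x)) \<le> norm (B * F y)"
        proof (rule AE_I2)
          fix y
          have "\<bar>F y\<bar> * \<bar>\<rho> (y - x)\<bar> \<le> \<bar>F y\<bar> * \<bar>B\<bar>"
            using \<rho>(2)[of "y - x"] \<rho>(3)[of "y - x"] by (intro mult_left_mono) auto
          then show "norm (F y * \<rho> (y - x)) \<le> norm (B * F y)"
            by (simp add: abs_mult mult.commute)
        qed
      qed simp
      note int = this integral_translation[OF this, of x] integrable_translation[OF this, of x]
      have "(LINT y|lborel. F y * \<rho> (y - x)) - F x = (LINT z|lborel. F (x + z) * \<rho> z) - (LINT z|lborel. F x * \<rho> z)"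
        using int(2) \<rho>(4) by simp
      also have "\<dots> = (LINT z|lborel. F (x + z) * \<rho> z - F x * \<rho> z)"
        by (rule Bochner_Integration.integral_diff[symmetric]) (use int(3) \<rho>(1) in auto)
      finally have "ennreal \<bar>(LINT y|lborel. F y * \<rho> (y - x)) - F x\<bar>
          \<le> (\<integral>\<^sup>+z. ennreal (norm (F (x + z) * \<rho> z - F x * \<rho> z)) \<partial>lborel)"
        using integral_norm_bound_ennreal[of lborel "\<lambda>z. F (x + z) * \<rho> z - F x * \<rho> z"] int(3) \<rho>(1) by simp
      also have "\<dots> = (\<integral>\<^sup>+z. ennreal (\<bar>F (z + x) - F x\<bar> * \<rho> z) \<partial>lborel)"
        using \<rho>(2) by (intro nn_integral_cong) (simp add: left_diff_distrib[symmetric] abs_mult add.commute)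
      finally show ?thesis .
    qed
    have "(\<integral>\<^sup>+x. ennreal \<bar>(LINT y|lborel. F y * \<rho> (y - x)) - F x\<bar> \<partial>lborel)
        \<le> (\<integral>\<^sup>+x. \<integral>\<^sup>+z. ennreal (\<bar>F (z + x) - F x\<bar> * \<rho> z) \<partial>lborel \<partial>lborel)"
      by (rule nn_integral_mono) (rule pt)
    also have "\<dots> = (\<integral>\<^sup>+z. \<integral>\<^sup>+x. ennreal (\<bar>F (z + x) - F x\<bar> * \<rho> z) \<partial>lborel \<partial>lborel)"
      by (rule lborel_pair.Fubini') measurable
    also have "\<dots> \<le> (\<integral>\<^sup>+z. ennreal e * ennreal (\<rho> z) \<partial>lborel)"
    proof (rule nn_integral_mono)
      fix z :: 'a
      have "(\<integral>\<^sup>+x. ennreal (\<bar>F (z + x) - F x\<bar> * \<rho> z) \<partial>lborel) = (\<integral>\<^sup>+x. ennreal \<bar>F (z + x) - F x\<bar> \<partial>lborel) * ennreal (\<rho> z)"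
        using \<rho>(2) by (subst nn_integral_multc[symmetric]) (auto simp: ennreal_mult)
      also have "\<dots> \<le> ennreal e * ennreal (\<rho> z)"
      proof (cases "\<rho> z = 0")
        case False
        have "(\<integral>\<^sup>+x. ennreal \<bar>F (z + x) - F x\<bar> \<partial>lborel) = ennreal (LINT x|lborel. \<bar>F (z + x) - F x\<bar>)"
          by (rule nn_integral_eq_integral) (use F integrable_translation[OF F] in auto)
        also have "\<dots> \<le> ennreal e"
          using d(2)[OF \<rho>(5)[OF False]] by (intro ennreal_leI) simp
        finally show ?thesis by (intro mult_right_mono) auto
      qed simp
      finally show "(\<integral>\<^sup>+x. ennreal (\<bar>F (z + x) - F x\<bar> * \<rho> z) \<partial>lborel) \<le> ennreal e * ennreal (\<rho> z)" .
    qed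
    also have "\<dots> = ennreal e * ennreal (LINT z|lborel. \<rho> z)"
      using \<rho>(1,2) by (subst nn_integral_cmult) (auto simp: nn_integral_eq_integral)
    finally show "(\<integral>\<^sup>+x. ennreal \<bar>(LINT y|lborel. F y * \<rho> (y - x)) - F x\<bar> \<partial>lborel) \<le> ennreal e"
      by (simp add: \<rho>(4))
  qed
qed

section \<open>Smooth bump functions\<close>

text \<open>The power of s in the denominator makes the family closed under differentiation, up to
  linear combinations; k = 0 is the usual flat function at the origin.\<close>

definition flat_exp :: "nat \<Rightarrow> real \<Rightarrow> real" where
  "flat_exp k s = (if s > 0 then exp (- 1 / s) / s ^ k else 0)"

text \<open>From the right, with u = 1/s, this is the limit of \<open>u ^ k / exp u\<close> at
  infinity.\<close>

lemma flat_exp_tendsto_0: "(flat_exp k \<longlongrightarrow> 0) (at 0)"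
proof (rule filterlim_split_at)
  have "\<forall>\<^sub>F s in at_left (0::real). 0 = flat_exp k s"
    by (auto simp: eventually_at_filter flat_exp_def)
  then show "(flat_exp k \<longlongrightarrow> 0) (at_left 0)"
    by (rule Lim_transform_eventually[OF tendsto_const])
  have "((\<lambda>s. (inverse s) ^ k / exp (inverse s)) \<longlongrightarrow> 0) (at_right (0::real))"
    by (rule filterlim_compose[OF tendsto_power_div_exp_0 filterlim_inverse_at_top_right])
  moreover have "\<forall>\<^sub>F s in at_right (0::real). (inverse s) ^ k / exp (inverse s) = flat_exp k s"
    by (auto simp: eventually_at_filter flat_exp_def exp_minus field_simps)
  ultimately show "(flat_exp k \<longlongrightarrow> 0) (at_right 0)"
    by (rule Lim_transform_eventually)
qed

lemma flat_exp_has_derivative: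
  "(flat_exp k has_real_derivative flat_exp (k + 2) s - real k * flat_exp (k + 1) s) (at s)"
proof (cases "s = 0")
  case True
  \<comment> \<open>The difference quotient of \<open>flat_exp k\<close> at 0 is
    \<open>flat_exp (Suc k)\<close>, which tends to 0.\<close>
  have "\<forall>\<^sub>F h in at (0::real). flat_exp (Suc k) h = flat_exp k h / h"
    by (auto simp: eventually_at_filter flat_exp_def)
  then have "((\<lambda>h. flat_exp k h / h) \<longlongrightarrow> 0) (at 0)"
    by (rule Lim_transform_eventually[OF flat_exp_tendsto_0])
  then show ?thesis
    by (simp add: True has_field_derivative_iff flat_exp_def)
next
  case False
  show ?thesis
  proof (cases "s > 0")
    case True
    have "((\<lambda>s. exp (- 1 / s) / s ^ k) has_real_derivative flat_exp (k + 2) s - real k * flat_exp (k + 1) s) (at s)"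
      using True by (auto intro!: derivative_eq_intros)
        (cases k; cases "k - 1"; simp add: flat_exp_def field_simps power2_eq_square)
    then show ?thesis
      by (rule has_field_derivative_transform_within_open[where S="{0<..}"])
        (use True in \<open>auto simp: flat_exp_def\<close>)
  next
    case F: False
    have "((\<lambda>s. 0) has_real_derivative flat_exp (k + 2) s - real k * flat_exp (k + 1) s) (at s)"
      using F by (auto simp: flat_exp_def)
    then show ?thesis
      by (rule has_field_derivative_transform_within_open[where S="{..<0}"])
        (use F False in \<open>auto simp: flat_exp_def\<close>)
  qed
qed

text \<open>A class of functions built from operations whose derivatives stay in the class.
  Membership gives \<open>C_k\<close> for all k by one induction, without any formula for higher
  derivatives.\<close>

inductive smooth_fun :: "(real^'n \<Rightarrow> real) \<Rightarrow> bool" where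
  const: "smooth_fun (\<lambda>_. c)"
| coord: "smooth_fun (\<lambda>y. y $ i)"
| add: "smooth_fun f \<Longrightarrow> smooth_fun g \<Longrightarrow> smooth_fun (\<lambda>y. f y + g y)"
| mult: "smooth_fun f \<Longrightarrow> smooth_fun g \<Longrightarrow> smooth_fun (\<lambda>y. f y * g y)"
| flat: "smooth_fun f \<Longrightarrow> smooth_fun (\<lambda>y. flat_exp k (f y))"

lemma smooth_fun_diff: "smooth_fun f \<Longrightarrow> smooth_fun g \<Longrightarrow> smooth_fun (\<lambda>y. f y - g y)"
  using smooth_fun.add[OF _ smooth_fun.mult[OF smooth_fun.const[of "-1"]], of f g] by simp

lemma smooth_fun_sum:
  "finite A \<Longrightarrow> (\<And>i. i \<in> A \<Longrightarrow> smooth_fun (f i)) \<Longrightarrow> smooth_fun (\<lambda>y. \<Sum>i\<in>A. f i y)"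
  by (induction A rule: finite_induct) (auto intro: smooth_fun.intros)

lemma smooth_fun_translation:
  assumes "smooth_fun f" shows "smooth_fun (\<lambda>y. f (y - x))"
  using assms
proof induction
  case (coord i)
  show ?case using smooth_fun_diff[OF smooth_fun.coord[of i] smooth_fun.const[of "x $ i"]] by simp
qed (auto intro: smooth_fun.intros)

text \<open>The induction yields some family of partial derivatives inside the class; uniqueness of
  derivatives identifies it with \<open>partial\<close> afterwards.\<close>

lemma smooth_fun_has_derivative:
  fixes f :: "real^'n \<Rightarrow> real"
  assumes "smooth_fun f"
  shows "\<exists>f'. (\<forall>i. smooth_fun (f' i)) \<and> (\<forall>y. (f has_derivative (\<lambda>h. \<Sum>i\<in>UNIV. h $ i * f' i y)) (at y))"
  using assms
proof induction
  case (const c)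
  show ?case by (intro exI[of _ "\<lambda>_ _. 0"]) (auto intro: smooth_fun.const)
next
  case (coord j)
  have "((\<lambda>y::real^'n. y $ j) has_derivative (\<lambda>h. \<Sum>i\<in>UNIV. h $ i * (if i = j then 1 else 0))) (at y)" for y
    by (simp add: if_distrib[of "\<lambda>t. _ * t"] bounded_linear_imp_has_derivative bounded_linear_vec_nth cong: if_cong)
  then show ?case
    by (intro exI[of _ "\<lambda>i _. if i = j then 1 else 0"]) (auto intro: smooth_fun.const)
next
  case (add f g)
  then obtain f' g' where f: "\<And>i. smooth_fun (f' i)" "\<And>y. (f has_derivative (\<lambda>h. \<Sum>i\<in>UNIV. h $ i * f' i y)) (at y)"
    and g: "\<And>i. smooth_fun (g' i)" "\<And>y. (g has_derivative (\<lambda>h. \<Sum>i\<in>UNIV. h $ i * g' i y)) (at y)"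
    by blast
  have "((\<lambda>y. f y + g y) has_derivative (\<lambda>h. \<Sum>i\<in>UNIV. h $ i * (f' i y + g' i y))) (at y)" for y
    using has_derivative_add[OF f(2)[of y] g(2)[of y]] by (simp add: distrib_left sum.distrib)
  then show ?case
    using f(1) g(1) by (intro exI[of _ "\<lambda>i y. f' i y + g' i y"]) (auto intro: smooth_fun.add)
next
  case (mult f g)
  then obtain f' g' where f: "\<And>i. smooth_fun (f' i)" "\<And>y. (f has_derivative (\<lambda>h. \<Sum>i\<in>UNIV. h $ i * f' i y)) (at y)"
    and g: "\<And>i. smooth_fun (g' i)" "\<And>y. (g has_derivative (\<lambda>h. \<Sum>i\<in>UNIV. h $ i * g' i y)) (at y)"
    by blast
  have "((\<lambda>y. f y * g y) has_derivative (\<lambda>h. \<Sum>i\<in>UNIV. h $ i * (f y * g' i y + f' i y * g y))) (at y)" for y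
    using has_derivative_mult[OF f(2)[of y] g(2)[of y]]
    by (simp add: distrib_left sum.distrib sum_distrib_left sum_distrib_right mult_ac)
  moreover have "smooth_fun (\<lambda>y. f y * g' i y + f' i y * g y)" for i
    by (rule smooth_fun.add[OF smooth_fun.mult[OF mult.hyps(1) g(1)] smooth_fun.mult[OF f(1) mult.hyps(2)]])
  ultimately show ?case
    by (intro exI[of _ "\<lambda>i y. f y * g' i y + f' i y * g y"]) auto
next
  case (flat f k)
  then obtain f' where f: "\<And>i. smooth_fun (f' i)" "\<And>y. (f has_derivative (\<lambda>h. \<Sum>i\<in>UNIV. h $ i * f' i y)) (at y)"
    by blast
  let ?d = "\<lambda>y. flat_exp (k + 2) (f y) - real k * flat_exp (k + 1) (f y)"
  have "((\<lambda>y. flat_exp k (f y)) has_derivative (\<lambda>h. \<Sum>i\<in>UNIV. h $ i * (?d y * f' i y))) (at y)" for y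
  proof -
    have "(flat_exp k has_derivative (*) (?d y)) (at (f y))"
      using flat_exp_has_derivative[of k "f y"] by (simp add: has_field_derivative_def)
    from has_derivative_compose[OF f(2)[of y] this] show ?thesis
      by (simp add: sum_distrib_left sum_distrib_right mult_ac)
  qed
  moreover have "smooth_fun (\<lambda>y. ?d y * f' i y)" for i
    using flat.hyps f(1) by (intro smooth_fun_diff smooth_fun.intros)
  ultimately show ?case
    by (intro exI[of _ "\<lambda>i y. ?d y * f' i y"]) auto
qed

lemma
  fixes f :: "real^'n \<Rightarrow> real"
  assumes "smooth_fun f"
  shows smooth_fun_partial: "smooth_fun (partial i f)"
    and smooth_fun_has_derivative_partial: "(f has_derivative (\<lambda>h. \<Sum>i\<in>UNIV. h $ i * partial i f y)) (at y)"
proof -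
  obtain f' where f: "\<And>i. smooth_fun (f' i)" "\<And>y. (f has_derivative (\<lambda>h. \<Sum>i\<in>UNIV. h $ i * f' i y)) (at y)"
    using smooth_fun_has_derivative[OF assms] by blast
  then have "partial i f = f' i" for i
    by (intro ext partial_eqI)
  then show "smooth_fun (partial i f)" "(f has_derivative (\<lambda>h. \<Sum>i\<in>UNIV. h $ i * partial i f y)) (at y)"
    using f by simp_all
qed

lemma smooth_fun_continuous: "smooth_fun f \<Longrightarrow> continuous_on UNIV f"
  by (intro continuous_at_imp_continuous_on ballI has_derivative_continuous[OF smooth_fun_has_derivative_partial])

lemma smooth_fun_C_k: "smooth_fun f \<Longrightarrow> C_k k f"
proof (induction k arbitrary: f)
  case 0
  then show ?case by (simp add: smooth_fun_continuous)
next
  case (Suc k)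
  then show ?case
    using smooth_fun_partial[OF Suc.prems] smooth_fun_has_derivative_partial[OF Suc.prems]
    by (simp add: Suc.IH) (blast intro: differentiableI)
qed

lemma smooth_fun_test_function:
  assumes "smooth_fun f" "\<And>y. f y \<noteq> 0 \<Longrightarrow> norm (y - x) \<le> d"
  shows "test_function f"
proof -
  have "closure {y. f y \<noteq> 0} \<subseteq> cball x d"
    by (rule closure_minimal) (use assms(2) in \<open>auto simp: dist_norm norm_minus_commute\<close>)
  then have "compact (closure {y. f y \<noteq> 0})"
    by (metis bounded_cball bounded_subset closed_closure compact_eq_bounded_closed)
  then show ?thesis
    using smooth_fun_C_k[OF assms(1)] by (simp add: test_function_def)
qed

lemma partial_translation:
  fixes f :: "real^'n \<Rightarrow> real"
  assumes "smooth_fun f"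
  shows "partial i (\<lambda>y. f (y - x)) y = partial i f (y - x)"
proof (rule partial_eqI)
  have "((\<lambda>y. y - x) has_derivative (\<lambda>h. h)) (at y)"
    by (auto intro!: derivative_eq_intros)
  from has_derivative_compose[OF this smooth_fun_has_derivative_partial[OF assms]]
  show "((\<lambda>y. f (y - x)) has_derivative (\<lambda>h. \<Sum>i\<in>UNIV. h $ i * partial i f (y - x))) (at y)" .
qed

text \<open>On the open complement of the closed ball f vanishes identically, hence so does its
  derivative. The argument does not reach the bounding sphere, whence \<le> in place of <.\<close>

lemma partial_support:
  fixes f :: "real^'n \<Rightarrow> real"
  assumes f: "\<And>y. f y \<noteq> 0 \<Longrightarrow> norm y < d" and nz: "partial i f y \<noteq> 0"
  shows "norm y \<le> d"
proof (rule ccontr)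
  assume y: "\<not> norm y \<le> d"
  have "((\<lambda>y. 0) has_derivative (\<lambda>h. \<Sum>i\<in>UNIV. h $ i * 0)) (at y)" by simp
  then have "(f has_derivative (\<lambda>h. \<Sum>i\<in>UNIV. h $ i * 0)) (at y)"
  proof (rule has_derivative_transform_within_open[where s="- cball 0 d"])
    fix z assume "z \<in> - cball (0::real^'n) d"
    then show "0 = f z" using f[of z] by force
  qed (use y in auto)
  then have "partial i f y = 0" by (rule partial_eqI)
  with nz show False by simp
qed

lemma mollifier_exists:
  fixes d :: real
  assumes d: "d > 0"
  obtains \<rho> :: "real^'n \<Rightarrow> real" where "smooth_fun \<rho>" "\<And>z. 0 \<le> \<rho> z" "\<And>z. \<rho> z \<noteq> 0 \<Longrightarrow> norm z < d"
    "integrable lborel \<rho>" "(LINT z|lborel. \<rho> z) = 1"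
proof -
  \<comment> \<open>The squared norm is spelled out in coordinates, which keeps r in the class
    \<open>smooth_fun\<close>; r is nonzero exactly where the norm is below d.\<close>
  define r :: "real^'n \<Rightarrow> real" where "r y = flat_exp 0 (d\<^sup>2 - (\<Sum>i\<in>UNIV. y $ i * y $ i))" for y
  have sm: "smooth_fun r"
    unfolding r_def by (intro smooth_fun_sum smooth_fun_diff smooth_fun.intros) auto
  have nrm: "(\<Sum>i\<in>UNIV. y $ i * y $ i) = (norm y)\<^sup>2" for y :: "real^'n"
    by (simp add: power2_norm_eq_inner inner_vec_def)
  have supp: "r y \<noteq> 0 \<longleftrightarrow> norm y < d" for y
  proof -
    have "(norm y)\<^sup>2 < d\<^sup>2 \<longleftrightarrow> norm y < d"
      using d abs_le_square_iff[of d "norm y"] by (simp flip: not_le)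
    then show ?thesis unfolding r_def nrm flat_exp_def by simp
  qed
  have nn: "0 \<le> r y" for y
    by (simp add: r_def flat_exp_def)
  have "integrable lborel (\<lambda>y. indicator (ball 0 d) y * r y)"
    by (rule integrable_continuous_ball[OF smooth_fun_continuous[OF sm]])
  moreover have "(\<lambda>y. indicator (ball 0 d) y * r y) = r"
    using supp by (auto simp: fun_eq_iff indicator_def)
  ultimately have int: "integrable lborel r" by simp
  \<comment> \<open>Otherwise r would vanish almost everywhere, although it is nonzero on a ball of
    positive volume.\<close>
  have "(LINT y|lborel. r y) \<noteq> 0"
  proof
    assume "(LINT y|lborel. r y) = 0"
    then have "AE y in lborel. r y = 0"
      using integral_nonneg_eq_0_iff_AE[OF int] nn by simp
    then have "AE y in lborel. y \<notin> ball (0::real^'n) d"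
      by eventually_elim (use supp in auto)
    then have "emeasure lborel (ball (0::real^'n) d) = 0"
      by (subst (asm) AE_iff_measurable[OF _ refl]) (auto simp: ball_def)
    then show False
      using content_ball_pos[OF d, of "0::real^'n"] by (simp add: measure_def)
  qed
  moreover have "(LINT y|lborel. r y) \<ge> 0" using nn by simp
  ultimately have pos: "(LINT y|lborel. r y) > 0" by simp
  show ?thesis
  proof (rule that[of "\<lambda>y. 1 / (LINT y|lborel. r y) * r y"])
    show "smooth_fun (\<lambda>y. 1 / (LINT y|lborel. r y) * r y)"
      by (intro smooth_fun.mult smooth_fun.const sm)
  next
    show "0 \<le> 1 / (LINT y|lborel. r y) * r z" for z
      using pos nn by simp
    show "norm z < d" if "1 / (LINT y|lborel. r y) * r z \<noteq> 0" for z
      using that supp[of z] by simp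
    show "integrable lborel (\<lambda>y. 1 / (LINT y|lborel. r y) * r y)"
      using int by (rule integrable_mult_right)
    show "(LINT z|lborel. 1 / (LINT y|lborel. r y) * r z) = 1"
      using pos by (subst integral_mult_right_zero) simp
  qed
qed

section \<open>Convolution of locally integrable functions\<close>

lemma locally_integrableD:
  assumes "locally_integrable f" "compact K"
  shows "integrable lebesgue (\<lambda>y. indicator K y * f y)"
  using assms by (simp add: locally_integrable_def set_integrable_def)

text \<open>f is the pointwise limit of its truncations to growing closed balls, each of which is
  integrable.\<close>

lemma locally_integrable_measurable:
  assumes "locally_integrable f"
  shows "f \<in> borel_measurable lebesgue"
proof (rule borel_measurable_LIMSEQ_real)
  show "(\<lambda>y. indicator (cball 0 (real k)) y * f y) \<in> borel_measurable lebesgue" for k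
    using locally_integrableD[OF assms, of "cball 0 (real k)"] by simp
  show "(\<lambda>k. indicator (cball 0 (real k)) y * f y) \<longlonglongrightarrow> f y" for y
  proof (rule tendsto_eventually)
    obtain k0 :: nat where "norm y \<le> k0" using real_arch_simple by blast
    then show "\<forall>\<^sub>F k in sequentially. indicator (cball 0 (real k)) y * f y = f y"
      by (intro eventually_sequentiallyI[of k0]) (auto simp: indicator_def)
  qed
qed

lemma locally_integrable_diff:
  assumes "locally_integrable f" "locally_integrable g"
  shows "locally_integrable (\<lambda>y. f y - g y)"
  using assms unfolding locally_integrable_def by (auto intro: set_integral_diff)

lemma locally_integrable_ball:
  assumes "locally_integrable f"
  shows "integrable lebesgue (\<lambda>y. indicator (ball x r) y * f y)"
proof (rule Bochner_Integration.integrable_bound)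
  show "integrable lebesgue (\<lambda>y. indicator (cball x r) y * f y)"
    by (rule locally_integrableD[OF assms]) simp
  show "(\<lambda>y. indicator (ball x r) y * f y) \<in> borel_measurable lebesgue"
    by (intro borel_measurable_times locally_integrable_measurable[OF assms] borel_measurable_indicator) simp
qed (auto split: split_indicator)

lemma lebesgue_measurable_of_borel: "k \<in> borel_measurable borel \<Longrightarrow> k \<in> borel_measurable lebesgue"
  by (rule measurable_completion) simp

lemma locally_integrable_mult:
  assumes f: "locally_integrable f" and [measurable]: "k \<in> borel_measurable borel"
    and k: "\<And>y. \<bar>k y\<bar> \<le> B" "\<And>y. k y \<noteq> 0 \<Longrightarrow> norm y \<le> R"
  shows "integrable lebesgue (\<lambda>y. f y * k y)"
proof (rule Bochner_Integration.integrable_bound)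
  show "integrable lebesgue (\<lambda>y. B * (indicator (cball 0 R) y * f y))"
    by (intro integrable_mult_right locally_integrableD[OF f]) simp
  show "(\<lambda>y. f y * k y) \<in> borel_measurable lebesgue"
    by (intro borel_measurable_times locally_integrable_measurable[OF f] lebesgue_measurable_of_borel) simp
  show "AE y in lebesgue. norm (f y * k y) \<le> norm (B * (indicator (cball 0 R) y * f y))"
  proof (rule AE_I2)
    fix y
    have "\<bar>k y\<bar> \<le> \<bar>B\<bar> * indicator (cball 0 R) y"
      using k(1)[of y] k(2)[of y] by (auto simp: indicator_def)
    then have "\<bar>f y\<bar> * \<bar>k y\<bar> \<le> \<bar>f y\<bar> * (\<bar>B\<bar> * indicator (cball 0 R) y)"
      by (rule mult_left_mono) simp
    then show "norm (f y * k y) \<le> norm (B * (indicator (cball 0 R) y * f y))"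
      by (simp add: abs_mult mult_ac)
  qed
qed

text \<open>All kernels share one bound and one bounded support, so |B| |f| on a fixed closed ball
  is an integrable majorant. Continuity and differentiability of convolutions are both
  instances.\<close>

lemma locally_integrable_mult_tendsto:
  assumes f: "locally_integrable f" and m: "\<And>j. k j \<in> borel_measurable borel"
    and k: "\<And>j y. \<bar>k j y\<bar> \<le> B" "\<And>j y. k j y \<noteq> 0 \<Longrightarrow> norm y \<le> R"
    and lim: "\<And>y. (\<lambda>j::nat. k j y) \<longlonglongrightarrow> l y"
  shows "(\<lambda>j. LINT y|lebesgue. f y * k j y) \<longlonglongrightarrow> (LINT y|lebesgue. f y * l y)"
proof (rule integral_dominated_convergence[where w="\<lambda>y. \<bar>B\<bar> * \<bar>indicator (cball 0 R) y * f y\<bar>"])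
  note [measurable] = m
  have [measurable]: "l \<in> borel_measurable borel"
    by (rule borel_measurable_LIMSEQ_real[OF lim m])
  show "(\<lambda>y. f y * l y) \<in> borel_measurable lebesgue" "\<And>j. (\<lambda>y. f y * k j y) \<in> borel_measurable lebesgue"
    by (intro borel_measurable_times locally_integrable_measurable[OF f] lebesgue_measurable_of_borel; simp)+
  show "integrable lebesgue (\<lambda>y. \<bar>B\<bar> * \<bar>indicator (cball 0 R) y * f y\<bar>)"
    by (intro integrable_mult_right integrable_abs locally_integrableD[OF f]) simp
  show "AE y in lebesgue. (\<lambda>j. f y * k j y) \<longlonglongrightarrow> f y * l y"
    using lim by (intro AE_I2 tendsto_intros)
  show "AE y in lebesgue. norm (f y * k j y) \<le> \<bar>B\<bar> * \<bar>indicator (cball 0 R) y * f y\<bar>" for j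
  proof (rule AE_I2)
    fix y
    have "\<bar>k j y\<bar> \<le> \<bar>B\<bar> * indicator (cball 0 R) y"
      using k(1)[of j y] k(2)[of j y] by (auto simp: indicator_def)
    then have "\<bar>f y\<bar> * \<bar>k j y\<bar> \<le> \<bar>f y\<bar> * (\<bar>B\<bar> * indicator (cball 0 R) y)"
      by (rule mult_left_mono) simp
    then show "norm (f y * k j y) \<le> \<bar>B\<bar> * \<bar>indicator (cball 0 R) y * f y\<bar>"
      by (simp add: abs_mult mult_ac)
  qed
qed

section \<open>Continuity and differentiability of convolutions\<close>

lemma continuous_compact_support_bounded:
  fixes k :: "'a::euclidean_space \<Rightarrow> real"
  assumes k: "continuous_on UNIV k" "\<And>y. k y \<noteq> 0 \<Longrightarrow> norm y \<le> d"
  obtains B where "B > 0" "\<And>y. \<bar>k y\<bar> \<le> B"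
proof -
  have "bounded (k ` cball 0 d)"
    by (intro compact_imp_bounded compact_continuous_image) (auto intro: continuous_on_subset[OF k(1)])
  then obtain B where B: "B > 0" "\<And>y. y \<in> cball 0 d \<Longrightarrow> \<bar>k y\<bar> \<le> B"
    by (auto simp: bounded_pos)
  then have "\<bar>k y\<bar> \<le> B" for y
    using k(2)[of y] by (cases "k y = 0") auto
  with B(1) show ?thesis by (rule that)
qed

lemma continuous_convolution:
  fixes f k :: "real^'n \<Rightarrow> real"
  assumes f: "locally_integrable f" and k: "continuous_on UNIV k" "\<And>y. k y \<noteq> 0 \<Longrightarrow> norm y \<le> d"
  shows "continuous_on UNIV (\<lambda>x. LINT y|lebesgue. f y * k (y - x))"
  unfolding continuous_on_sequentially comp_def
proof (intro ballI allI impI, elim conjE)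
  fix x :: "real^'n" and X assume X: "X \<longlonglongrightarrow> x"
  obtain B where B: "\<And>y. \<bar>k y\<bar> \<le> B"
    using continuous_compact_support_bounded[OF k] by blast
  \<comment> \<open>A convergent sequence is bounded, so all translated kernels live on one ball of
    radius d + M.\<close>
  obtain M where M: "\<And>j. norm (X j) \<le> M"
    using convergent_imp_Bseq[OF convergentI[OF X]] by (auto simp: Bseq_def)
  have [measurable]: "k \<in> borel_measurable borel"
    using k(1) by (rule borel_measurable_continuous_onI)
  show "(\<lambda>j. LINT y|lebesgue. f y * k (y - X j)) \<longlonglongrightarrow> (LINT y|lebesgue. f y * k (y - x))"
  proof (rule locally_integrable_mult_tendsto[OF f])
    show "norm y \<le> d + M" if "k (y - X j) \<noteq> 0" for j y
      using k(2)[OF that] M[of j] norm_triangle_ineq[of "y - X j" "X j"] by simp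
    show "(\<lambda>j. k (y - X j)) \<longlonglongrightarrow> k (y - x)" for y
      by (rule continuous_on_tendsto_compose[OF k(1)]) (use X in \<open>auto intro!: tendsto_intros\<close>)
  qed (use B in auto)
qed

lemma abs_sum_components_le:
  fixes h :: "real^'n"
  assumes "\<And>i. \<bar>d i\<bar> \<le> M"
  shows "\<bar>\<Sum>i\<in>UNIV. h $ i * d i\<bar> \<le> real CARD('n) * M * norm h"
proof -
  have "\<bar>\<Sum>i\<in>UNIV. h $ i * d i\<bar> \<le> (\<Sum>i\<in>UNIV. \<bar>h $ i * d i\<bar>)" by (rule sum_abs)
  also have "\<dots> \<le> (\<Sum>i\<in>(UNIV::'n set). norm h * M)"
    by (intro sum_mono) (auto simp: abs_mult intro!: mult_mono component_le_norm_cart assms)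
  finally show ?thesis by (simp add: mult_ac)
qed

text \<open>Differentiation under the integral sign: the remainders of the first order expansion of
  k, divided by the step, tend to 0 pointwise, are uniformly bounded since k is Lipschitz, and have
  a common bounded support. The minus sign stems from the kernel k(y - x), in which x enters
  negatively.\<close>

lemma has_derivative_convolution:
  fixes f k :: "real^'n \<Rightarrow> real"
  assumes f: "locally_integrable f" and k: "smooth_fun k" "\<And>y. k y \<noteq> 0 \<Longrightarrow> norm y < d"
  shows "((\<lambda>x. LINT y|lebesgue. f y * k (y - x)) has_derivative
    (\<lambda>h. \<Sum>i\<in>UNIV. h $ i * - (LINT y|lebesgue. f y * partial i k (y - x)))) (at x)"
proof -
  let ?N = "real CARD('n)"
  have ck: "continuous_on UNIV k" "\<And>i. continuous_on UNIV (partial i k)"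
    using k(1) by (auto intro: smooth_fun_continuous smooth_fun_partial)
  have [measurable]: "k \<in> borel_measurable borel" "\<And>i. partial i k \<in> borel_measurable borel"
    using ck by (auto intro: borel_measurable_continuous_onI)
  have supp: "norm y \<le> d" if "partial i k y \<noteq> 0" for i y
    by (rule partial_support[OF k(2) that])
  have zero: "k z = 0" "partial i k z = 0" if "norm z > d" for z i
    using that k(2)[of z] supp[of i z] by (meson not_le order.asym)+
  have "\<exists>B. \<forall>y. \<bar>partial i k y\<bar> \<le> B" for i
    using continuous_compact_support_bounded[OF ck(2)[of i] supp[of i]] by blast
  then obtain B where B: "\<And>i y. \<bar>partial i k y\<bar> \<le> B i" by metis
  define M where "M = Max (range B)"
  have M: "\<bar>partial i k y\<bar> \<le> M" for i y
    unfolding M_def by (rule order_trans[OF B[of i y] Max_ge]) auto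
  note D = smooth_fun_has_derivative_partial[OF k(1)]
  have lip: "\<bar>k a - k b\<bar> \<le> ?N * M * norm (a - b)" for a b
    unfolding real_norm_def[symmetric]
  proof (rule differentiable_bound[OF convex_UNIV])
    show "onorm (\<lambda>h. \<Sum>i\<in>UNIV. h $ i * partial i k y) \<le> ?N * M" for y
      by (rule onorm_le) (use abs_sum_components_le[of "\<lambda>i. partial i k y", OF M] in simp)
  qed (use D in auto)
  obtain Bk where Bk: "\<And>y. \<bar>k y\<bar> \<le> Bk"
    using continuous_compact_support_bounded[OF ck(1) less_imp_le[OF k(2)]] by metis
  have int: "integrable lebesgue (\<lambda>y. f y * k (y - z))" for z
  proof (rule locally_integrable_mult[OF f, of _ Bk "d + norm z"])
    show "norm y \<le> d + norm z" if "k (y - z) \<noteq> 0" for y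
      using k(2)[OF that] norm_triangle_ineq[of "y - z" z] by simp
  qed (use Bk in auto)
  have int': "integrable lebesgue (\<lambda>y. f y * partial i k (y - z))" for z i
  proof (rule locally_integrable_mult[OF f, of _ M "d + norm z"])
    show "norm y \<le> d + norm z" if "partial i k (y - z) \<noteq> 0" for y
      using supp[OF that] norm_triangle_ineq[of "y - z" z] by simp
  qed (use M in auto)
  show ?thesis
    unfolding has_derivative_iff_norm
  proof (intro conjI)
    show "bounded_linear (\<lambda>h. \<Sum>i\<in>UNIV. h $ i * - (LINT y|lebesgue. f y * partial i k (y - x)))"
      by (intro bounded_linear_sum bounded_linear_mult_const bounded_linear_vec_nth)
    let ?q = "\<lambda>z. norm ((LINT y|lebesgue. f y * k (y - z)) - (LINT y|lebesgue. f y * k (y - x)) -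
        (\<Sum>i\<in>UNIV. (z - x) $ i * - (LINT y|lebesgue. f y * partial i k (y - x)))) / norm (z - x)"
    show "(?q \<longlongrightarrow> 0) (at x)"
      unfolding tendsto_at_iff_sequentially comp_def
    proof (intro allI impI)
      fix X :: "nat \<Rightarrow> real^'n" assume X0: "\<forall>j. X j \<in> UNIV - {x}" and X: "X \<longlonglongrightarrow> x"
      \<comment> \<open>The first order remainder of k at y - x, divided by the step. The sum
        carries a plus sign because moving x by h moves y - x by -h.\<close>
      define K where "K j y = (k (y - X j) - k (y - x) + (\<Sum>i\<in>UNIV. (X j - x) $ i * partial i k (y - x))) / norm (X j - x)" for j y
      obtain R where R: "\<And>j. norm (X j) \<le> R"
        using convergent_imp_Bseq[OF convergentI[OF X]] by (auto simp: Bseq_def)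
      have "(\<lambda>j. LINT y|lebesgue. f y * K j y) \<longlonglongrightarrow> (LINT y|lebesgue. f y * (0::real))"
      proof (rule locally_integrable_mult_tendsto[OF f])
        show "K j \<in> borel_measurable borel" for j
          unfolding K_def by measurable
        \<comment> \<open>The Lipschitz bound for the difference plus the same bound for the linear
          part.\<close>
        show "\<bar>K j y\<bar> \<le> 2 * ?N * M" for j y
        proof -
          have "norm (X j - x) > 0" using X0 by auto
          moreover have "\<bar>k (y - X j) - k (y - x)\<bar> \<le> ?N * M * norm (X j - x)"
            using lip[of "y - X j" "y - x"] by (simp add: norm_minus_commute)
          moreover have "\<bar>\<Sum>i\<in>UNIV. (X j - x) $ i * partial i k (y - x)\<bar> \<le> ?N * M * norm (X j - x)"
            by (rule abs_sum_components_le[OF M])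
          ultimately show ?thesis
            unfolding K_def by (simp add: pos_divide_le_eq abs_divide) 
        qed
        show "norm y \<le> d + R + norm x" if "K j y \<noteq> 0" for j y
        proof (rule ccontr)
          assume "\<not> ?thesis"
          moreover have "norm x \<ge> 0" "norm (X j) \<ge> 0" "R \<ge> 0"
            using order_trans[OF norm_ge_zero R[of j]] by auto
          ultimately have "norm (y - X j) > d" "norm (y - x) > d"
            using norm_triangle_ineq2[of y "X j"] norm_triangle_ineq2[of y x] R[of j] by linarith+
          then have "k (y - X j) = 0" "k (y - x) = 0" "\<And>i. partial i k (y - x) = 0"
            by (simp_all add: zero)
          with that show False by (simp add: K_def)
        qed
        show "(\<lambda>j. K j y) \<longlonglongrightarrow> 0" for y
        proof -
          have "((\<lambda>z. y - z) has_derivative (\<lambda>h. - h)) (at x)"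
            by (auto intro!: derivative_eq_intros)
          from has_derivative_compose[OF this D[of "y - x"]]
          have "((\<lambda>z. norm (k (y - z) - k (y - x) - (\<Sum>i\<in>UNIV. (- (z - x)) $ i * partial i k (y - x))) / norm (z - x)) \<longlongrightarrow> 0) (at x)"
            unfolding has_derivative_iff_norm by blast
          then have "(\<lambda>j. norm (k (y - X j) - k (y - x) - (\<Sum>i\<in>UNIV. (- (X j - x)) $ i * partial i k (y - x))) / norm (X j - x)) \<longlonglongrightarrow> 0"
            unfolding tendsto_at_iff_sequentially comp_def using X0 X by blast
          moreover have "(norm (k (y - X j) - k (y - x) - (\<Sum>i\<in>UNIV. (- (X j - x)) $ i * partial i k (y - x))) / norm (X j - x)) = norm (K j y)" for j
            unfolding K_def vector_uminus_component by (simp add: sum_negf del: vector_minus_component minus_diff_eq)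
          ultimately have "(\<lambda>j. norm (K j y)) \<longlonglongrightarrow> 0" by (simp only:)
          then show ?thesis by (rule tendsto_norm_zero_cancel)
        qed
      qed
      moreover have "?q (X j) = norm (LINT y|lebesgue. f y * K j y)" for j
      proof -
        have "(LINT y|lebesgue. f y * K j y) = (LINT y|lebesgue. (f y * k (y - X j) - f y * k (y - x) +
            (\<Sum>i\<in>UNIV. (X j - x) $ i * (f y * partial i k (y - x)))) / norm (X j - x))"
          by (intro Bochner_Integration.integral_cong) (auto simp: K_def algebra_simps sum_distrib_left)
        also have "\<dots> = ((LINT y|lebesgue. f y * k (y - X j)) - (LINT y|lebesgue. f y * k (y - x)) +
            (\<Sum>i\<in>UNIV. (X j - x) $ i * (LINT y|lebesgue. f y * partial i k (y - x)))) / norm (X j - x)"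
          using int int' by simp
        finally show ?thesis
          by (simp add: sum_negf)
      qed
      ultimately show "(\<lambda>j. ?q (X j)) \<longlonglongrightarrow> 0"
        by (auto dest: tendsto_norm_zero)
    qed
  qed
qed

lemma
  fixes f k :: "real^'n \<Rightarrow> real"
  assumes f: "locally_integrable f" and k: "smooth_fun k" "\<And>y. k y \<noteq> 0 \<Longrightarrow> norm y < d"
  shows partial_convolution: "partial i (\<lambda>x. LINT y|lebesgue. f y * k (y - x)) x =
      - (LINT y|lebesgue. f y * partial i k (y - x))"
    and C1_convolution: "C_k 1 (\<lambda>x. LINT y|lebesgue. f y * k (y - x))"
proof -
  note D = has_derivative_convolution[OF f k]
  show p: "partial i (\<lambda>x. LINT y|lebesgue. f y * k (y - x)) x =
      - (LINT y|lebesgue. f y * partial i k (y - x))" for i x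
    by (rule partial_eqI[OF D])
  have "continuous_on UNIV (\<lambda>x. - (LINT y|lebesgue. f y * partial i k (y - x)))" for i
    by (intro continuous_on_minus continuous_convolution[OF f, of _ d] smooth_fun_continuous smooth_fun_partial k(1))
      (rule partial_support[OF k(2)])
  moreover have "partial i (\<lambda>x. LINT y|lebesgue. f y * k (y - x)) =
      (\<lambda>x. - (LINT y|lebesgue. f y * partial i k (y - x)))" for i
    by (rule ext) (rule p)
  ultimately show "C_k 1 (\<lambda>x. LINT y|lebesgue. f y * k (y - x))"
    using D by (auto simp: differentiable_def)
qed

text \<open>The translate of k by x is a test function in y. Its derivative in y and the derivative
  in x of the convolution differ by a sign, which cancels the sign in the definition of weak
  derivatives.\<close>

lemma partial_convolution_weak:
  fixes f k :: "real^'n \<Rightarrow> real"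
  assumes w: "has_weak_partial f i g" and k: "smooth_fun k" "\<And>y. k y \<noteq> 0 \<Longrightarrow> norm y < d"
  shows "partial i (\<lambda>x. LINT y|lebesgue. f y * k (y - x)) x = (LINT y|lebesgue. g y * k (y - x))"
proof -
  have f: "locally_integrable f" using w by (simp add: has_weak_partial_def)
  have "test_function (\<lambda>y. k (y - x))"
    by (rule smooth_fun_test_function[OF smooth_fun_translation[OF k(1)], of x _ d])
      (rule less_imp_le[OF k(2)])
  then have "(LINT y|lebesgue. f y * partial i (\<lambda>y. k (y - x)) y) = - (LINT y|lebesgue. g y * k (y - x))"
    using w by (simp add: has_weak_partial_def)
  then have "- (LINT y|lebesgue. f y * partial i k (y - x)) = (LINT y|lebesgue. g y * k (y - x))"
    by (simp add: partial_translation[OF k(1)])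
  then show ?thesis
    using partial_convolution[OF f k, of i x] by simp
qed

section \<open>Approximation by continuously differentiable functions\<close>

definition mollifier :: "real \<Rightarrow> (real^'n \<Rightarrow> real) \<Rightarrow> bool" where
  "mollifier d \<rho> \<longleftrightarrow> smooth_fun \<rho> \<and> (\<forall>z. 0 \<le> \<rho> z) \<and> (\<forall>z. \<rho> z \<noteq> 0 \<longrightarrow> norm z < d) \<and>
     integrable lborel \<rho> \<and> (LINT z|lborel. \<rho> z) = 1"

text \<open>Lets one mollifier meet several smallness conditions at once.\<close>

lemma mollifier_mono: "mollifier d \<rho> \<Longrightarrow> d \<le> e \<Longrightarrow> mollifier e \<rho>"
  unfolding mollifier_def by force

lemma ex_mollifier: "d > 0 \<Longrightarrow> \<exists>\<rho> :: real^'n \<Rightarrow> real. mollifier d \<rho>"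
  by (rule mollifier_exists[of d, where ?'n='n]) (auto simp: mollifier_def)

text \<open>For a mollifier of radius at most 1, only f on the concentric ball of radius R + 1
  matters, so f may be cut off there and \<open>mollification_L1\<close> applies. The cut-off
  function is replaced by a Borel representative, since that lemma works over
  \<open>lborel\<close>.\<close>

lemma mollification_local:
  fixes f :: "real^'n \<Rightarrow> real"
  assumes f: "locally_integrable f" and e: "e > 0"
  shows "\<exists>d>0. \<forall>\<rho>. mollifier d \<rho> \<longrightarrow>
    (\<integral>\<^sup>+x\<in>ball a R. ennreal \<bar>(LINT y|lebesgue. f y * \<rho> (y - x)) - f x\<bar> \<partial>lebesgue) \<le> ennreal e"
proof -
  define F0 where "F0 y = indicator (ball a (R + 1)) y * f y" for y
  have F0: "integrable lebesgue F0"
    unfolding F0_def by (rule locally_integrable_ball[OF f])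
  then obtain F where F: "F \<in> borel_measurable lborel" "AE y in lborel. F0 y = F y"
    using completion_ex_borel_measurable_real[of F0 lborel] by auto
  have AE: "AE y in lebesgue. F0 y = F y" by (rule AE_completion[OF F(2)])
  have F': "F \<in> borel_measurable lebesgue" using F(1) by (rule measurable_completion)
  have "integrable lebesgue F"
    by (rule integrable_cong_AE_imp[OF F0 F']) (use AE in auto)
  then have intF: "integrable lborel F" using F(1) by (simp add: integrable_completion)
  obtain d where d: "d > 0"
    "\<And>\<rho> B. integrable lborel \<rho> \<Longrightarrow> (\<And>z. 0 \<le> \<rho> z) \<Longrightarrow> (\<And>z. \<rho> z \<le> B) \<Longrightarrow> (LINT z|lborel. \<rho> z) = 1 \<Longrightarrow>
      (\<And>z. \<rho> z \<noteq> 0 \<Longrightarrow> norm z < d) \<Longrightarrow>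
      (\<integral>\<^sup>+x. ennreal \<bar>(LINT y|lborel. F y * \<rho> (y - x)) - F x\<bar> \<partial>lborel) \<le> ennreal e"
    using mollification_L1[OF intF e] by blast
  show ?thesis
  proof (intro exI[of _ "min d 1"] conjI allI impI)
    show "min d 1 > 0" using d(1) by simp
    fix \<rho> :: "real^'n \<Rightarrow> real" assume "mollifier (min d 1) \<rho>"
    then have \<rho>: "smooth_fun \<rho>" "\<And>z. 0 \<le> \<rho> z" "\<And>z. \<rho> z \<noteq> 0 \<Longrightarrow> norm z < d" "\<And>z. \<rho> z \<noteq> 0 \<Longrightarrow> norm z < 1"
      "integrable lborel \<rho>" "(LINT z|lborel. \<rho> z) = 1"
      by (auto simp: mollifier_def)
    have [measurable]: "\<rho> \<in> borel_measurable borel" using \<rho>(5) by simp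
    obtain B where B: "\<And>y. \<bar>\<rho> y\<bar> \<le> B"
      using continuous_compact_support_bounded[OF smooth_fun_continuous[OF \<rho>(1)] less_imp_le[OF \<rho>(3)]] by metis
    have eq: "(LINT y|lebesgue. f y * \<rho> (y - x)) = (LINT y|lborel. F y * \<rho> (y - x))" if x: "x \<in> ball a R" for x
    proof -
      have "f y * \<rho> (y - x) = F0 y * \<rho> (y - x)" for y
      proof (cases "\<rho> (y - x) = 0")
        case False
        then have "norm (y - x) < 1" by (rule \<rho>(4))
        then have "y \<in> ball a (R + 1)"
          using x dist_triangle[of a y x] by (simp add: dist_norm norm_minus_commute)
        then show ?thesis by (simp add: F0_def)
      qed simp
      then have "(LINT y|lebesgue. f y * \<rho> (y - x)) = (LINT y|lebesgue. F0 y * \<rho> (y - x))"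
        by (intro Bochner_Integration.integral_cong refl)
      also have "\<dots> = (LINT y|lebesgue. F y * \<rho> (y - x))"
      proof (rule integral_cong_AE)
        have m: "(\<lambda>y. \<rho> (y - x)) \<in> borel_measurable lebesgue"
          by (rule lebesgue_measurable_of_borel) simp
        show "(\<lambda>y. F0 y * \<rho> (y - x)) \<in> borel_measurable lebesgue"
          by (rule borel_measurable_times[OF borel_measurable_integrable[OF F0] m])
        show "(\<lambda>y. F y * \<rho> (y - x)) \<in> borel_measurable lebesgue"
          by (rule borel_measurable_times[OF F' m])
      qed (use AE in auto)
      also have "\<dots> = (LINT y|lborel. F y * \<rho> (y - x))"
        using F(1) by (intro integral_completion) simp
      finally show ?thesis .
    qed
    have "(\<integral>\<^sup>+x\<in>ball a R. ennreal \<bar>(LINT y|lebesgue. f y * \<rho> (y - x)) - f x\<bar> \<partial>lebesgue)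
        \<le> (\<integral>\<^sup>+x. ennreal \<bar>(LINT y|lborel. F y * \<rho> (y - x)) - F x\<bar> \<partial>lebesgue)"
    proof (rule nn_integral_mono_AE, use AE in eventually_elim)
      fix x assume "F0 x = F x"
      then show "ennreal \<bar>(LINT y|lebesgue. f y * \<rho> (y - x)) - f x\<bar> * indicator (ball a R) x
          \<le> ennreal \<bar>(LINT y|lborel. F y * \<rho> (y - x)) - F x\<bar>"
        using eq[of x] by (auto simp: F0_def split: split_indicator split_indicator_asm)
    qed
    also have "\<dots> = (\<integral>\<^sup>+x. ennreal \<bar>(LINT y|lborel. F y * \<rho> (y - x)) - F x\<bar> \<partial>lborel)"
      by (rule nn_integral_completion)
    also have "\<dots> \<le> ennreal e"
      using B by (intro d(2)[of _ B] \<rho>) (auto simp: abs_le_iff)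
    finally show "(\<integral>\<^sup>+x\<in>ball a R. ennreal \<bar>(LINT y|lebesgue. f y * \<rho> (y - x)) - f x\<bar> \<partial>lebesgue) \<le> ennreal e" .
  qed
qed

text \<open>A single mollifier serves f and its gradient: its radius is the least of those required
  by f and by the finitely many \<open>G i\<close>, and the gradient of the convolution is the
  convolution of the weak gradient.\<close>

lemma C1_approximation:
  fixes f :: "real^'n \<Rightarrow> real"
  assumes w: "\<And>i. has_weak_partial f i (G i)" and e: "e > 0"
  shows "\<exists>\<phi>. C_k 1 \<phi> \<and> (\<integral>\<^sup>+y\<in>ball a R. ennreal \<bar>\<phi> y - f y\<bar> \<partial>lebesgue) \<le> ennreal e \<and>
    (\<forall>i. (\<integral>\<^sup>+y\<in>ball a R. ennreal \<bar>partial i \<phi> y - G i y\<bar> \<partial>lebesgue) \<le> ennreal e)"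
proof -
  have f: "locally_integrable f" and G: "\<And>i. locally_integrable (G i)"
    using w by (auto simp: has_weak_partial_def)
  obtain d0 where d0: "d0 > 0" "\<And>\<rho>. mollifier d0 \<rho> \<Longrightarrow>
      (\<integral>\<^sup>+x\<in>ball a R. ennreal \<bar>(LINT y|lebesgue. f y * \<rho> (y - x)) - f x\<bar> \<partial>lebesgue) \<le> ennreal e"
    using mollification_local[OF f e] by blast
  have "\<forall>i. \<exists>d. d > 0 \<and> (\<forall>\<rho>. mollifier d \<rho> \<longrightarrow>
      (\<integral>\<^sup>+x\<in>ball a R. ennreal \<bar>(LINT y|lebesgue. G i y * \<rho> (y - x)) - G i x\<bar> \<partial>lebesgue) \<le> ennreal e)"
    using mollification_local[OF G e] by blast
  from choice[OF this] obtain D where D: "\<And>i. D i > 0" "\<And>i \<rho>. mollifier (D i) \<rho> \<Longrightarrow>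
      (\<integral>\<^sup>+x\<in>ball a R. ennreal \<bar>(LINT y|lebesgue. G i y * \<rho> (y - x)) - G i x\<bar> \<partial>lebesgue) \<le> ennreal e"
    by blast
  define d where "d = Min (insert d0 (range D))"
  have d: "d > 0" "d \<le> d0" "\<And>i. d \<le> D i"
    unfolding d_def by (simp add: d0(1) D(1), (rule Min_le; simp)+)
  obtain \<rho> where \<rho>: "mollifier d (\<rho> :: real^'n \<Rightarrow> real)"
    using ex_mollifier[OF d(1)] by blast
  then have sm: "smooth_fun \<rho>" "\<And>y. \<rho> y \<noteq> 0 \<Longrightarrow> norm y < d" by (auto simp: mollifier_def)
  define \<phi> where "\<phi> x = (LINT y|lebesgue. f y * \<rho> (y - x))" for x
  have "C_k 1 \<phi>"
    unfolding \<phi>_def by (rule C1_convolution[OF f sm])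
  moreover have "(\<integral>\<^sup>+y\<in>ball a R. ennreal \<bar>\<phi> y - f y\<bar> \<partial>lebesgue) \<le> ennreal e"
    unfolding \<phi>_def by (rule d0(2)[OF mollifier_mono[OF \<rho> d(2)]])
  moreover have "(\<integral>\<^sup>+y\<in>ball a R. ennreal \<bar>partial i \<phi> y - G i y\<bar> \<partial>lebesgue) \<le> ennreal e" for i
  proof -
    have "partial i \<phi> x = (LINT y|lebesgue. G i y * \<rho> (y - x))" for x
      using partial_convolution_weak[OF w[of i] sm, of x] unfolding \<phi>_def .
    then show ?thesis
      using D(2)[OF mollifier_mono[OF \<rho> d(3)[of i]]] by (simp only:)
  qed
  ultimately show ?thesis by blast
qed

text \<open>Convolutions of g and h with a mollifier agree, both being the partial derivative of the
  convolution of f. Hence the mollified difference is 0, while mollifications approach g - h in the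
  mean on each ball.\<close>

lemma weak_partial_unique:
  fixes f :: "real^'n \<Rightarrow> real"
  assumes g: "has_weak_partial f i g" and h: "has_weak_partial f i h"
  shows "AE y in lebesgue. g y = h y"
proof -
  have lg: "locally_integrable g" and lh: "locally_integrable h"
    using g h by (auto simp: has_weak_partial_def)
  note l = locally_integrable_diff[OF lg lh]
  have "AE y in lebesgue. y \<in> ball 0 (real R) \<longrightarrow> g y = h y" for R :: nat
  proof -
    \<comment> \<open>The summand 0 fits the shape required by
      \<open>ennreal_le_epsilon\<close>.\<close>
    have *: "(\<integral>\<^sup>+y\<in>ball 0 (real R). ennreal \<bar>g y - h y\<bar> \<partial>lebesgue) \<le> 0 + ennreal e" if e: "e > 0" for e
    proof -
      obtain d where d: "d > 0" "\<And>\<rho>. mollifier d \<rho> \<Longrightarrow>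
        (\<integral>\<^sup>+x\<in>ball 0 (real R). ennreal \<bar>(LINT y|lebesgue. (g y - h y) * \<rho> (y - x)) - (g x - h x)\<bar> \<partial>lebesgue) \<le> ennreal e"
        using mollification_local[OF l e] by blast
      obtain \<rho> where \<rho>: "mollifier d (\<rho> :: real^'n \<Rightarrow> real)"
        using ex_mollifier[OF d(1)] by blast
      then have sm: "smooth_fun \<rho>" "\<And>y. \<rho> y \<noteq> 0 \<Longrightarrow> norm y < d" by (auto simp: mollifier_def)
      obtain B where B: "\<And>y. \<bar>\<rho> y\<bar> \<le> B"
        using continuous_compact_support_bounded[OF smooth_fun_continuous[OF sm(1)] less_imp_le[OF sm(2)]] by metis
      have [measurable]: "\<rho> \<in> borel_measurable borel"
        by (rule borel_measurable_continuous_onI[OF smooth_fun_continuous[OF sm(1)]])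
      have int: "integrable lebesgue (\<lambda>y. u y * \<rho> (y - x))" if "locally_integrable u" for u x
      proof (rule locally_integrable_mult[OF that, of _ B "d + norm x"])
        show "norm y \<le> d + norm x" if "\<rho> (y - x) \<noteq> 0" for y
          using sm(2)[OF that] norm_triangle_ineq[of "y - x" x] by simp
      qed (use B in auto)
      have "(LINT y|lebesgue. (g y - h y) * \<rho> (y - x)) = 0" for x
        using partial_convolution_weak[OF g sm, of x] partial_convolution_weak[OF h sm, of x]
        by (simp add: left_diff_distrib int lg lh)
      then show ?thesis
        using d(2)[OF \<rho>] by (simp add: abs_minus_commute)
    qed
    have "(\<integral>\<^sup>+y\<in>ball 0 (real R). ennreal \<bar>g y - h y\<bar> \<partial>lebesgue) \<le> 0"
      by (rule ennreal_le_epsilon) (use * in auto)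
    then have "(\<integral>\<^sup>+y\<in>ball 0 (real R). ennreal \<bar>g y - h y\<bar> \<partial>lebesgue) = 0" by simp
    moreover have "(\<lambda>y. ennreal \<bar>g y - h y\<bar> * indicator (ball 0 (real R)) y) \<in> borel_measurable lebesgue"
    proof -
      note [measurable] = locally_integrable_measurable[OF l]
      have [measurable]: "ball 0 (real R) \<in> sets (lebesgue :: (real^'n) measure)" by simp
      show ?thesis by measurable
    qed
    ultimately have "AE y in lebesgue. ennreal \<bar>g y - h y\<bar> * indicator (ball 0 (real R)) y = 0"
      by (simp add: nn_integral_0_iff_AE)
    then show ?thesis
      by eventually_elim (auto simp: indicator_def)
  qed
  then have "AE y in lebesgue. \<forall>R::nat. y \<in> ball 0 (real R) \<longrightarrow> g y = h y"
    by (subst AE_all_countable) blast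
  then show ?thesis
  proof eventually_elim
    case (elim y)
    obtain R :: nat where "norm y < R" using reals_Archimedean2 by blast
    with elim show ?case by auto
  qed
qed

section \<open>Sphere traces\<close>

lemma tendsto_of_ennreal_bound:
  fixes a :: "nat \<Rightarrow> real"
  assumes "\<And>k. ennreal \<bar>a k - l\<bar> \<le> e k" "e \<longlonglongrightarrow> 0"
  shows "a \<longlonglongrightarrow> l"
proof -
  have "(\<lambda>k. ennreal \<bar>a k - l\<bar>) \<longlonglongrightarrow> 0"
    by (rule tendsto_sandwich[OF _ _ tendsto_const assms(2)]) (use assms(1) in auto)
  then have "(\<lambda>k. \<bar>a k - l\<bar>) \<longlonglongrightarrow> 0"
    by (subst (asm) ennreal_tendsto_0_iff) auto
  then show ?thesis
    by (simp add: tendsto_rabs_zero_iff LIM_zero_iff)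
qed

lemma ennreal_integral_diff_le:
  fixes f g :: "'a \<Rightarrow> real"
  assumes "integrable M f" "integrable M g"
  shows "ennreal \<bar>(LINT y|M. f y) - (LINT y|M. g y)\<bar> \<le> (\<integral>\<^sup>+y. ennreal \<bar>f y - g y\<bar> \<partial>M)"
  using integral_norm_bound_ennreal[of M "\<lambda>y. f y - g y"] assms by simp

lemma component_measurable_lebesgue: "(\<lambda>y::real^'n. (y - x) $ i) \<in> borel_measurable lebesgue"
  by (rule lebesgue_measurable_of_borel) simp

lemma radial_div_measurable:
  fixes f :: "real^'n \<Rightarrow> real"
  assumes "f \<in> borel_measurable lebesgue" "\<And>i. G i \<in> borel_measurable lebesgue"
  shows "radial_div x f G \<in> borel_measurable lebesgue"
  unfolding radial_div_def
  by (intro borel_measurable_add borel_measurable_times borel_measurable_const borel_measurable_sum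
      component_measurable_lebesgue assms)

lemma integrable_radial_div:
  fixes f :: "real^'n \<Rightarrow> real"
  assumes f: "locally_integrable f" and G: "\<And>i. locally_integrable (G i)"
  shows "integrable lebesgue (\<lambda>y. indicator (ball x t) y * radial_div x f G y)"
proof -
  have "integrable lebesgue (\<lambda>y. (y - x) $ i * (indicator (ball x t) y * G i y))" for i
  proof (rule Bochner_Integration.integrable_bound)
    show "integrable lebesgue (\<lambda>y. t * (indicator (ball x t) y * G i y))"
      by (intro integrable_mult_right locally_integrable_ball G)
    show "(\<lambda>y. (y - x) $ i * (indicator (ball x t) y * G i y)) \<in> borel_measurable lebesgue"
      by (intro borel_measurable_times component_measurable_lebesgue borel_measurable_integrable
          locally_integrable_ball G)
    show "AE y in lebesgue. norm ((y - x) $ i * (indicator (ball x t) y * G i y)) \<le> norm (t * (indicator (ball x t) y * G i y))"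
    proof (rule AE_I2)
      fix y
      show "norm ((y - x) $ i * (indicator (ball x t) y * G i y)) \<le> norm (t * (indicator (ball x t) y * G i y))"
        using component_le_norm_cart[of "y - x" i]
        by (auto simp: abs_mult dist_norm norm_minus_commute intro!: mult_right_mono split: split_indicator)
    qed
  qed
  then have "integrable lebesgue (\<lambda>y. real CARD('n) * (indicator (ball x t) y * f y) +
      (\<Sum>i\<in>UNIV. (y - x) $ i * (indicator (ball x t) y * G i y)))"
    by (intro Bochner_Integration.integrable_add integrable_mult_right locally_integrable_ball f
        Bochner_Integration.integrable_sum)
  then show ?thesis
    by (rule Bochner_Integration.integrable_cong[THEN iffD1, rotated -1])
      (auto simp: radial_div_def distrib_left sum_distrib_left mult_ac)
qed

text \<open>\<open>radial_div\<close> is linear in the pair of function and gradient, and on the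
  ball each coordinate of y - x is at most t in absolute value.\<close>

lemma radial_div_L1_le:
  fixes f \<phi> :: "real^'n \<Rightarrow> real"
  assumes m: "f \<in> borel_measurable lebesgue" "\<And>i. G i \<in> borel_measurable lebesgue"
      "\<phi> \<in> borel_measurable lebesgue" "\<And>i. P i \<in> borel_measurable lebesgue"
    and t: "0 \<le> t"
  shows "(\<integral>\<^sup>+y\<in>ball x t. ennreal \<bar>radial_div x \<phi> P y - radial_div x f G y\<bar> \<partial>lebesgue) \<le>
    ennreal (real CARD('n)) * (\<integral>\<^sup>+y\<in>ball x t. ennreal \<bar>\<phi> y - f y\<bar> \<partial>lebesgue) +
    (\<Sum>i\<in>UNIV. ennreal t * (\<integral>\<^sup>+y\<in>ball x t. ennreal \<bar>P i y - G i y\<bar> \<partial>lebesgue))"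
proof -
  note [measurable] = m
  have [measurable]: "ball x t \<in> sets lebesgue" by simp
  have "(\<integral>\<^sup>+y\<in>ball x t. ennreal \<bar>radial_div x \<phi> P y - radial_div x f G y\<bar> \<partial>lebesgue) \<le>
      (\<integral>\<^sup>+y. ennreal (real CARD('n)) * (ennreal \<bar>\<phi> y - f y\<bar> * indicator (ball x t) y) +
        (\<Sum>i\<in>UNIV. ennreal t * (ennreal \<bar>P i y - G i y\<bar> * indicator (ball x t) y)) \<partial>lebesgue)"
  proof (rule nn_integral_mono)
    fix y
    show "ennreal \<bar>radial_div x \<phi> P y - radial_div x f G y\<bar> * indicator (ball x t) y \<le>
      ennreal (real CARD('n)) * (ennreal \<bar>\<phi> y - f y\<bar> * indicator (ball x t) y) +
        (\<Sum>i\<in>UNIV. ennreal t * (ennreal \<bar>P i y - G i y\<bar> * indicator (ball x t) y))"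
    proof (cases "y \<in> ball x t")
      case True
      have "radial_div x \<phi> P y - radial_div x f G y =
          real CARD('n) * (\<phi> y - f y) + (\<Sum>i\<in>UNIV. (y - x) $ i * (P i y - G i y))"
        by (simp add: radial_div_def algebra_simps sum_subtractf sum.distrib)
      also have "\<bar>\<dots>\<bar> \<le> real CARD('n) * \<bar>\<phi> y - f y\<bar> + (\<Sum>i\<in>UNIV. t * \<bar>P i y - G i y\<bar>)"
      proof (intro order_trans[OF abs_triangle_ineq] add_mono order_trans[OF sum_abs] sum_mono)
        fix i
        show "\<bar>(y - x) $ i * (P i y - G i y)\<bar> \<le> t * \<bar>P i y - G i y\<bar>"
          using component_le_norm_cart[of "y - x" i] True
          by (auto simp: abs_mult dist_norm norm_minus_commute intro!: mult_right_mono)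
      qed (simp add: abs_mult)
      finally have "ennreal \<bar>radial_div x \<phi> P y - radial_div x f G y\<bar> \<le>
          ennreal (real CARD('n) * \<bar>\<phi> y - f y\<bar> + (\<Sum>i\<in>UNIV. t * \<bar>P i y - G i y\<bar>))"
        by (rule ennreal_leI)
      also have "\<dots> = ennreal (real CARD('n)) * ennreal \<bar>\<phi> y - f y\<bar> + (\<Sum>i\<in>UNIV. ennreal t * ennreal \<bar>P i y - G i y\<bar>)"
        using t by (simp add: ennreal_mult sum_nonneg ennreal_plus flip: sum_ennreal)
      finally show ?thesis using True by simp
    qed simp
  qed
  also have "\<dots> = ennreal (real CARD('n)) * (\<integral>\<^sup>+y\<in>ball x t. ennreal \<bar>\<phi> y - f y\<bar> \<partial>lebesgue) +
    (\<Sum>i\<in>UNIV. ennreal t * (\<integral>\<^sup>+y\<in>ball x t. ennreal \<bar>P i y - G i y\<bar> \<partial>lebesgue))"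
    by (simp add: nn_integral_add nn_integral_sum nn_integral_cmult)
  finally show ?thesis .
qed

lemma continuous_locally_integrable:
  fixes \<phi> :: "real^'n \<Rightarrow> real"
  assumes "continuous_on UNIV \<phi>"
  shows "locally_integrable \<phi>"
  unfolding locally_integrable_def set_integrable_def
proof (intro allI impI)
  fix K :: "(real^'n) set" assume K: "compact K"
  have m: "\<phi> \<in> borel_measurable borel" using assms by (rule borel_measurable_continuous_onI)
  have "integrable lborel (\<lambda>y. indicator K y *\<^sub>R \<phi> y)"
    by (rule borel_integrable_compact[OF K]) (use assms continuous_on_subset in auto)
  then show "integrable lebesgue (\<lambda>y. indicator K y *\<^sub>R \<phi> y)"
    by (subst integrable_completion) auto
qed

lemma integral_ball_lebesgue:
  fixes D :: "real^'n \<Rightarrow> real"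
  assumes "continuous_on UNIV D"
  shows "(LINT y|lebesgue. indicator (ball x t) y * D y) = (LINT y|lborel. indicator (ball x t) y * D y)"
  using borel_measurable_continuous_onI[OF assms] by (intro integral_completion) simp

lemma integrable_sphere_continuous:
  fixes \<phi> :: "real^'n \<Rightarrow> real"
  assumes \<phi>: "continuous_on UNIV \<phi>" and t: "0 \<le> t"
  shows "integrable (sphere_measure x t) \<phi>"
proof -
  have [measurable]: "\<phi> \<in> borel_measurable borel" using \<phi> by (rule borel_measurable_continuous_onI)
  \<comment> \<open>The closed ball rather than the sphere, since \<open>sgn 0 = 0\<close> sends z =
    0 to the centre.\<close>
  have "bounded (\<phi> ` cball x t)"
    by (intro compact_imp_bounded compact_continuous_image continuous_on_subset[OF \<phi>]) auto
  then obtain B where B: "\<And>y. y \<in> cball x t \<Longrightarrow> \<bar>\<phi> y\<bar> \<le> B"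
    unfolding bounded_iff by (auto simp del: mem_cball)
  have "integrable lborel (\<lambda>z. sphere_density t z * \<phi> (x + t *\<^sub>R sgn z))"
  proof (rule Bochner_Integration.integrable_bound)
    show "integrable lborel (\<lambda>z::real^'n. sphere_density t z * B)"
      by (rule integrable_mult_left[OF integrable_sphere_density])
    show "AE z in lborel. norm (sphere_density t z * \<phi> (x + t *\<^sub>R sgn z)) \<le> norm (sphere_density t z * B)"
    proof (rule AE_I2)
      fix z :: "real^'n"
      have "\<bar>\<phi> (x + t *\<^sub>R sgn z)\<bar> \<le> \<bar>B\<bar>"
        using B[of "x + t *\<^sub>R sgn z"] t by (cases "z = 0") (auto simp: dist_norm norm_sgn)
      then show "norm (sphere_density t z * \<phi> (x + t *\<^sub>R sgn z)) \<le> norm (sphere_density t z * B)"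
        by (simp add: abs_mult mult_left_mono)
    qed
  qed simp
  then show ?thesis by (simp add: integrable_sphere_measure[OF _ t])
qed

text \<open>By the divergence theorem this is the integral over the sphere of the trace of \<open>f\<close>, if \<open>G\<close> is
  the weak gradient of \<open>f\<close>; it does not refer to the trace and is continuous in the radius.\<close>

definition surface_integral :: "real^'n \<Rightarrow> (real^'n \<Rightarrow> real) \<Rightarrow> ('n \<Rightarrow> real^'n \<Rightarrow> real) \<Rightarrow> real \<Rightarrow> real" where
  "surface_integral x f G t = (LINT y|lebesgue. indicator (ball x t) y * radial_div x f G y) / t"

lemma surface_integral_C1:
  assumes "C_k 1 \<phi>" "0 < t"
  shows "(LINT y|sphere_measure x t. \<phi> y) = surface_integral x \<phi> (\<lambda>i. partial i \<phi>) t"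
  using sphere_integral_divergence[OF assms, of x] assms(2)
  unfolding surface_integral_def integral_ball_lebesgue[OF continuous_radial_div[OF assms(1)]]
  by (simp add: field_simps)

lemma C1_locally_integrable:
  assumes "C_k 1 \<phi>"
  shows "locally_integrable \<phi>" "locally_integrable (partial i \<phi>)"
  using assms by (auto intro!: continuous_locally_integrable C1_continuous C1_partial_continuous simp del: C_k.simps One_nat_def)

text \<open>The bound is explicit in the radius: it gives the limit on a single sphere and, where
  1/t stays bounded, a uniform estimate over an annulus.\<close>

lemma surface_integral_diff_le:
  fixes f \<phi> :: "real^'n \<Rightarrow> real"
  assumes f: "locally_integrable f" "\<And>i. locally_integrable (G i)"
    and \<phi>: "locally_integrable \<phi>" "\<And>i. locally_integrable (P i)" and t: "0 < t"
  shows "ennreal \<bar>surface_integral x \<phi> P t - surface_integral x f G t\<bar> \<le>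
    ennreal (1 / t) * (ennreal (real CARD('n)) * (\<integral>\<^sup>+y\<in>ball x t. ennreal \<bar>\<phi> y - f y\<bar> \<partial>lebesgue) +
    (\<Sum>i\<in>UNIV. ennreal t * (\<integral>\<^sup>+y\<in>ball x t. ennreal \<bar>P i y - G i y\<bar> \<partial>lebesgue)))"
proof -
  let ?I = "\<lambda>f G. LINT y|lebesgue. indicator (ball x t) y * radial_div x f G y"
  have "ennreal \<bar>?I \<phi> P - ?I f G\<bar> \<le> (\<integral>\<^sup>+y. ennreal \<bar>indicator (ball x t) y * radial_div x \<phi> P y - indicator (ball x t) y * radial_div x f G y\<bar> \<partial>lebesgue)"
    by (intro ennreal_integral_diff_le integrable_radial_div assms)
  also have "\<dots> = (\<integral>\<^sup>+y\<in>ball x t. ennreal \<bar>radial_div x \<phi> P y - radial_div x f G y\<bar> \<partial>lebesgue)"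
    by (intro nn_integral_cong) (auto split: split_indicator)
  also have "\<dots> \<le> ennreal (real CARD('n)) * (\<integral>\<^sup>+y\<in>ball x t. ennreal \<bar>\<phi> y - f y\<bar> \<partial>lebesgue) +
    (\<Sum>i\<in>UNIV. ennreal t * (\<integral>\<^sup>+y\<in>ball x t. ennreal \<bar>P i y - G i y\<bar> \<partial>lebesgue))"
    using t by (intro radial_div_L1_le locally_integrable_measurable assms) simp
  finally have *: "ennreal \<bar>?I \<phi> P - ?I f G\<bar> \<le> \<dots>" .
  have eq: "\<bar>surface_integral x \<phi> P t - surface_integral x f G t\<bar> = 1 / t * \<bar>?I \<phi> P - ?I f G\<bar>"
    using t by (simp add: surface_integral_def diff_divide_distrib[symmetric] abs_divide)
  have "ennreal \<bar>surface_integral x \<phi> P t - surface_integral x f G t\<bar> = ennreal (1 / t) * ennreal \<bar>?I \<phi> P - ?I f G\<bar>"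
    unfolding eq by (rule ennreal_mult) (use t in simp_all)
  then show ?thesis
    using * by (simp add: mult_left_mono)
qed

text \<open>The surface integrals of the approximants have two limits: the integral of g, by
  convergence on the sphere, and the surface integral formed with the gradient H of the trace, by
  convergence in the ball. So all traces have the same integral.\<close>

lemma integral_sphere_trace:
  fixes f :: "real^'n \<Rightarrow> real"
  assumes w: "\<And>i. has_weak_partial f i (G i)" and t: "0 < t" and g: "is_sphere_trace f x t g"
  shows "(LINT y|sphere_measure x t. g y) = surface_integral x f G t"
proof -
  from g obtain H \<phi> where g': "integrable (sphere_measure x t) g"
    and H: "\<And>i. has_weak_partial f i (H i)" and \<phi>: "\<And>k. C_k 1 (\<phi> k)"
    and 1: "(\<lambda>k. \<integral>\<^sup>+y\<in>ball x t. ennreal \<bar>\<phi> k y - f y\<bar> \<partial>lebesgue) \<longlonglongrightarrow> 0"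
    and 2: "\<And>i. (\<lambda>k. \<integral>\<^sup>+y\<in>ball x t. ennreal \<bar>partial i (\<phi> k) y - H i y\<bar> \<partial>lebesgue) \<longlonglongrightarrow> 0"
    and 3: "(\<lambda>k. \<integral>\<^sup>+y. ennreal \<bar>\<phi> (k::nat) y - g y\<bar> \<partial>sphere_measure x t) \<longlonglongrightarrow> 0"
    unfolding is_sphere_trace_def by blast
  have lf: "locally_integrable f" "\<And>i. locally_integrable (H i)" "\<And>i. locally_integrable (G i)"
    using H w by (auto simp: has_weak_partial_def)
  have "(\<lambda>k. LINT y|sphere_measure x t. \<phi> k y) \<longlonglongrightarrow> (LINT y|sphere_measure x t. g y)"
    by (rule tendsto_of_ennreal_bound[OF ennreal_integral_diff_le 3])
      (use g' integrable_sphere_continuous[OF C1_continuous[OF \<phi>] less_imp_le[OF t]] in auto)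
  moreover have "(\<lambda>k. LINT y|sphere_measure x t. \<phi> k y) \<longlonglongrightarrow> surface_integral x f H t"
    unfolding surface_integral_C1[OF \<phi> t]
  proof (rule tendsto_of_ennreal_bound[OF surface_integral_diff_le[OF lf(1,2) C1_locally_integrable[OF \<phi>] t]])
    have "(\<lambda>k. ennreal (1 / t) * (ennreal (real CARD('n)) * (\<integral>\<^sup>+y\<in>ball x t. ennreal \<bar>\<phi> k y - f y\<bar> \<partial>lebesgue) +
      (\<Sum>i\<in>UNIV. ennreal t * (\<integral>\<^sup>+y\<in>ball x t. ennreal \<bar>partial i (\<phi> k) y - H i y\<bar> \<partial>lebesgue)))) \<longlonglongrightarrow>
      ennreal (1 / t) * (ennreal (real CARD('n)) * 0 + (\<Sum>i\<in>(UNIV::'n set). ennreal t * 0))"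
      by (intro ennreal_tendsto_cmult tendsto_add tendsto_sum 1 2) auto
    then show "(\<lambda>k. ennreal (1 / t) * (ennreal (real CARD('n)) * (\<integral>\<^sup>+y\<in>ball x t. ennreal \<bar>\<phi> k y - f y\<bar> \<partial>lebesgue) +
      (\<Sum>i\<in>UNIV. ennreal t * (\<integral>\<^sup>+y\<in>ball x t. ennreal \<bar>partial i (\<phi> k) y - H i y\<bar> \<partial>lebesgue)))) \<longlonglongrightarrow> 0"
      by simp
  qed
  ultimately have "(LINT y|sphere_measure x t. g y) = surface_integral x f H t"
    by (rule LIMSEQ_unique)
  also have "\<dots> = surface_integral x f G t"
  proof -
    \<comment> \<open>H is the gradient hidden in the definition of the trace. It agrees with G
      almost everywhere, which suffices for the solid integral.\<close>
    have "AE y in lebesgue. \<forall>i\<in>UNIV. H i y = G i y"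
      by (rule AE_finite_allI) (auto intro: weak_partial_unique[OF H w])
    then have "AE y in lebesgue. indicator (ball x t) y * radial_div x f H y = indicator (ball x t) y * radial_div x f G y"
      by eventually_elim (simp add: radial_div_def)
    then have "(LINT y|lebesgue. indicator (ball x t) y * radial_div x f H y) =
        (LINT y|lebesgue. indicator (ball x t) y * radial_div x f G y)"
      by (intro integral_cong_AE borel_measurable_integrable integrable_radial_div lf)
    then show ?thesis by (simp add: surface_integral_def)
  qed
  finally show ?thesis .
qed

section \<open>Existence of traces\<close>

lemma
  assumes "C_k 1 \<phi>" "C_k 1 \<psi>"
  shows C1_diff: "C_k 1 (\<lambda>y. \<phi> y - \<psi> y)"
    and partial_diff: "partial i (\<lambda>y. \<phi> y - \<psi> y) y = partial i \<phi> y - partial i \<psi> y"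
proof -
  have "((\<lambda>y. \<phi> y - \<psi> y) has_derivative (\<lambda>h. \<Sum>i\<in>UNIV. h $ i * (partial i \<phi> y - partial i \<psi> y))) (at y)" for y
    using has_derivative_diff[OF has_derivative_partial[of \<phi> y] has_derivative_partial[of \<psi> y]] assms
    by (simp add: right_diff_distrib sum_subtractf)
  note D = this
  show p: "partial i (\<lambda>y. \<phi> y - \<psi> y) y = partial i \<phi> y - partial i \<psi> y" for i y
    by (rule partial_eqI[OF D])
  then have "partial i (\<lambda>y. \<phi> y - \<psi> y) = (\<lambda>y. partial i \<phi> y - partial i \<psi> y)" for i
    by (intro ext)
  moreover have "continuous_on UNIV (\<lambda>y. partial i \<phi> y - partial i \<psi> y)" for i
    by (intro continuous_on_diff C1_partial_continuous assms)
  ultimately show "C_k 1 (\<lambda>y. \<phi> y - \<psi> y)"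
    using D by (auto simp: differentiable_def)
qed

text \<open>Completeness of L1 of the sphere, carried out directly. The approximants converge at a
  geometric rate in the ball, the trace inequality carries this rate to their successive differences
  on the sphere, and the telescoping series converges almost everywhere and in the mean; its sum is
  the trace.\<close>

lemma ex_sphere_trace:
  fixes f :: "real^'n \<Rightarrow> real" and t :: real
  assumes w: "\<And>i. has_weak_partial f i (G i)" and t: "0 < t"
  shows "\<exists>g. is_sphere_trace f x t g"
proof -
  let ?M = "sphere_measure x t"
  let ?N = "real CARD('n)"
  have lf: "locally_integrable f" "\<And>i. locally_integrable (G i)"
    using w by (auto simp: has_weak_partial_def)
  have "\<forall>k. \<exists>\<phi>. C_k 1 \<phi> \<and> (\<integral>\<^sup>+y\<in>ball x t. ennreal \<bar>\<phi> y - f y\<bar> \<partial>lebesgue) \<le> ennreal ((1/2) ^ k) \<and>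
    (\<forall>i. (\<integral>\<^sup>+y\<in>ball x t. ennreal \<bar>partial i \<phi> y - G i y\<bar> \<partial>lebesgue) \<le> ennreal ((1/2) ^ k))"
    by (intro allI C1_approximation[OF w]) simp
  from choice[OF this] obtain \<phi> where \<phi>: "\<And>k. C_k 1 (\<phi> k)"
    and \<phi>f: "\<And>k. (\<integral>\<^sup>+y\<in>ball x t. ennreal \<bar>\<phi> k y - f y\<bar> \<partial>lebesgue) \<le> ennreal ((1/2) ^ k)"
    and \<phi>G: "\<And>k i. (\<integral>\<^sup>+y\<in>ball x t. ennreal \<bar>partial i (\<phi> k) y - G i y\<bar> \<partial>lebesgue) \<le> ennreal ((1/2) ^ k)"
    by blast
  have int\<phi>: "integrable ?M (\<phi> k)" for k
    by (rule integrable_sphere_continuous[OF C1_continuous[OF \<phi>] less_imp_le[OF t]])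
  define u where "u k y = \<phi> (Suc k) y - \<phi> k y" for k y
  have u: "C_k 1 (u k)" for k
    unfolding u_def by (rule C1_diff[OF \<phi> \<phi>])
  have intu: "integrable ?M (u k)" for k
    unfolding u_def by (intro Bochner_Integration.integrable_diff int\<phi>)
  define R where "R k = radial_div x (\<phi> k) (\<lambda>i. partial i (\<phi> k))" for k
  define R' where "R' = radial_div x f G"
  have R: "R k \<in> borel_measurable lebesgue" "R' \<in> borel_measurable lebesgue" for k
    unfolding R_def R'_def by (intro radial_div_measurable locally_integrable_measurable lf C1_locally_integrable \<phi>)+
  have Rm: "(\<lambda>y. ennreal \<bar>R k y - R' y\<bar> * indicator (ball x t) y) \<in> borel_measurable lebesgue" for k
  proof -
    have "ball x t \<in> sets lebesgue" by simp
    note [measurable] = R this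
    show ?thesis by measurable
  qed
  have RL: "(\<integral>\<^sup>+y\<in>ball x t. ennreal \<bar>R k y - R' y\<bar> \<partial>lebesgue) \<le> ennreal ((?N + ?N * t) * (1/2) ^ k)" for k
  proof -
    have "(\<integral>\<^sup>+y\<in>ball x t. ennreal \<bar>R k y - R' y\<bar> \<partial>lebesgue) \<le>
        ennreal ?N * (\<integral>\<^sup>+y\<in>ball x t. ennreal \<bar>\<phi> k y - f y\<bar> \<partial>lebesgue) +
        (\<Sum>i\<in>UNIV. ennreal t * (\<integral>\<^sup>+y\<in>ball x t. ennreal \<bar>partial i (\<phi> k) y - G i y\<bar> \<partial>lebesgue))"
      unfolding R_def R'_def
      by (intro radial_div_L1_le locally_integrable_measurable lf C1_locally_integrable \<phi> less_imp_le[OF t])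
    also have "\<dots> \<le> ennreal ?N * ennreal ((1/2) ^ k) + (\<Sum>i\<in>(UNIV::'n set). ennreal t * ennreal ((1/2) ^ k))"
      by (intro add_mono mult_left_mono sum_mono \<phi>f \<phi>G) simp_all
    also have "\<dots> = ennreal ?N * ennreal ((1/2) ^ k) + ennreal (?N * (t * (1/2) ^ k))"
      using t by (simp add: ennreal_mult ennreal_of_nat_eq_real_of_nat)
    also have "\<dots> = ennreal (?N * (1/2) ^ k + ?N * (t * (1/2) ^ k))"
      using t by (simp add: ennreal_mult)
    finally show ?thesis by (simp add: algebra_simps)
  qed
  \<comment> \<open>The trace inequality for \<open>u k\<close>, whose radial divergence is R (Suc
    k) - R k; both terms are compared with the limit R'. The two errors add up to the factor 3/2,
    rounded up to 2.\<close>
  have uL: "(LINT y|?M. \<bar>u k y\<bar>) \<le> 2 * (?N + ?N * t) / t * (1/2) ^ k" for k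
  proof -
    let ?D = "radial_div x (u k) (\<lambda>i. partial i (u k))"
    have D: "?D y = R (Suc k) y - R k y" for y
      unfolding R_def radial_div_def
      by (simp add: u_def[abs_def] partial_diff[OF \<phi> \<phi>] algebra_simps sum_subtractf sum.distrib del: C_k.simps)
    have cD: "continuous_on UNIV (\<lambda>y. \<bar>?D y\<bar>)"
      by (intro continuous_on_rabs continuous_radial_div u)
    have "t * (LINT y|?M. \<bar>u k y\<bar>) \<le> (LINT y|lborel. indicator (ball x t) y * \<bar>?D y\<bar>)"
      by (rule sphere_trace_inequality[OF u t])
    also have "\<dots> = (LINT y|lebesgue. indicator (ball x t) y * \<bar>?D y\<bar>)"
      by (rule integral_ball_lebesgue[OF cD, symmetric])
    finally have "ennreal (t * (LINT y|?M. \<bar>u k y\<bar>)) \<le> ennreal (LINT y|lebesgue. indicator (ball x t) y * \<bar>?D y\<bar>)"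
      by (rule ennreal_leI)
    also have "\<dots> = (\<integral>\<^sup>+y. ennreal (indicator (ball x t) y * \<bar>?D y\<bar>) \<partial>lebesgue)"
      by (rule nn_integral_eq_integral[symmetric])
        (use locally_integrable_ball[OF continuous_locally_integrable[OF cD]] in auto)
    also have "\<dots> \<le> (\<integral>\<^sup>+y. ennreal \<bar>R (Suc k) y - R' y\<bar> * indicator (ball x t) y + ennreal \<bar>R k y - R' y\<bar> * indicator (ball x t) y \<partial>lebesgue)"
      by (intro nn_integral_mono) (auto simp: D ennreal_plus[symmetric] simp del: ennreal_plus split: split_indicator intro!: ennreal_leI)
    also have "\<dots> = (\<integral>\<^sup>+y\<in>ball x t. ennreal \<bar>R (Suc k) y - R' y\<bar> \<partial>lebesgue) + (\<integral>\<^sup>+y\<in>ball x t. ennreal \<bar>R k y - R' y\<bar> \<partial>lebesgue)"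
      by (rule nn_integral_add) (rule Rm)+
    also have "\<dots> \<le> ennreal ((?N + ?N * t) * (1/2) ^ Suc k) + ennreal ((?N + ?N * t) * (1/2) ^ k)"
      by (intro add_mono RL)
    also have "\<dots> = ennreal ((?N + ?N * t) * (1/2) ^ Suc k + (?N + ?N * t) * (1/2) ^ k)"
      using t by (intro ennreal_plus[symmetric]) auto
    also have "\<dots> \<le> ennreal (2 * (?N + ?N * t) * (1/2) ^ k)"
      using t by (intro ennreal_leI) (simp add: field_simps)
    finally have "t * (LINT y|?M. \<bar>u k y\<bar>) \<le> 2 * (?N + ?N * t) * (1/2) ^ k"
      by (subst (asm) ennreal_le_iff) (use t in auto)
    then show ?thesis using t by (simp add: field_simps)
  qed
  have sumL: "summable (\<lambda>k. LINT y|?M. norm (u k y))"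
  proof (rule summable_comparison_test')
    show "summable (\<lambda>k. 2 * (?N + ?N * t) / t * (1/2::real) ^ k)"
      by (intro summable_mult summable_geometric) simp
    show "norm (LINT y|?M. norm (u k y)) \<le> 2 * (?N + ?N * t) / t * (1/2) ^ k" for k
      using uL[of k] by simp
  qed
  have sumAE: "AE y in ?M. summable (\<lambda>k. norm (u k y))"
  proof -
    \<comment> \<open>The integral of the sum is the finite sum of the integrals, so the sum itself
      is finite almost everywhere.\<close>
    have "(\<integral>\<^sup>+y. (\<Sum>k. ennreal (norm (u k y))) \<partial>?M) = (\<Sum>k. \<integral>\<^sup>+y. ennreal (norm (u k y)) \<partial>?M)"
      using intu by (intro nn_integral_suminf) (auto dest: borel_measurable_integrable)
    also have "\<dots> = (\<Sum>k. ennreal (LINT y|?M. norm (u k y)))"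
      using intu by (intro suminf_cong nn_integral_eq_integral integrable_norm) auto
    also have "\<dots> = ennreal (\<Sum>k. LINT y|?M. norm (u k y))"
      by (rule suminf_ennreal2[OF _ sumL]) simp
    finally have fin: "(\<integral>\<^sup>+y. (\<Sum>k. ennreal (norm (u k y))) \<partial>?M) \<noteq> \<infinity>" by simp
    have m: "(\<lambda>y. \<Sum>k. ennreal (norm (u k y))) \<in> borel_measurable ?M"
      using intu by (intro borel_measurable_suminf_order measurable_compose[OF _ measurable_ennreal] borel_measurable_norm) auto
    show ?thesis
      using nn_integral_PInf_AE[OF m fin] by eventually_elim (auto intro!: summable_suminf_not_top)
  qed
  \<comment> \<open>Off the null set where the series need not converge, this is the pointwise limit
    of \<open>\<phi> k\<close>; values on that null set do not affect the integrals.\<close>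
  define g where "g y = \<phi> 0 y + (\<Sum>k. u k y)" for y
  have intg: "integrable ?M g"
    unfolding g_def by (intro Bochner_Integration.integrable_add int\<phi> integrable_suminf intu sumAE sumL)
  \<comment> \<open>The majorant for dominated convergence: by telescoping, its first two terms
    bound |\<open>\<phi> k\<close>| for all k.\<close>
  have intw: "integrable ?M (\<lambda>y. \<bar>\<phi> 0 y\<bar> + (\<Sum>k. norm (u k y)) + \<bar>g y\<bar>)"
    by (intro Bochner_Integration.integrable_add integrable_abs int\<phi> intg integrable_suminf)
      (use intu sumAE sumL in auto)
  have tel: "\<phi> k y = \<phi> 0 y + (\<Sum>j<k. u j y)" for k y
    using sum_lessThan_telescope[of "\<lambda>j. \<phi> j y" k] by (simp add: u_def)
  have "(\<lambda>k. LINT y|?M. \<bar>\<phi> k y - g y\<bar>) \<longlonglongrightarrow> (LINT y|?M. 0)"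
  proof (rule integral_dominated_convergence[OF _ _ intw])
    show "AE y in ?M. (\<lambda>k. \<bar>\<phi> k y - g y\<bar>) \<longlonglongrightarrow> 0"
      using sumAE
    proof eventually_elim
      case (elim y)
      from summable_LIMSEQ[OF summable_norm_cancel[OF elim]]
      have "(\<lambda>k. \<phi> 0 y + (\<Sum>j<k. u j y)) \<longlonglongrightarrow> g y"
        unfolding g_def by (intro tendsto_intros)
      then show ?case
        unfolding tel[symmetric] by (intro tendsto_rabs_zero) (simp add: LIM_zero_iff)
    qed
    show "AE y in ?M. norm \<bar>\<phi> k y - g y\<bar> \<le> \<bar>\<phi> 0 y\<bar> + (\<Sum>k. norm (u k y)) + \<bar>g y\<bar>" for k
      using sumAE
    proof eventually_elim
      case (elim y)
      have "\<bar>\<phi> k y\<bar> \<le> \<bar>\<phi> 0 y\<bar> + (\<Sum>j<k. norm (u j y))"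
        unfolding tel[of k y] by (intro order_trans[OF abs_triangle_ineq] add_mono sum_abs[THEN order_trans]) auto
      moreover have "(\<Sum>j<k. norm (u j y)) \<le> (\<Sum>j. norm (u j y))"
        by (rule sum_le_suminf[OF elim]) auto
      ultimately show ?case by simp
    qed
  qed (use int\<phi> intg in auto)
  then have L0: "(\<lambda>k. LINT y|?M. \<bar>\<phi> k y - g y\<bar>) \<longlonglongrightarrow> 0" by simp
  have "(\<integral>\<^sup>+y. ennreal \<bar>\<phi> k y - g y\<bar> \<partial>?M) = ennreal (LINT y|?M. \<bar>\<phi> k y - g y\<bar>)" for k
    using int\<phi> intg by (intro nn_integral_eq_integral) auto
  then have 3: "(\<lambda>k. \<integral>\<^sup>+y. ennreal \<bar>\<phi> k y - g y\<bar> \<partial>?M) \<longlonglongrightarrow> 0"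
    using tendsto_ennrealI[OF L0] by simp
  have half: "(\<lambda>k. ennreal ((1/2) ^ k)) \<longlonglongrightarrow> 0"
    using tendsto_ennrealI[OF LIMSEQ_power_zero[of "1/2::real"]] by simp
  have 1: "(\<lambda>k. \<integral>\<^sup>+y\<in>ball x t. ennreal \<bar>\<phi> k y - f y\<bar> \<partial>lebesgue) \<longlonglongrightarrow> 0"
    by (rule tendsto_sandwich[OF _ _ tendsto_const half]) (use \<phi>f in auto)
  have 2: "(\<lambda>k. \<integral>\<^sup>+y\<in>ball x t. ennreal \<bar>partial i (\<phi> k) y - G i y\<bar> \<partial>lebesgue) \<longlonglongrightarrow> 0" for i
    by (rule tendsto_sandwich[OF _ _ tendsto_const half]) (use \<phi>G in auto)
  show "\<exists>g. is_sphere_trace f x t g"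
  proof (rule exI[of _ g])
    show "is_sphere_trace f x t g"
      unfolding is_sphere_trace_def using intg w \<phi> 1 2 3 by blast
  qed
qed

text \<open>Existence makes the \<open>SOME\<close> in \<open>sphere_trace\<close> meaningful, and
  \<open>integral_sphere_trace\<close> removes the dependence on its choice. From here on traces no
  longer occur.\<close>

lemma sphere_avg_eq:
  fixes f :: "real^'n \<Rightarrow> real" and t :: real
  assumes w: "\<And>i. has_weak_partial f i (G i)" and t: "0 < t"
  shows "sphere_avg f x t = surface_integral x f G t /
    (CARD('n) * t ^ (CARD('n) - 1) * measure lborel (ball 0 1 :: (real^'n) set))"
proof -
  have "is_sphere_trace f x t (sphere_trace f x t)"
    unfolding sphere_trace_def by (rule someI_ex[OF ex_sphere_trace[OF w t]])
  from integral_sphere_trace[OF w t this] show ?thesis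
    unfolding sphere_avg_def measure_sphere_measure[OF less_imp_le[OF t]] by simp
qed

text \<open>As the radii converge to r, the indicators of the balls converge off the sphere of
  radius r, which is negligible. All real radii are covered; continuity at 0 says that integrals
  over shrinking balls tend to 0.\<close>

lemma continuous_integral_ball:
  fixes F :: "'a::euclidean_space \<Rightarrow> real"
  assumes F: "\<And>r. integrable lebesgue (\<lambda>y. indicator (ball x r) y * F y)"
  shows "continuous_on UNIV (\<lambda>r. LINT y|lebesgue. indicator (ball x r) y * F y)"
  unfolding continuous_on_sequentially comp_def
proof (intro ballI allI impI, elim conjE)
  fix r and X :: "nat \<Rightarrow> real" assume X: "X \<longlonglongrightarrow> r"
  obtain M where M: "\<And>j. \<bar>X j\<bar> \<le> M"
    using convergent_imp_Bseq[OF convergentI[OF X]] by (auto simp: Bseq_def)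
  have ae: "AE y in lebesgue. y \<notin> sphere x r"
    by (rule AE_not_in[OF negligible_sphere[unfolded negligible_iff_null_sets]])
  show "(\<lambda>j. LINT y|lebesgue. indicator (ball x (X j)) y * F y) \<longlonglongrightarrow> (LINT y|lebesgue. indicator (ball x r) y * F y)"
  proof (rule integral_dominated_convergence[where w="\<lambda>y. \<bar>indicator (ball x (M + 1)) y * F y\<bar>"])
    show "AE y in lebesgue. (\<lambda>j. indicator (ball x (X j)) y * F y) \<longlonglongrightarrow> indicator (ball x r) y * F y"
      using ae
    proof eventually_elim
      case (elim y)
      then consider "dist x y < r" | "r < dist x y" by force
      then have "\<forall>\<^sub>F j in sequentially. indicator (ball x (X j)) y * F y = indicator (ball x r) y * F y"
      proof cases
        case 1
        from order_tendstoD(1)[OF X this] show ?thesis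
          by eventually_elim (use 1 in \<open>simp add: indicator_def\<close>)
      next
        case 2
        from order_tendstoD(2)[OF X this] show ?thesis
          by eventually_elim (use 2 in \<open>simp add: indicator_def\<close>)
      qed
      then show ?case by (rule tendsto_eventually)
    qed
    show "AE y in lebesgue. norm (indicator (ball x (X j)) y * F y) \<le> \<bar>indicator (ball x (M + 1)) y * F y\<bar>" for j
      using M[of j] by (intro AE_I2) (auto split: split_indicator)
  qed (use F in \<open>auto dest: borel_measurable_integrable\<close>)
qed

text \<open>The source of measurability of the spherical averages in the radius.\<close>

lemma continuous_surface_integral:
  fixes f :: "real^'n \<Rightarrow> real"
  assumes f: "locally_integrable f" and G: "\<And>i. locally_integrable (G i)"
  shows "continuous_on {0<..} (surface_integral x f G)"
  unfolding surface_integral_def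
  by (intro continuous_on_divide continuous_on_subset[OF continuous_integral_ball] continuous_on_id
      integrable_radial_div assms) auto

section \<open>Spherical and solid averages\<close>

lemma integrable_continuous_Ico:
  fixes h :: "real \<Rightarrow> real"
  assumes h: "continuous_on {0<..} h" and e: "0 < e"
  shows "integrable lborel (\<lambda>r. indicator {e..<t} r * h r)"
proof (rule Bochner_Integration.integrable_bound)
  show "integrable lborel (\<lambda>r. indicator {e..t} r *\<^sub>R h r)"
    by (rule borel_integrable_compact) (use e in \<open>auto intro!: continuous_on_subset[OF h]\<close>)
  have "(\<lambda>r. indicator {e..<t} r *\<^sub>R h r) \<in> borel_measurable borel"
    by (rule borel_measurable_continuous_on_indicator) (use e in \<open>auto intro!: continuous_on_subset[OF h]\<close>)
  then show "(\<lambda>r. indicator {e..<t} r * h r) \<in> borel_measurable lborel" by simp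
qed (auto split: split_indicator)

text \<open>For continuously differentiable functions these are polar coordinates. Both sides pass
  to the limit: the ball integrals by convergence in the mean, the left side because 1/r stays below
  1/e on the annulus and the surface integrals converge uniformly there.\<close>

lemma integral_surface_integral:
  fixes f :: "real^'n \<Rightarrow> real"
  assumes w: "\<And>i. has_weak_partial f i (G i)" and e: "0 < e" "e \<le> t"
  shows "(LINT r|lborel. indicator {e..<t} r * surface_integral x f G r) =
    (LINT y|lebesgue. indicator (ball x t) y * f y) - (LINT y|lebesgue. indicator (ball x e) y * f y)"
proof -
  let ?N = "real CARD('n)"
  have t: "0 < t" using e by simp
  have lf: "locally_integrable f" "\<And>i. locally_integrable (G i)"
    using w by (auto simp: has_weak_partial_def)
  have "\<forall>k. \<exists>\<phi>. C_k 1 \<phi> \<and> (\<integral>\<^sup>+y\<in>ball x t. ennreal \<bar>\<phi> y - f y\<bar> \<partial>lebesgue) \<le> ennreal ((1/2) ^ k) \<and>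
    (\<forall>i. (\<integral>\<^sup>+y\<in>ball x t. ennreal \<bar>partial i \<phi> y - G i y\<bar> \<partial>lebesgue) \<le> ennreal ((1/2) ^ k))"
    by (intro allI C1_approximation[OF w]) simp
  from choice[OF this] obtain \<phi> where \<phi>: "\<And>k. C_k 1 (\<phi> k)"
    and \<phi>f: "\<And>k. (\<integral>\<^sup>+y\<in>ball x t. ennreal \<bar>\<phi> k y - f y\<bar> \<partial>lebesgue) \<le> ennreal ((1/2) ^ k)"
    and \<phi>G: "\<And>k i. (\<integral>\<^sup>+y\<in>ball x t. ennreal \<bar>partial i (\<phi> k) y - G i y\<bar> \<partial>lebesgue) \<le> ennreal ((1/2) ^ k)"
    by blast
  have half: "(\<lambda>k. ennreal ((1/2) ^ k)) \<longlonglongrightarrow> 0"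
    using tendsto_ennrealI[OF LIMSEQ_power_zero[of "1/2::real"]] by simp
  \<comment> \<open>Approximation on the largest ball controls all smaller radii.\<close>
  have sub: "(\<integral>\<^sup>+y\<in>ball x r. h y \<partial>lebesgue) \<le> (\<integral>\<^sup>+y\<in>ball x t. h y \<partial>lebesgue)" if "r \<le> t" for r h
    using that by (intro nn_integral_mono) (auto split: split_indicator)
  define A where "A = surface_integral x f G"
  define B where "B k = surface_integral x (\<phi> k) (\<lambda>i. partial i (\<phi> k))" for k
  have cA: "continuous_on {0<..} A" "continuous_on {0<..} (B k)" for k
    unfolding A_def B_def by (intro continuous_surface_integral lf C1_locally_integrable \<phi>)+
  have ball: "(\<lambda>k. LINT y|lebesgue. indicator (ball x r) y * \<phi> k y) \<longlonglongrightarrow> (LINT y|lebesgue. indicator (ball x r) y * f y)"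
    if r: "r \<le> t" for r
  proof (rule tendsto_of_ennreal_bound[OF _ half])
    fix k
    have "ennreal \<bar>(LINT y|lebesgue. indicator (ball x r) y * \<phi> k y) - (LINT y|lebesgue. indicator (ball x r) y * f y)\<bar>
        \<le> (\<integral>\<^sup>+y. ennreal \<bar>indicator (ball x r) y * \<phi> k y - indicator (ball x r) y * f y\<bar> \<partial>lebesgue)"
      by (intro ennreal_integral_diff_le locally_integrable_ball lf C1_locally_integrable \<phi>)
    also have "\<dots> = (\<integral>\<^sup>+y\<in>ball x r. ennreal \<bar>\<phi> k y - f y\<bar> \<partial>lebesgue)"
      by (intro nn_integral_cong) (auto split: split_indicator)
    also have "\<dots> \<le> ennreal ((1/2) ^ k)"
      by (rule order_trans[OF sub[OF r] \<phi>f])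
    finally show "ennreal \<bar>(LINT y|lebesgue. indicator (ball x r) y * \<phi> k y) - (LINT y|lebesgue. indicator (ball x r) y * f y)\<bar> \<le> ennreal ((1/2) ^ k)" .
  qed
  have "(LINT r|lborel. indicator {e..<t} r * B k r) =
      (LINT y|lebesgue. indicator (ball x t) y * \<phi> k y) - (LINT y|lebesgue. indicator (ball x e) y * \<phi> k y)" for k
  proof -
    have "(LINT r|lborel. indicator {e..<t} r * B k r) =
        (LINT r|lborel. indicator {e..<t} r * (LINT y|sphere_measure x r. \<phi> k y))"
      unfolding B_def using e
      by (intro Bochner_Integration.integral_cong refl) (auto simp: surface_integral_C1[OF \<phi>] split: split_indicator)
    then show ?thesis
      unfolding integral_ball_lebesgue[OF C1_continuous[OF \<phi>]]
      using sphere_integral_annulus[OF C1_continuous[OF \<phi>] e] by simp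
  qed
  then have "(\<lambda>k. LINT r|lborel. indicator {e..<t} r * B k r) \<longlonglongrightarrow>
      (LINT y|lebesgue. indicator (ball x t) y * f y) - (LINT y|lebesgue. indicator (ball x e) y * f y)"
    using tendsto_diff[OF ball[OF order_refl] ball[OF e(2)]] by simp
  moreover have "(\<lambda>k. LINT r|lborel. indicator {e..<t} r * B k r) \<longlonglongrightarrow> (LINT r|lborel. indicator {e..<t} r * A r)"
  proof (rule tendsto_of_ennreal_bound)
    \<comment> \<open>A bound free of r, from 1/r \<le> 1/e and r \<le> t.\<close>
    let ?c = "\<lambda>k. ennreal (1 / e) * (ennreal ?N * ennreal ((1/2) ^ k) + (\<Sum>i\<in>(UNIV::'n set). ennreal t * ennreal ((1/2) ^ k)))"
    show "ennreal \<bar>(LINT r|lborel. indicator {e..<t} r * B k r) - (LINT r|lborel. indicator {e..<t} r * A r)\<bar>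
      \<le> ?c k * ennreal (t - e)" for k
    proof -
      have "ennreal \<bar>(LINT r|lborel. indicator {e..<t} r * B k r) - (LINT r|lborel. indicator {e..<t} r * A r)\<bar>
        \<le> (\<integral>\<^sup>+r. ennreal \<bar>indicator {e..<t} r * B k r - indicator {e..<t} r * A r\<bar> \<partial>lborel)"
        by (intro ennreal_integral_diff_le integrable_continuous_Ico cA e)
      also have "\<dots> \<le> (\<integral>\<^sup>+r. ?c k * indicator {e..<t} r \<partial>lborel)"
      proof (rule nn_integral_mono)
        fix r
        show "ennreal \<bar>indicator {e..<t} r * B k r - indicator {e..<t} r * A r\<bar> \<le> ?c k * indicator {e..<t} r"
        proof (cases "r \<in> {e..<t}")
          case True
          then have r: "e \<le> r" "r \<le> t" "0 < r" using e by auto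
          have "ennreal \<bar>B k r - A r\<bar> \<le> ennreal (1 / r) * (ennreal ?N * (\<integral>\<^sup>+y\<in>ball x r. ennreal \<bar>\<phi> k y - f y\<bar> \<partial>lebesgue) +
              (\<Sum>i\<in>UNIV. ennreal r * (\<integral>\<^sup>+y\<in>ball x r. ennreal \<bar>partial i (\<phi> k) y - G i y\<bar> \<partial>lebesgue)))"
            unfolding A_def B_def by (intro surface_integral_diff_le lf C1_locally_integrable \<phi> r)
          also have "\<dots> \<le> ?c k"
          proof (intro mult_mono add_mono sum_mono)
            show "ennreal (1 / r) \<le> ennreal (1 / e)"
              using r e by (intro ennreal_leI) (simp add: frac_le)
            show "(\<integral>\<^sup>+y\<in>ball x r. ennreal \<bar>\<phi> k y - f y\<bar> \<partial>lebesgue) \<le> ennreal ((1/2) ^ k)"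
              by (rule order_trans[OF sub[OF r(2)] \<phi>f])
            show "(\<integral>\<^sup>+y\<in>ball x r. ennreal \<bar>partial i (\<phi> k) y - G i y\<bar> \<partial>lebesgue) \<le> ennreal ((1/2) ^ k)" for i
              by (rule order_trans[OF sub[OF r(2)] \<phi>G])
          qed (use r in \<open>auto intro: ennreal_leI\<close>)
          finally show ?thesis using True by simp
        qed simp
      qed
      also have "\<dots> = ?c k * ennreal (t - e)"
        using e by (subst nn_integral_cmult_indicator) auto
      finally show ?thesis .
    qed
    have "(\<lambda>k. ennreal (t - e) * ?c k) \<longlonglongrightarrow> ennreal (t - e) * (ennreal (1 / e) *
        (ennreal ?N * 0 + (\<Sum>i\<in>(UNIV::'n set). ennreal t * 0)))"
      by (intro ennreal_tendsto_cmult tendsto_add tendsto_sum half) auto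
    then show "(\<lambda>k. ?c k * ennreal (t - e)) \<longlonglongrightarrow> 0"
      by (simp add: mult.commute)
  qed
  ultimately show ?thesis
    unfolding A_def using LIMSEQ_unique by blast
qed

text \<open>With m the weighted integral of a, this is the nonnegativity of the integral of w (a -
  m)^2. The total mass is allowed to be below 1 because an annulus misses the mass
  \<open>e ^ n / t ^ n\<close> of the inner ball.\<close>

lemma weighted_jensen:
  fixes a w :: "'a \<Rightarrow> real"
  assumes int: "integrable M w" "integrable M (\<lambda>r. w r * a r)" "integrable M (\<lambda>r. w r * (a r)\<^sup>2)"
    and nn: "\<And>r. r \<in> space M \<Longrightarrow> 0 \<le> w r" and W: "(LINT r|M. w r) \<le> 1"
  shows "(LINT r|M. w r * a r)\<^sup>2 \<le> (LINT r|M. w r * (a r)\<^sup>2)"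
proof -
  define m where "m = (LINT r|M. w r * a r)"
  have "0 \<le> (LINT r|M. w r * (a r - m)\<^sup>2)"
    using nn by (intro Bochner_Integration.integral_nonneg) auto
  also have "\<dots> = (LINT r|M. w r * (a r)\<^sup>2 - 2 * m * (w r * a r) + m\<^sup>2 * w r)"
    by (intro Bochner_Integration.integral_cong) (auto simp: power2_eq_square algebra_simps)
  also have "\<dots> = (LINT r|M. w r * (a r)\<^sup>2) - 2 * m * m + m\<^sup>2 * (LINT r|M. w r)"
    using int by (simp add: m_def)
  also have "m\<^sup>2 * (LINT r|M. w r) \<le> m\<^sup>2 * 1"
    using W by (intro mult_left_mono) auto
  finally show ?thesis by (simp add: m_def power2_eq_square)
qed

lemma ball_avg_eq:
  fixes f :: "real^'n \<Rightarrow> real" and t :: real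
  assumes "0 < t"
  shows "ball_avg f x t = (LINT y|lebesgue. indicator (ball x t) y * f y) /
    (t ^ CARD('n) * measure lborel (ball 0 1 :: (real^'n) set))"
  using assms content_ball_conv_unit_ball[of t x]
  by (simp add: ball_avg_def set_lebesgue_integral_def)

text \<open>The annuli \<open>e \<le> r < t\<close> avoid the question whether the spherical averages are integrable near \<open>r = 0\<close>.\<close>

lemma sq_ball_avg_le:
  fixes f :: "real^'n \<Rightarrow> real" and t v :: real
  assumes w: "\<And>i. has_weak_partial f i (G i)" and t: "0 < t"
  shows "ennreal (\<bar>v - ball_avg f x t\<bar>\<^sup>2) \<le> (\<integral>\<^sup>+(r::real). indicator {0<..<t} r *
    ennreal (real CARD('n) * r ^ (CARD('n) - 1) / t ^ CARD('n) * \<bar>v - sphere_avg f x r\<bar>\<^sup>2) \<partial>lborel)" (is "_ \<le> ?R")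
proof -
  let ?N = "CARD('n)"
  let ?c = "measure lborel (ball 0 1 :: (real^'n) set)"
  let ?I = "\<lambda>r::real. LINT y|lebesgue. indicator (ball x r) y * f y"
  let ?w = "\<lambda>r::real. real ?N * r ^ (?N - 1) / t ^ ?N"
  have c: "?c > 0" by (rule content_ball_pos) simp
  have lf: "locally_integrable f" "\<And>i. locally_integrable (G i)"
    using w by (auto simp: has_weak_partial_def)
  \<comment> \<open>A continuous expression that agrees with \<open>v - sphere_avg f x r\<close> for
    positive radii.\<close>
  define a :: "real \<Rightarrow> real" where "a r = v - surface_integral x f G r / (real ?N * r ^ (?N - 1) * ?c)" for r :: real
  have a: "v - sphere_avg f x r = a r" if "0 < r" for r :: real
    using sphere_avg_eq[OF w that] by (simp add: a_def)
  have ca: "continuous_on {0<..} a"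
    unfolding a_def using c
    by (intro continuous_intros continuous_surface_integral lf) auto
  \<comment> \<open>The weighted integral of a over e \<le> r < t in closed form: v times the mass
    of the weight, minus the normalised integral of f over the solid annulus.\<close>
  define m :: "real \<Rightarrow> real" where "m e = v * (1 - e ^ ?N / t ^ ?N) - (?I t - ?I e) / (t ^ ?N * ?c)" for e :: real
  have m_le: "ennreal ((m e)\<^sup>2) \<le> ?R" if e: "0 < e" "e < t" for e
  proof -
    let ?i = "indicator {e..<t} :: real \<Rightarrow> real"
    have int: "integrable lborel (\<lambda>r. ?i r * ?w r)" "integrable lborel (\<lambda>r. ?i r * ?w r * a r)"
      "integrable lborel (\<lambda>r. ?i r * ?w r * (a r)\<^sup>2)"
      unfolding mult.assoc using t e by (intro integrable_continuous_Ico continuous_intros ca; simp)+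
    have W: "(LINT r|lborel. ?i r * ?w r) = 1 - e ^ ?N / t ^ ?N"
    proof -
      have "(LINT r|lborel. indicator {e..t} r *\<^sub>R ?w r) = t ^ ?N / t ^ ?N - e ^ ?N / t ^ ?N"
      proof (rule integral_FTC_Icc)
        fix r
        have "((\<lambda>r. r ^ ?N / t ^ ?N) has_real_derivative ?w r) (at r within {e..t})"
          using t by (auto intro!: derivative_eq_intros)
        then show "((\<lambda>r. r ^ ?N / t ^ ?N) has_vector_derivative ?w r) (at r within {e..t})"
          by (simp add: has_real_derivative_iff_has_vector_derivative)
      qed (use e t in \<open>auto intro!: continuous_intros\<close>)
      moreover have "(LINT r|lborel. ?i r * ?w r) = (LINT r|lborel. indicator {e..t} r *\<^sub>R ?w r)"
      proof (rule integral_cong_AE)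
        have "AE r in lborel. r \<noteq> t" by (rule AE_lborel_singleton)
        then show "AE r in lborel. ?i r * ?w r = indicator {e..t} r *\<^sub>R ?w r"
          by eventually_elim (auto split: split_indicator)
      qed auto
      ultimately show ?thesis using t by simp
    qed
    have "(LINT r|lborel. ?i r * ?w r * a r) =
        (LINT r|lborel. v * (?i r * ?w r) - (?i r * surface_integral x f G r) / (t ^ ?N * ?c))"
    proof (rule Bochner_Integration.integral_cong[OF refl])
      fix r
      show "?i r * ?w r * a r = v * (?i r * ?w r) - (?i r * surface_integral x f G r) / (t ^ ?N * ?c)"
        using e t c by (cases "r \<in> {e..<t}") (auto simp: a_def field_simps)
    qed
    also have "\<dots> = v * (LINT r|lborel. ?i r * ?w r) - (LINT r|lborel. ?i r * surface_integral x f G r) / (t ^ ?N * ?c)"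
    proof -
      have "integrable lborel (\<lambda>r. ?i r * surface_integral x f G r)"
        by (intro integrable_continuous_Ico continuous_surface_integral lf e)
      then have "integrable lborel (\<lambda>r. (?i r * surface_integral x f G r) / (t ^ ?N * ?c))"
        by simp
      from Bochner_Integration.integral_diff[OF integrable_mult_right[OF int(1), of v] this]
      show ?thesis by simp
    qed
    also have "\<dots> = m e"
      unfolding W m_def integral_surface_integral[OF w e(1) less_imp_le[OF e(2)]] ..
    finally have me: "(LINT r|lborel. ?i r * ?w r * a r) = m e" .
    have "(m e)\<^sup>2 \<le> (LINT r|lborel. ?i r * ?w r * (a r)\<^sup>2)"
      unfolding me[symmetric]
    proof (rule weighted_jensen[OF int])
      show "0 \<le> ?i r * ?w r" for r
        using e t by (auto split: split_indicator)
      show "(LINT r|lborel. ?i r * ?w r) \<le> 1"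
        unfolding W using e t by simp
    qed
    then have "ennreal ((m e)\<^sup>2) \<le> ennreal (LINT r|lborel. ?i r * ?w r * (a r)\<^sup>2)"
      by (rule ennreal_leI)
    also have "\<dots> = (\<integral>\<^sup>+r. ennreal (?i r * ?w r * (a r)\<^sup>2) \<partial>lborel)"
      using e t by (intro nn_integral_eq_integral[symmetric] int(3)) (auto split: split_indicator)
    also have "\<dots> \<le> ?R"
      using e t by (intro nn_integral_mono) (auto simp: a split: split_indicator)
    finally show ?thesis .
  qed
  \<comment> \<open>Now e tends to 0: the ball of radius 0 is empty and \<open>0 ^ n = 0\<close>, so
    m e tends to \<open>v - ball_avg f x t\<close>.\<close>
  have "isCont ?I 0"
    using continuous_integral_ball[of x f, OF locally_integrable_ball[OF lf(1)]]
    by (simp add: continuous_on_eq_continuous_at)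
  then have "((\<lambda>e. ?I e) \<longlongrightarrow> ?I 0) (at_right 0)"
    unfolding isCont_def by (rule filterlim_mono[OF _ order_refl at_le]) simp
  then have "(m \<longlongrightarrow> v * (1 - 0 ^ ?N / t ^ ?N) - (?I t - ?I 0) / (t ^ ?N * ?c)) (at_right 0)"
    unfolding m_def using t c by (intro tendsto_intros) auto
  then have "(m \<longlongrightarrow> v - ball_avg f x t) (at_right 0)"
    by (simp add: ball_avg_eq[OF t] zero_power[OF zero_less_card_finite])
  then have "((\<lambda>e. ennreal ((m e)\<^sup>2)) \<longlongrightarrow> ennreal ((v - ball_avg f x t)\<^sup>2)) (at_right 0)"
    by (intro tendsto_intros)
  moreover have "\<forall>\<^sub>F e in at_right 0. ennreal ((m e)\<^sup>2) \<le> ?R"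
    using eventually_at_right_real[OF t] by eventually_elim (rule m_le; simp)
  ultimately have "ennreal ((v - ball_avg f x t)\<^sup>2) \<le> ?R"
    by (rule tendsto_upperbound) simp
  then show ?thesis by simp
qed

section \<open>The square functions\<close>

text \<open>Tonelli on the region 0 < r < t, at a fixed centre x. The number v stands for the value
  of f at x, which plays no part in the averages.\<close>

lemma square_function_le:
  fixes f :: "real^'n \<Rightarrow> real" and v :: real
  assumes w: "\<And>i. has_weak_partial f i (G i)"
  shows "(\<integral>\<^sup>+t\<in>{0<..}. ennreal (\<bar>v - ball_avg f x t\<bar>\<^sup>2 / t ^ 3) \<partial>lebesgue) \<le>
    ennreal (real CARD('n) / (real CARD('n) + 2)) * (\<integral>\<^sup>+t\<in>{0<..}. ennreal (\<bar>v - sphere_avg f x t\<bar>\<^sup>2 / t ^ 3) \<partial>lebesgue)"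
proof -
  let ?N = "CARD('n)"
  let ?c = "measure lborel (ball 0 1 :: (real^'n) set)"
  have c: "?c > 0" by (rule content_ball_pos) simp
  have lf: "locally_integrable f" "\<And>i. locally_integrable (G i)"
    using w by (auto simp: has_weak_partial_def)
  \<comment> \<open>A Borel function that equals \<open>v - sphere_avg f x r\<close> for r > 0 and
    is set to 0 elsewhere; it carries the measurability needed for Tonelli.\<close>
  define b :: "real \<Rightarrow> real" where "b r = indicator {0<..} r *\<^sub>R (v - surface_integral x f G r / (real ?N * r ^ (?N - 1) * ?c))" for r
  have [measurable]: "b \<in> borel_measurable borel"
    unfolding b_def using c
    by (intro borel_measurable_continuous_on_indicator continuous_intros continuous_surface_integral lf) auto
  have b: "v - sphere_avg f x r = b r" if "0 < r" for r :: real
    using sphere_avg_eq[OF w that] that by (simp add: b_def)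
  have [measurable]: "(\<lambda>p::real \<times> real. indicator {fst p<..} (snd p) :: ennreal) \<in> borel_measurable (borel \<Otimes>\<^sub>M borel)"
    unfolding indicator_def of_bool_def greaterThan_iff by measurable
  \<comment> \<open>Chosen so that (n + 2) q = n: the kernel in t then has the shape
    \<open>(n + 2) / t ^ (n + 3)\<close> of \<open>nn_integral_inverse_power_tail\<close>.\<close>
  let ?q = "real ?N / (real ?N + 2)"
  let ?h = "\<lambda>(t::real) (r::real). indicator {r<..} t * ennreal (real (?N + 2) / t ^ Suc (?N + 2)) *
      (indicator {0<..} r * ennreal (?q * r ^ (?N - 1) * (b r)\<^sup>2))"
  have "(\<integral>\<^sup>+t\<in>{0<..}. ennreal (\<bar>v - ball_avg f x t\<bar>\<^sup>2 / t ^ 3) \<partial>lebesgue) =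
      (\<integral>\<^sup>+t\<in>{0<..}. ennreal (\<bar>v - ball_avg f x t\<bar>\<^sup>2 / t ^ 3) \<partial>lborel)"
    by (rule nn_integral_completion)
  also have "\<dots> \<le> (\<integral>\<^sup>+t. \<integral>\<^sup>+r. ?h t r \<partial>lborel \<partial>lborel)"
  proof (rule nn_integral_mono)
    fix t :: real
    show "ennreal (\<bar>v - ball_avg f x t\<bar>\<^sup>2 / t ^ 3) * indicator {0<..} t \<le> (\<integral>\<^sup>+r. ?h t r \<partial>lborel)"
    proof (cases "0 < t")
      case True
      have "ennreal (\<bar>v - ball_avg f x t\<bar>\<^sup>2 / t ^ 3) = ennreal (1 / t ^ 3) * ennreal (\<bar>v - ball_avg f x t\<bar>\<^sup>2)"
        using True by (subst ennreal_mult[symmetric]) auto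
      also have "\<dots> \<le> ennreal (1 / t ^ 3) * (\<integral>\<^sup>+r. indicator {0<..<t} r *
          ennreal (real ?N * r ^ (?N - 1) / t ^ ?N * \<bar>v - sphere_avg f x r\<bar>\<^sup>2) \<partial>lborel)"
        by (intro mult_left_mono sq_ball_avg_le[OF w True]) simp
      also have "\<dots> = ennreal (1 / t ^ 3) * (\<integral>\<^sup>+r. indicator {0<..<t} r *
          ennreal (real ?N * r ^ (?N - 1) / t ^ ?N * (b r)\<^sup>2) \<partial>lborel)"
      proof (rule arg_cong2[where f="(*)", OF refl], rule nn_integral_cong)
        fix r :: real
        show "indicator {0<..<t} r * ennreal (real ?N * r ^ (?N - 1) / t ^ ?N * \<bar>v - sphere_avg f x r\<bar>\<^sup>2) =
            indicator {0<..<t} r * ennreal (real ?N * r ^ (?N - 1) / t ^ ?N * (b r)\<^sup>2)"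
          by (cases "0 < r") (simp_all add: b)
      qed
      also have "\<dots> = (\<integral>\<^sup>+r. ennreal (1 / t ^ 3) * (indicator {0<..<t} r *
          ennreal (real ?N * r ^ (?N - 1) / t ^ ?N * (b r)\<^sup>2)) \<partial>lborel)"
        by (rule nn_integral_cmult[symmetric]) measurable
      also have "\<dots> = (\<integral>\<^sup>+r. ?h t r \<partial>lborel)"
      proof (rule nn_integral_cong)
        fix r :: real
        show "ennreal (1 / t ^ 3) * (indicator {0<..<t} r * ennreal (real ?N * r ^ (?N - 1) / t ^ ?N * (b r)\<^sup>2)) = ?h t r"
        proof (cases "0 < r \<and> r < t")
          case r: True
          have "1 / t ^ 3 * (?N * r ^ (?N - 1) / t ^ ?N * (b r)\<^sup>2) =
              real (?N + 2) / t ^ Suc (?N + 2) * (?q * r ^ (?N - 1) * (b r)\<^sup>2)"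
          proof -
            \<comment> \<open>The rearrangement is proved for abstract reals, so that simplification
              cannot take the powers apart.\<close>
            have "1 / a * (n * p / s * y) = d / (s * a) * (q * p * y)" if "d * q = n" for a n p s y d q :: real
              by (simp add: that[symmetric] mult_ac)
            moreover have "real (?N + 2) * ?q = real ?N" by (simp add: field_simps)
            moreover have "t ^ Suc (?N + 2) = t ^ ?N * t ^ 3" by (simp add: power3_eq_cube)
            ultimately show ?thesis by (simp only:)
          qed
          then have "ennreal (1 / t ^ 3) * ennreal (real ?N * r ^ (?N - 1) / t ^ ?N * (b r)\<^sup>2) =
              ennreal (real (?N + 2) / t ^ Suc (?N + 2)) * ennreal (?q * r ^ (?N - 1) * (b r)\<^sup>2)"
            by (intro trans[OF ennreal_mult[symmetric] trans[OF arg_cong[where f=ennreal] ennreal_mult]])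
              (use r True in auto)
          then show ?thesis using r by simp
        qed (use True in \<open>auto split: split_indicator\<close>)
      qed
      finally show ?thesis using True by simp
    qed simp
  qed
  also have "\<dots> = (\<integral>\<^sup>+r. \<integral>\<^sup>+t. ?h t r \<partial>lborel \<partial>lborel)"
    by (rule lborel_pair.Fubini') (simp add: case_prod_unfold del: power_Suc)
  also have "\<dots> = (\<integral>\<^sup>+r. ennreal ?q * (ennreal (\<bar>v - sphere_avg f x r\<bar>\<^sup>2 / r ^ 3) * indicator {0<..} r) \<partial>lborel)"
  proof (rule nn_integral_cong)
    fix r :: real
    show "(\<integral>\<^sup>+t. ?h t r \<partial>lborel) = ennreal ?q * (ennreal (\<bar>v - sphere_avg f x r\<bar>\<^sup>2 / r ^ 3) * indicator {0<..} r)"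
    proof (cases "0 < r")
      case True
      \<comment> \<open>The weight \<open>r ^ (n - 1)\<close> cancels against the tail
        \<open>1 / r ^ (n + 2)\<close> and leaves \<open>1 / r ^ 3\<close>, the weight of the square
        function.\<close>
      have pow: "r ^ (?N + 2) = r ^ (?N - 1) * r ^ 3"
        by (simp add: power_add[symmetric] Suc_leI)
      have tail: "(\<integral>\<^sup>+t. indicator {r<..} t * ennreal (real (?N + 2) / t ^ Suc (?N + 2)) \<partial>lborel) =
          ennreal (1 / r ^ (?N + 2))"
        using True by (rule nn_integral_inverse_power_tail) simp
      have "(\<integral>\<^sup>+t. ?h t r \<partial>lborel) = ennreal (1 / r ^ (?N + 2)) * (indicator {0<..} r * ennreal (?q * r ^ (?N - 1) * (b r)\<^sup>2))"
        unfolding tail[symmetric]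
        by (rule nn_integral_multc) measurable
      also have "\<dots> = ennreal (1 / r ^ (?N + 2) * (?q * r ^ (?N - 1) * (b r)\<^sup>2))"
        using True by (subst ennreal_mult) auto
      also have "1 / r ^ (?N + 2) * (?q * r ^ (?N - 1) * (b r)\<^sup>2) = ?q * ((b r)\<^sup>2 / r ^ 3)"
        unfolding pow using True by (simp add: field_simps)
      also have "ennreal (?q * ((b r)\<^sup>2 / r ^ 3)) = ennreal ?q * ennreal ((b r)\<^sup>2 / r ^ 3)"
        using True by (intro ennreal_mult) auto
      finally show ?thesis using True by (simp add: b)
    qed simp
  qed
  also have "\<dots> = ennreal ?q * (\<integral>\<^sup>+t\<in>{0<..}. ennreal (\<bar>v - sphere_avg f x t\<bar>\<^sup>2 / t ^ 3) \<partial>lborel)"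
  proof (rule nn_integral_cmult)
    have "(\<lambda>r. ennreal (\<bar>v - sphere_avg f x r\<bar>\<^sup>2 / r ^ 3) * indicator {0<..} r) = (\<lambda>r. ennreal ((b r)\<^sup>2 / r ^ 3) * indicator {0<..} r)"
      by (auto simp: fun_eq_iff b split: split_indicator)
    then show "(\<lambda>r. ennreal (\<bar>v - sphere_avg f x r\<bar>\<^sup>2 / r ^ 3) * indicator {0<..} r) \<in> borel_measurable lborel"
      by simp
  qed
  also have "(\<integral>\<^sup>+t\<in>{0<..}. ennreal (\<bar>v - sphere_avg f x t\<bar>\<^sup>2 / t ^ 3) \<partial>lborel) =
      (\<integral>\<^sup>+t\<in>{0<..}. ennreal (\<bar>v - sphere_avg f x t\<bar>\<^sup>2 / t ^ 3) \<partial>lebesgue)"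
    by (rule nn_integral_completion[symmetric])
  finally show ?thesis .
qed

text \<open>If Y is infinite, q > 0 makes the right side infinite; otherwise X is finite as well and
  the claim is monotonicity of the real square root.\<close>

lemma ennreal_sqrt_le_mult:
  assumes "X \<le> ennreal q * Y" "0 < q"
  shows "ennreal_sqrt X \<le> ennreal (sqrt q) * ennreal_sqrt Y"
proof (cases "Y = \<infinity>")
  case True
  then show ?thesis using assms(2) by (simp add: ennreal_sqrt_def ennreal_mult_top)
next
  case False
  then obtain y where y: "Y = ennreal y" "0 \<le> y" by (cases Y) auto
  have "ennreal q * Y < \<infinity>" using y by (simp add: ennreal_mult_less_top)
  then obtain z where z: "X = ennreal z" "0 \<le> z" using assms(1) by (cases X) auto
  have "ennreal z \<le> ennreal (q * y)"
    using assms y z by (simp add: ennreal_mult)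
  then have "z \<le> q * y" using assms(2) y by (subst (asm) ennreal_le_iff) auto
  then have "sqrt z \<le> sqrt q * sqrt y" by (simp add: real_sqrt_mult[symmetric])
  then have "ennreal (sqrt z) \<le> ennreal (sqrt q) * ennreal (sqrt y)"
    using y assms(2) by (simp add: ennreal_mult[symmetric] ennreal_leI)
  then show ?thesis using y z by (simp add: ennreal_sqrt_def)
qed

theorem proposition1p9:
  fixes f :: "real^'n \<Rightarrow> real" and p :: ennreal
  assumes "1 \<le> p"
    and "f \<in> W1p p"
  shows "AE x in lebesgue.
    S_fun f x \<le> ennreal (sqrt (real CARD('n) / (real CARD('n) + 2))) * T_fun f x"
proof (rule AE_I2)
  fix x
  have "\<forall>i. \<exists>g. has_weak_partial f i g"
    using assms(2) by (auto simp: W1p_def)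
  from choice[OF this] obtain G where G: "\<And>i. has_weak_partial f i (G i)" by blast
  show "S_fun f x \<le> ennreal (sqrt (real CARD('n) / (real CARD('n) + 2))) * T_fun f x"
    unfolding S_fun_def T_fun_def
    by (rule ennreal_sqrt_le_mult[OF square_function_le[OF G]]) simp
qed

end
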